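(* Let $\delta\le\kappa\le\lambda$ be uncountable cardinals with $\delta$ regular and $\lambda^{<\delta}=\lambda$. Then $\kappa$ is $(\delta,\lambda)$-compact if and only if for all (equivalently, for some) regular $\theta>\lambda^{<\kappa}$, whenever $M\prec H(\theta)$ is of size $\lambda$ with $\lambda+1\subseteq M$, there is $U$ which is a ${<}\delta$-complete, fine $M$-ultrafilter on $\mathcal P(\mathcal P_\kappa(\lambda))$. Moreover, for such $\theta$ and $M$, the existence of such $U$ is equivalent to the existence of an elementary embedding $j\colon (M,\in)\to (N,\in_N)$ with $\mathrm{crit}\,j\ge\delta$ (but $N$ not necessarily transitive), and a set $D\in N$ with $j[\lambda\cap M]\subseteq D$ (that is, $j(\gamma)\in_N D$ for all $\gamma\in\lambda\cap M$) and $|D|<j(\kappa)$ in $N$.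
   Context: Work in ZFC. $H(\theta)$ is the set of all sets whose transitive closure has size less than $\theta$. Compactness. $\mathcal L_{\delta,\omega}$ denotes the logic extending first-order logic by allowing conjunctions and disjunctions of arbitrary size less than $\delta$, with formulas using only finitely many free variables. For uncountable cardinals $\delta\le\kappa\le\lambda$ with $\delta$ regular, $\kappa$ is $(\delta,\lambda)$-compact if every $\mathcal L_{\delta,\omega}$-theory in a language of size at most $\lambda$, all of whose subsets of size less than $\kappa$ have a model, has a model. Filters. Let $X$ be a set and $F\subseteq E\subseteq\mathcal P(X)$ with $E$ closed under complements in $X$ and $X\in E$. $F$ is a ${<}\delta$-complete filter (on $E$) if: $X\in F$ and $\emptyset\notin F$; whenever $Y,Z\in E$, $Y\supseteq Z$ and $Z\in F$, then $Y\in F$; and whenever $(Y_i)_{i<\mu}$ is a family of elements of $F$ with $\mu<\delta$, then $\bigcap_{i<\mu}Y_i\ne\emptyset$. A filter is a ${<}\omega$-complete filter. $F$ measures $E$ if for every $Y\in E$, $Y\in F$ or $X\setminus Y\in F$. $\mathcal P_\kappa(\lambda)$ is the collection of subsets of $\lambda$ of cardinality less than $\kappa$. A filter $U\subseteq\mathcal P(\mathcal P_\kappa(\lambda))\cap M$ (on $E=\mathcal P(\mathcal P_\kappa(\lambda))\cap M$) is an $M$-ultrafilter on $\mathcal P(\mathcal P_\kappa(\lambda))$ if it measures $\mathcal P(\mathcal P_\kappa(\lambda))\cap M$. It is fine if $\{x\in\mathcal P_\kappa(\lambda)\mid\gamma\in x\}\in U$ for every $\gamma\in\lambda\cap M$.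 For $M\prec H(\theta)$ and an elementary embedding $j\colon(M,\in)\to(N,\in_N)$ with $N$ not necessarily transitive (or well-founded), the critical point $\mathrm{crit}\,j$ (which may or may not exist) is the least ordinal $\gamma\in M$ such that $\{\bar\gamma\in N\mid\bar\gamma\in_N j(\gamma)\}\supsetneq j[\gamma\cap M]$; the statement $\mathrm{crit}\,j\ge\delta$ includes that $\mathrm{crit}\,j$ exists. *)

theory Defs
  imports Main "HOL-Library.Countable_Set" "HOL-Library.Equipollence" "HOL-Library.FuncSet"
begin

text \<open>
  The theorem is stated for a type \<open>'v\<close> that is a universe of ZFC, given by the map \<open>elts\<close>
  taking a set to the HOL set of its elements. As usual in HOL, separation and replacement
  are stated for arbitrary HOL predicates and functions. Hence every HOL subset of \<open>elts x\<close>
  is an element of the universe, and cardinalities can be compared by the library relations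
  \<open>\<approx>\<close>, \<open>\<lesssim>\<close>, \<open>\<prec>\<close> (existence of HOL bijections and injections). The axiom of choice is that
  of HOL.
\<close>

class zfc =
  fixes elts :: "'a \<Rightarrow> 'a set"
  assumes extensionality: "elts x = elts y \<Longrightarrow> x = y"
    and foundation: "wf {(x, y). x \<in> elts y}"
    and pairing: "\<exists>z. elts z = {x, y}"
    and union: "\<exists>u. elts u = (\<Union>y\<in>elts x. elts y)"
    and powerset: "\<exists>p. elts p = {y. elts y \<subseteq> elts x}"
    and infinity: "\<exists>w. (\<exists>z\<in>elts w. elts z = {}) \<and>
                       (\<forall>x\<in>elts w. \<exists>y\<in>elts w. elts y = insert x (elts x))"
    and separation: "\<exists>y. elts y = {z \<in> elts x. P z}"
    and replacement: "\<exists>y. elts y = f ` elts x"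

definition mem :: "'v::zfc \<Rightarrow> 'v \<Rightarrow> bool" where
  "mem x y \<longleftrightarrow> x \<in> elts y"

definition small :: "'v::zfc set \<Rightarrow> bool" where
  "small A \<longleftrightarrow> (\<exists>x. elts x = A)"

text \<open>The element of the universe with the given elements; meaningful for small \<open>A\<close> only.\<close>

definition vset :: "'v::zfc set \<Rightarrow> 'v" where
  "vset A = (THE x. elts x = A)"

lemma vset_elts [simp]: "vset (elts x) = x"
  unfolding vset_def by (rule the_equality) (auto intro: extensionality)

lemma elts_vset: "small A \<Longrightarrow> elts (vset A) = A"
  by (auto simp: small_def)

text \<open>Ordinals are von Neumann ordinals and cardinals are initial ordinals. So for ordinals,
  \<open>\<alpha> < \<beta>\<close> is \<open>\<alpha> \<in> elts \<beta>\<close> and \<open>\<alpha> \<le> \<beta>\<close> is \<open>elts \<alpha> \<subseteq> elts \<beta>\<close>.\<close>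

definition transitive_set :: "'v::zfc \<Rightarrow> bool" where
  "transitive_set x \<longleftrightarrow> (\<forall>y\<in>elts x. elts y \<subseteq> elts x)"

definition Ord :: "'v::zfc \<Rightarrow> bool" where
  "Ord x \<longleftrightarrow> transitive_set x \<and> (\<forall>y\<in>elts x. transitive_set y)"

definition Card :: "'v::zfc \<Rightarrow> bool" where
  "Card \<kappa> \<longleftrightarrow> Ord \<kappa> \<and> (\<forall>\<alpha>\<in>elts \<kappa>. \<not> elts \<alpha> \<approx> elts \<kappa>)"

definition uncountable_Card :: "'v::zfc \<Rightarrow> bool" where
  "uncountable_Card \<kappa> \<longleftrightarrow> Card \<kappa> \<and> uncountable (elts \<kappa>)"

definition omega :: "'v::zfc" where
  "omega = vset {n. Ord n \<and> finite (elts n)}"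

definition regular :: "'v::zfc \<Rightarrow> bool" where
  "regular \<kappa> \<longleftrightarrow> Card \<kappa> \<and> infinite (elts \<kappa>) \<and>
     (\<forall>A\<subseteq>elts \<kappa>. A \<prec> elts \<kappa> \<longrightarrow> (\<exists>\<beta>\<in>elts \<kappa>. \<forall>\<alpha>\<in>A. \<alpha> \<in> elts \<beta>))"

definition vcard :: "'b set \<Rightarrow> 'v::zfc" where
  "vcard A = (THE \<mu>. Card \<mu> \<and> elts \<mu> \<approx> A)"

definition cpower :: "'v::zfc \<Rightarrow> 'v \<Rightarrow> 'v" where
  "cpower lam \<mu> = vcard (elts \<mu> \<rightarrow>\<^sub>E elts lam)"

text \<open>The weak power: the supremum (i.e. union) of the cardinals \<open>lam\<^sup>\<mu>\<close>, \<open>\<mu> < \<kappa>\<close> a cardinal.\<close>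

definition weak_cpower :: "'v::zfc \<Rightarrow> 'v \<Rightarrow> 'v" where
  "weak_cpower lam \<kappa> = vset (\<Union>\<mu>\<in>{\<mu>\<in>elts \<kappa>. Card \<mu>}. elts (cpower lam \<mu>))"

definition trcl :: "'v::zfc \<Rightarrow> 'v set" where
  "trcl x = {y. (y, x) \<in> {(a, b). a \<in> elts b}\<^sup>+}"

definition Hset :: "'v::zfc \<Rightarrow> 'v set" where
  "Hset \<theta> = {x. trcl x \<prec> elts \<theta>}"

text \<open>Symbols are elements of the universe; every symbol has a finite arity, and constants
  are function symbols of arity 0.\<close>

record 'v lang =
  rels :: "'v set"
  funs :: "'v set"
  rel_arity :: "'v \<Rightarrow> nat"
  fun_arity :: "'v \<Rightarrow> nat"

datatype 'v tm = Var nat | Fun 'v "'v tm list"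

text \<open>\<open>Conj \<mu> \<phi>\<close> is the conjunction of the family \<open>(\<phi> i)\<^sub>i\<^sub><\<^sub>\<mu>\<close>, for an ordinal \<open>\<mu>\<close>.\<close>

datatype 'v fm =
    Eq "'v tm" "'v tm"
  | Rel 'v "'v tm list"
  | Neg "'v fm"
  | Conj 'v "'v \<Rightarrow> 'v fm"
  | Disj 'v "'v \<Rightarrow> 'v fm"
  | Ex nat "'v fm"
  | All nat "'v fm"

primrec tm_vars :: "'v tm \<Rightarrow> nat set" where
  "tm_vars (Var n) = {n}"
| "tm_vars (Fun f ts) = \<Union> (set (map tm_vars ts))"

primrec free_vars :: "'v::zfc fm \<Rightarrow> nat set" where
  "free_vars (Eq s t) = tm_vars s \<union> tm_vars t"
| "free_vars (Rel r ts) = \<Union> (set (map tm_vars ts))"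
| "free_vars (Neg \<phi>) = free_vars \<phi>"
| "free_vars (Conj \<mu> \<Phi>) = (\<Union>i\<in>elts \<mu>. free_vars (\<Phi> i))"
| "free_vars (Disj \<mu> \<Phi>) = (\<Union>i\<in>elts \<mu>. free_vars (\<Phi> i))"
| "free_vars (Ex n \<phi>) = free_vars \<phi> - {n}"
| "free_vars (All n \<phi>) = free_vars \<phi> - {n}"

inductive_set lang_terms :: "'v lang \<Rightarrow> 'v tm set" for L where
  "Var n \<in> lang_terms L"
| "f \<in> funs L \<Longrightarrow> length ts = fun_arity L f \<Longrightarrow> (\<And>t. t \<in> set ts \<Longrightarrow> t \<in> lang_terms L)
    \<Longrightarrow> Fun f ts \<in> lang_terms L"

text \<open>The condition \<open>extensional\<close> fixes the irrelevant values of a family outside its index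
  set, so that different elements of this set are different formulas.\<close>

inductive_set formulas :: "'v::zfc \<Rightarrow> 'v lang \<Rightarrow> 'v fm set" for \<delta> L where
  "s \<in> lang_terms L \<Longrightarrow> t \<in> lang_terms L \<Longrightarrow> Eq s t \<in> formulas \<delta> L"
| "r \<in> rels L \<Longrightarrow> length ts = rel_arity L r \<Longrightarrow> set ts \<subseteq> lang_terms L
    \<Longrightarrow> Rel r ts \<in> formulas \<delta> L"
| "\<phi> \<in> formulas \<delta> L \<Longrightarrow> Neg \<phi> \<in> formulas \<delta> L"
| "\<mu> \<in> elts \<delta> \<Longrightarrow> \<Phi> \<in> extensional (elts \<mu>) \<Longrightarrow> (\<And>i. i \<in> elts \<mu> \<Longrightarrow> \<Phi> i \<in> formulas \<delta> L)
    \<Longrightarrow> finite (free_vars (Conj \<mu> \<Phi>)) \<Longrightarrow> Conj \<mu> \<Phi> \<in> formulas \<delta> L"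
| "\<mu> \<in> elts \<delta> \<Longrightarrow> \<Phi> \<in> extensional (elts \<mu>) \<Longrightarrow> (\<And>i. i \<in> elts \<mu> \<Longrightarrow> \<Phi> i \<in> formulas \<delta> L)
    \<Longrightarrow> finite (free_vars (Disj \<mu> \<Phi>)) \<Longrightarrow> Disj \<mu> \<Phi> \<in> formulas \<delta> L"
| "\<phi> \<in> formulas \<delta> L \<Longrightarrow> Ex n \<phi> \<in> formulas \<delta> L"
| "\<phi> \<in> formulas \<delta> L \<Longrightarrow> All n \<phi> \<in> formulas \<delta> L"

definition sentences :: "'v::zfc \<Rightarrow> 'v lang \<Rightarrow> 'v fm set" where
  "sentences \<delta> L = {\<phi> \<in> formulas \<delta> L. free_vars \<phi> = {}}"

record 'v struct =
  univ :: "'v set"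
  rel_int :: "'v \<Rightarrow> 'v list \<Rightarrow> bool"
  fun_int :: "'v \<Rightarrow> 'v list \<Rightarrow> 'v"

definition is_struct :: "'v::zfc lang \<Rightarrow> 'v struct \<Rightarrow> bool" where
  "is_struct L S \<longleftrightarrow> small (univ S) \<and> univ S \<noteq> {} \<and>
     (\<forall>f\<in>funs L. \<forall>xs. length xs = fun_arity L f \<and> set xs \<subseteq> univ S \<longrightarrow> fun_int S f xs \<in> univ S)"

primrec tm_val :: "'v struct \<Rightarrow> (nat \<Rightarrow> 'v) \<Rightarrow> 'v tm \<Rightarrow> 'v" where
  "tm_val S e (Var n) = e n"
| "tm_val S e (Fun f ts) = fun_int S f (map (tm_val S e) ts)"

primrec sat :: "'v::zfc struct \<Rightarrow> 'v fm \<Rightarrow> (nat \<Rightarrow> 'v) \<Rightarrow> bool" where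
  "sat S (Eq s t) = (\<lambda>e. tm_val S e s = tm_val S e t)"
| "sat S (Rel r ts) = (\<lambda>e. rel_int S r (map (tm_val S e) ts))"
| "sat S (Neg \<phi>) = (\<lambda>e. \<not> sat S \<phi> e)"
| "sat S (Conj \<mu> \<Phi>) = (\<lambda>e. \<forall>i\<in>elts \<mu>. sat S (\<Phi> i) e)"
| "sat S (Disj \<mu> \<Phi>) = (\<lambda>e. \<exists>i\<in>elts \<mu>. sat S (\<Phi> i) e)"
| "sat S (Ex n \<phi>) = (\<lambda>e. \<exists>x\<in>univ S. sat S \<phi> (e(n := x)))"
| "sat S (All n \<phi>) = (\<lambda>e. \<forall>x\<in>univ S. sat S \<phi> (e(n := x)))"

definition has_model :: "'v::zfc lang \<Rightarrow> 'v fm set \<Rightarrow> bool" where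
  "has_model L T \<longleftrightarrow>
     (\<exists>S. is_struct L S \<and> (\<forall>\<phi>\<in>T. \<forall>e. range e \<subseteq> univ S \<longrightarrow> sat S \<phi> e))"

definition compact_Card :: "'v::zfc \<Rightarrow> 'v \<Rightarrow> 'v \<Rightarrow> bool" where
  "compact_Card \<delta> lam \<kappa> \<longleftrightarrow>
     (\<forall>L T. rels L <+> funs L \<lesssim> elts lam \<and> T \<subseteq> sentences \<delta> L \<and>
            (\<forall>T'\<subseteq>T. T' \<prec> elts \<kappa> \<longrightarrow> has_model L T')
        \<longrightarrow> has_model L T)"

definition complete_filter :: "'v::zfc \<Rightarrow> 'v \<Rightarrow> 'v set \<Rightarrow> 'v set \<Rightarrow> bool" where
  "complete_filter \<delta> X E F \<longleftrightarrow>
     F \<subseteq> E \<and> (\<forall>Y\<in>E. elts Y \<subseteq> elts X) \<and> (\<forall>Y\<in>E. vset (elts X - elts Y) \<in> E) \<and> X \<in> E \<and>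
     X \<in> F \<and> vset {} \<notin> F \<and>
     (\<forall>Y\<in>E. \<forall>Z\<in>E. elts Z \<subseteq> elts Y \<and> Z \<in> F \<longrightarrow> Y \<in> F) \<and>
     (\<forall>\<mu>\<in>elts \<delta>. \<forall>Y. (\<forall>i\<in>elts \<mu>. Y i \<in> F) \<longrightarrow> (\<Inter>i\<in>elts \<mu>. elts (Y i)) \<noteq> {})"

definition measures :: "'v::zfc \<Rightarrow> 'v set \<Rightarrow> 'v set \<Rightarrow> bool" where
  "measures X E F \<longleftrightarrow> (\<forall>Y\<in>E. Y \<in> F \<or> vset (elts X - elts Y) \<in> F)"

definition Pkl :: "'v::zfc \<Rightarrow> 'v \<Rightarrow> 'v" where
  "Pkl \<kappa> lam = vset {x. elts x \<subseteq> elts lam \<and> elts x \<prec> elts \<kappa>}"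

definition subsets_in :: "'v::zfc set \<Rightarrow> 'v \<Rightarrow> 'v set" where
  "subsets_in M X = {Y. elts Y \<subseteq> elts X} \<inter> M"

definition M_ultrafilter :: "'v::zfc set \<Rightarrow> 'v \<Rightarrow> 'v \<Rightarrow> 'v set \<Rightarrow> bool" where
  "M_ultrafilter M \<kappa> lam U \<longleftrightarrow>
     complete_filter omega (Pkl \<kappa> lam) (subsets_in M (Pkl \<kappa> lam)) U \<and>
     measures (Pkl \<kappa> lam) (subsets_in M (Pkl \<kappa> lam)) U"

definition fine :: "'v::zfc set \<Rightarrow> 'v \<Rightarrow> 'v \<Rightarrow> 'v set \<Rightarrow> bool" where
  "fine M \<kappa> lam U \<longleftrightarrow> (\<forall>\<gamma>\<in>elts lam \<inter> M. vset {x \<in> elts (Pkl \<kappa> lam). \<gamma> \<in> elts x} \<in> U)"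

definition complete_fine_ultrafilter :: "'v::zfc \<Rightarrow> 'v set \<Rightarrow> 'v \<Rightarrow> 'v \<Rightarrow> 'v set \<Rightarrow> bool" where
  "complete_fine_ultrafilter \<delta> M \<kappa> lam U \<longleftrightarrow>
     M_ultrafilter M \<kappa> lam U \<and>
     complete_filter \<delta> (Pkl \<kappa> lam) (subsets_in M (Pkl \<kappa> lam)) U \<and>
     fine M \<kappa> lam U"

datatype set_fm =
    Set_Mem nat nat
  | Set_Eq nat nat
  | Set_Neg set_fm
  | Set_And set_fm set_fm
  | Set_Ex nat set_fm

primrec set_sat :: "'a set \<Rightarrow> ('a \<Rightarrow> 'a \<Rightarrow> bool) \<Rightarrow> set_fm \<Rightarrow> (nat \<Rightarrow> 'a) \<Rightarrow> bool" where
  "set_sat A R (Set_Mem m n) = (\<lambda>e. R (e m) (e n))"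
| "set_sat A R (Set_Eq m n) = (\<lambda>e. e m = e n)"
| "set_sat A R (Set_Neg \<phi>) = (\<lambda>e. \<not> set_sat A R \<phi> e)"
| "set_sat A R (Set_And \<phi> \<psi>) = (\<lambda>e. set_sat A R \<phi> e \<and> set_sat A R \<psi> e)"
| "set_sat A R (Set_Ex n \<phi>) = (\<lambda>e. \<exists>x\<in>A. set_sat A R \<phi> (e(n := x)))"

definition elementary_embedding ::
  "('a \<Rightarrow> 'b) \<Rightarrow> 'a set \<Rightarrow> ('a \<Rightarrow> 'a \<Rightarrow> bool) \<Rightarrow> 'b set \<Rightarrow> ('b \<Rightarrow> 'b \<Rightarrow> bool) \<Rightarrow> bool" where
  "elementary_embedding j A R B S \<longleftrightarrow>
     j ` A \<subseteq> B \<and>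
     (\<forall>\<phi> e. range e \<subseteq> A \<longrightarrow> (set_sat A R \<phi> e \<longleftrightarrow> set_sat B S \<phi> (j \<circ> e)))"

definition elementary_submodel :: "'v::zfc set \<Rightarrow> 'v set \<Rightarrow> bool" where
  "elementary_submodel M H \<longleftrightarrow> M \<subseteq> H \<and> elementary_embedding id M mem H mem"

definition moved :: "('v::zfc \<Rightarrow> 'v) \<Rightarrow> 'v set \<Rightarrow> 'v set \<Rightarrow> ('v \<Rightarrow> 'v \<Rightarrow> bool) \<Rightarrow> 'v \<Rightarrow> bool" where
  "moved j M N R \<gamma> \<longleftrightarrow>
     Ord \<gamma> \<and> \<gamma> \<in> M \<and> j ` (elts \<gamma> \<inter> M) \<subset> {\<gamma>'\<in>N. R \<gamma>' (j \<gamma>)}"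

definition is_crit :: "('v::zfc \<Rightarrow> 'v) \<Rightarrow> 'v set \<Rightarrow> 'v set \<Rightarrow> ('v \<Rightarrow> 'v \<Rightarrow> bool) \<Rightarrow> 'v \<Rightarrow> bool" where
  "is_crit j M N R \<gamma> \<longleftrightarrow> moved j M N R \<gamma> \<and> (\<forall>\<beta>\<in>elts \<gamma>. \<not> moved j M N R \<beta>)"

definition crit_ge :: "('v::zfc \<Rightarrow> 'v) \<Rightarrow> 'v set \<Rightarrow> 'v set \<Rightarrow> ('v \<Rightarrow> 'v \<Rightarrow> bool) \<Rightarrow> 'v \<Rightarrow> bool" where
  "crit_ge j M N R \<delta> \<longleftrightarrow> (\<exists>\<gamma>. is_crit j M N R \<gamma> \<and> elts \<delta> \<subseteq> elts \<gamma>)"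

text \<open>Relativizations to \<open>(A, R)\<close> of the set-theoretic definitions; ordered pairs are
  Kuratowski pairs.\<close>

definition int_upair :: "'a set \<Rightarrow> ('a \<Rightarrow> 'a \<Rightarrow> bool) \<Rightarrow> 'a \<Rightarrow> 'a \<Rightarrow> 'a \<Rightarrow> bool" where
  "int_upair A R p a b \<longleftrightarrow> (\<forall>x\<in>A. R x p \<longleftrightarrow> x = a \<or> x = b)"

definition int_pair :: "'a set \<Rightarrow> ('a \<Rightarrow> 'a \<Rightarrow> bool) \<Rightarrow> 'a \<Rightarrow> 'a \<Rightarrow> 'a \<Rightarrow> bool" where
  "int_pair A R p a b \<longleftrightarrow>
     (\<exists>s\<in>A. \<exists>t\<in>A. int_upair A R s a a \<and> int_upair A R t a b \<and> int_upair A R p s t)"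

definition int_maps :: "'a set \<Rightarrow> ('a \<Rightarrow> 'a \<Rightarrow> bool) \<Rightarrow> 'a \<Rightarrow> 'a \<Rightarrow> 'a \<Rightarrow> bool" where
  "int_maps A R f a b \<longleftrightarrow> (\<exists>p\<in>A. R p f \<and> int_pair A R p a b)"

definition int_bij :: "'a set \<Rightarrow> ('a \<Rightarrow> 'a \<Rightarrow> bool) \<Rightarrow> 'a \<Rightarrow> 'a \<Rightarrow> 'a \<Rightarrow> bool" where
  "int_bij A R f x y \<longleftrightarrow>
     (\<forall>p\<in>A. R p f \<longrightarrow> (\<exists>a\<in>A. \<exists>b\<in>A. R a x \<and> R b y \<and> int_pair A R p a b)) \<and>
     (\<forall>a\<in>A. R a x \<longrightarrow> (\<exists>!b. b \<in> A \<and> R b y \<and> int_maps A R f a b)) \<and>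
     (\<forall>b\<in>A. R b y \<longrightarrow> (\<exists>!a. a \<in> A \<and> R a x \<and> int_maps A R f a b))"

definition int_transitive :: "'a set \<Rightarrow> ('a \<Rightarrow> 'a \<Rightarrow> bool) \<Rightarrow> 'a \<Rightarrow> bool" where
  "int_transitive A R x \<longleftrightarrow> (\<forall>y\<in>A. R y x \<longrightarrow> (\<forall>z\<in>A. R z y \<longrightarrow> R z x))"

definition int_Ord :: "'a set \<Rightarrow> ('a \<Rightarrow> 'a \<Rightarrow> bool) \<Rightarrow> 'a \<Rightarrow> bool" where
  "int_Ord A R x \<longleftrightarrow>
     int_transitive A R x \<and> (\<forall>y\<in>A. R y x \<longrightarrow> int_transitive A R y)"

definition int_eqpoll :: "'a set \<Rightarrow> ('a \<Rightarrow> 'a \<Rightarrow> bool) \<Rightarrow> 'a \<Rightarrow> 'a \<Rightarrow> bool" where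
  "int_eqpoll A R x y \<longleftrightarrow> (\<exists>f\<in>A. int_bij A R f x y)"

definition int_is_card :: "'a set \<Rightarrow> ('a \<Rightarrow> 'a \<Rightarrow> bool) \<Rightarrow> 'a \<Rightarrow> 'a \<Rightarrow> bool" where
  "int_is_card A R m x \<longleftrightarrow>
     int_Ord A R m \<and> int_eqpoll A R x m \<and> (\<forall>n\<in>A. R n m \<longrightarrow> \<not> int_eqpoll A R x n)"

text \<open>\<open>(A, R)\<close> satisfies \<open>|x| < k\<close>, where \<open>k\<close> is a cardinal of \<open>(A, R)\<close>.\<close>

definition int_card_less :: "'a set \<Rightarrow> ('a \<Rightarrow> 'a \<Rightarrow> bool) \<Rightarrow> 'a \<Rightarrow> 'a \<Rightarrow> bool" where
  "int_card_less A R x k \<longleftrightarrow> (\<exists>m\<in>A. int_is_card A R m x \<and> R m k)"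

definition covering_embedding ::
  "'v::zfc \<Rightarrow> 'v set \<Rightarrow> 'v \<Rightarrow> 'v \<Rightarrow> ('v \<Rightarrow> 'v) \<Rightarrow> 'v set \<Rightarrow> ('v \<Rightarrow> 'v \<Rightarrow> bool) \<Rightarrow> 'v \<Rightarrow> bool" where
  "covering_embedding \<delta> M \<kappa> lam j N R D \<longleftrightarrow>
     small N \<and> elementary_embedding j M mem N R \<and> crit_ge j M N R \<delta> \<and>
     D \<in> N \<and> (\<forall>\<gamma>\<in>elts lam \<inter> M. R (j \<gamma>) D) \<and> int_card_less N R D (j \<kappa>)"

definition regular_above :: "'v::zfc \<Rightarrow> 'v \<Rightarrow> 'v \<Rightarrow> bool" where
  "regular_above \<kappa> lam \<theta> \<longleftrightarrow> regular \<theta> \<and> weak_cpower lam \<kappa> \<in> elts \<theta>"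

definition good_submodel :: "'v::zfc \<Rightarrow> 'v \<Rightarrow> 'v set \<Rightarrow> bool" where
  "good_submodel lam \<theta> M \<longleftrightarrow>
     elementary_submodel M (Hset \<theta>) \<and> M \<approx> elts lam \<and> insert lam (elts lam) \<subseteq> M"

end

theory Submission
  imports Defs
begin

text \<open>
  Everything is reduced to a combinatorial property \<open>family_measure\<close> of the cardinals alone: every
  family of \<open>lam\<close> many subsets of \<open>P\<^sub>\<kappa>(lam)\<close> is measured by a fine, \<open><\<delta>\<close>-complete ultrafilter.
  Compactness gives the ultrafilter \<open>U\<close> (by a propositional theory with an atom for each set in
  \<open>M\<close>) and the embedding \<open>j\<close> (by the elementary diagram of \<open>M\<close>) for every \<open>M\<close>; in both cases fewer
  than \<open>\<kappa>\<close> of the covering axioms are satisfied by a point \<open>x \<in> P\<^sub>\<kappa>(lam)\<close>. Conversely, already one \<open>M\<close>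
  with such \<open>U\<close> or \<open>j\<close> yields \<open>family_measure\<close>, because a failure of \<open>family_measure\<close> would reflect to a family coded in
  \<open>M\<close>. For \<open>j\<close> one measures a set \<open>Y \<in> M\<close> by \<open>D \<in> j(Y)\<close>; completeness for sequences outside of \<open>M\<close>
  is not needed, since \<open>lam\<^sup><\<^sup>\<delta> = lam\<close> puts all subsets of \<open>lam\<close> of size less than \<open>\<delta>\<close> into \<open>M\<close>.
  Finally, \<open>family_measure\<close> implies compactness by an ultraproduct of models of the small subtheories,
  restricted to \<open>lam\<close> many functions closed under Skolem functions.
\<close>

section \<open>Cardinal arithmetic of HOL sets\<close>

text \<open>Since \<open>family_measure\<close> mentions neither \<theta> nor M, "for all" and "for
  some" \<theta> become equivalent once suitable \<theta> and M are known to exist. Its witness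
  \<open>u\<close> is in effect a subset of \<open>lam\<close> and can be taken in H(\<theta>),
  whereas a whole ultrafilter on P_\<kappa>(lam) is in general too large to be an element there;
  this is why the property can be reflected into M. Completeness is phrased through points: any
  fewer than \<delta> decisions of \<open>u\<close> are all correct at one actual x. An argument
  about the ultrafilter thereby becomes an argument about a single x, and the ultraproduct is built
  on this form alone. The arithmetic assumption on \<open>lam\<close> has a second use: it bounds
  the number of formulas of the infinitary logic by \<open>lam\<close>, so that Los's theorem for a
  structure of size at most \<open>lam\<close> refers to at most \<open>lam\<close> many subsets of
  P_\<kappa>(lam). That \<open>crit j\<close> exists at all is a point of its own: an embedding that
  moves no ordinal of M cannot cover \<open>lam\<close> by a set that N believes to be smaller than
  \<open>j \<kappa>\<close>.\<close>

lemma lepoll_iff_ordLeq: "A \<lesssim> B \<longleftrightarrow> (card_of A, card_of B) \<in> ordLeq"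
  by (simp add: lepoll_def card_of_ordLeq)

lemma not_lepoll_iff_lesspoll: "\<not> A \<lesssim> B \<longleftrightarrow> B \<prec> A"
proof
  assume "\<not> A \<lesssim> B"
  then have "B \<lesssim> A"
    using ordLeq_total[OF card_of_Well_order card_of_Well_order, of A B]
    unfolding lepoll_iff_ordLeq by blast
  moreover have "\<not> B \<approx> A"
    using \<open>\<not> A \<lesssim> B\<close> eqpoll_sym eqpoll_imp_lepoll by blast
  ultimately show "B \<prec> A" by (simp add: lesspoll_def)
next
  assume "B \<prec> A"
  then show "\<not> A \<lesssim> B" unfolding lesspoll_def using lepoll_antisym by blast
qed

lemma lesspoll_iff_ordLess: "A \<prec> B \<longleftrightarrow> (card_of A, card_of B) \<in> ordLess"
  unfolding not_lepoll_iff_lesspoll[symmetric] lepoll_iff_ordLeq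
  by (rule not_ordLeq_iff_ordLess[OF card_of_Well_order card_of_Well_order])

lemma times_lepoll_infinite:
  assumes "infinite C" "A \<lesssim> C" "B \<lesssim> C"
  shows "A \<times> B \<lesssim> C"
proof -
  have "C \<times> C \<lesssim> C"
    using card_of_Times_same_infinite[OF assms(1)] ordIso_imp_ordLeq lepoll_iff_ordLeq by blast
  then show ?thesis
    using times_lepoll_mono[OF assms(2,3)] lepoll_trans by blast
qed

lemma UN_lepoll_infinite:
  assumes "infinite C" "I \<lesssim> C" "\<And>i. i \<in> I \<Longrightarrow> B i \<lesssim> C"
  shows "(\<Union>i\<in>I. B i) \<lesssim> C"
  using card_of_UNION_ordLeq_infinite[of C I B] assms by (auto simp: lepoll_iff_ordLeq)

lemma Plus_lepoll_infinite:
  assumes "infinite C" "A \<lesssim> C" "B \<lesssim> C"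
  shows "A <+> B \<lesssim> C"
proof -
  have "C <+> C \<lesssim> C"
    unfolding lepoll_iff_ordLeq
    by (rule ordIso_imp_ordLeq[OF card_of_Plus_infinite1[OF assms(1) card_of_refl[THEN ordIso_imp_ordLeq]]])
  then show ?thesis
    using sum_lepoll_mono[OF assms(2,3)] lepoll_trans by blast
qed

lemma Un_lepoll_infinite:
  assumes "infinite C" "A \<lesssim> C" "B \<lesssim> C"
  shows "A \<union> B \<lesssim> C"
proof -
  have "(\<Union>b\<in>{True, False}. if b then A else B) \<lesssim> C"
    using assms by (intro UN_lepoll_infinite) (auto simp: finite_lepoll_infinite)
  then show ?thesis by (simp add: Un_commute)
qed

lemma Un_lesspoll_infinite:
  assumes "infinite C" "A \<prec> C" "B \<prec> C"
  shows "A \<union> B \<prec> C"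
  using card_of_Un_ordLess_infinite[of C A B] assms by (auto simp: lesspoll_iff_ordLess)

text \<open>If one factor is infinite, then so is the sum \<open>A <+> B\<close>, which is still
  smaller than \<open>C\<close> and absorbs the product.\<close>

lemma times_lesspoll_infinite:
  assumes "infinite C" "A \<prec> C" "B \<prec> C"
  shows "A \<times> B \<prec> C"
proof (cases "finite A \<and> finite B")
  case True
  then show ?thesis by (simp add: finite_lesspoll_infinite[OF assms(1)])
next
  case False
  have AB: "A <+> B \<prec> C"
    using card_of_Plus_ordLess_infinite[of C A B] assms by (auto simp: lesspoll_iff_ordLess)
  have inf: "infinite (A <+> B)" using False by simp
  have A: "A \<lesssim> A <+> B"
    unfolding lepoll_def by (rule exI[of _ Inl]) auto
  have B: "B \<lesssim> A <+> B"
    unfolding lepoll_def by (rule exI[of _ Inr]) auto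
  show ?thesis
    by (rule lesspoll_trans1[OF times_lepoll_infinite[OF inf A B] AB])
qed

section \<open>Closure of a set under finitary operations\<close>

lemma lists_lepoll_infinite:
  assumes "infinite C" "A \<lesssim> C"
  shows "lists A \<lesssim> C"
proof -
  have "{xs. set xs \<subseteq> A \<and> length xs = n} \<lesssim> C" for n
  proof (induction n)
    case 0
    have "{xs. set xs \<subseteq> A \<and> length xs = 0} = {[]}" by auto
    then show ?case using assms(1) by (simp add: finite_lepoll_infinite)
  next
    case (Suc n)
    have "{xs. set xs \<subseteq> A \<and> length xs = Suc n}
        \<subseteq> (\<lambda>(x, xs). x # xs) ` (A \<times> {xs. set xs \<subseteq> A \<and> length xs = n})"
      by (auto simp: length_Suc_conv)
    then show ?case
      by (rule lepoll_trans[OF subset_image_lepoll times_lepoll_infinite[OF assms Suc]])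
  qed
  then have "(\<Union>n. {xs. set xs \<subseteq> A \<and> length xs = n}) \<lesssim> C"
    using assms(1) by (intro UN_lepoll_infinite) (auto simp: infinite_le_lepoll)
  moreover have "lists A = (\<Union>n. {xs. set xs \<subseteq> A \<and> length xs = n})" by auto
  ultimately show ?thesis by simp
qed

text \<open>Serves to count terms, the functions of the ultraproduct and elementary submodels.
  Operations act on lists of every length; the empty list yields the starting points.\<close>

inductive_set hull :: "'f set \<Rightarrow> ('f \<Rightarrow> 'a list \<Rightarrow> 'a) \<Rightarrow> 'a set" for F g where
  "f \<in> F \<Longrightarrow> (\<And>x. x \<in> set xs \<Longrightarrow> x \<in> hull F g) \<Longrightarrow> g f xs \<in> hull F g"

text \<open>A finite list of elements already lies in one of the increasing stages
  \<open>G n\<close>, so \<omega> many stages exhaust the hull. Each stage has size at most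
  \<open>C\<close>, because an infinite set absorbs finite lists and products.\<close>

lemma hull_lepoll:
  assumes "infinite C" "F \<lesssim> C"
  shows "hull F g \<lesssim> C"
proof -
  define step where "step A = (\<lambda>(f, xs). g f xs) ` (F \<times> lists A)" for A
  define G where "G n = (step ^^ n) {}" for n
  have G_Suc: "G (Suc n) = step (G n)" for n by (simp add: G_def)
  have mono: "A \<subseteq> B \<Longrightarrow> step A \<subseteq> step B" for A B
    unfolding step_def using lists_mono by (intro image_mono) blast
  have "G n \<subseteq> G (Suc n)" for n
    by (induction n) (use mono G_Suc in \<open>auto simp: G_def\<close>)
  then have G_mono: "m \<le> n \<Longrightarrow> G m \<subseteq> G n" for m n
    by (metis lift_Suc_mono_le)
  have "G n \<lesssim> C" for n
  proof (induction n)
    case 0 then show ?case by (simp add: G_def)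
  next
    case (Suc n)
    have "step (G n) \<lesssim> F \<times> lists (G n)"
      unfolding step_def by (rule image_lepoll)
    then show ?case unfolding G_Suc
      by (rule lepoll_trans[OF _ times_lepoll_infinite[OF assms lists_lepoll_infinite[OF assms(1) Suc]]])
  qed
  then have le: "(\<Union>n. G n) \<lesssim> C"
    using assms(1) by (intro UN_lepoll_infinite) (auto simp: infinite_le_lepoll)
  have "x \<in> (\<Union>n. G n)" if "x \<in> hull F g" for x
    using that
  proof induction
    case (1 f xs)
    have "\<exists>n. set xs \<subseteq> G n"
      using 1(2,3)
    proof (induction xs)
      case (Cons a xs)
      then have "\<exists>n. set xs \<subseteq> G n" "\<exists>m. a \<in> G m" by simp_all
      then obtain n m where "set xs \<subseteq> G n" "a \<in> G m" by blast
      then have "set (a # xs) \<subseteq> G (max n m)"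
        using G_mono[of n "max n m"] G_mono[of m "max n m"] by auto
      then show ?case by blast
    qed auto
    then obtain n where "set xs \<subseteq> G n" by blast
    then have "g f xs \<in> G (Suc n)"
      unfolding G_Suc step_def using 1(1) by (auto intro!: image_eqI[of _ _ "(f, xs)"])
    then show ?case by blast
  qed
  then have "hull F g \<lesssim> (\<Union>n. G n)" by (intro subset_imp_lepoll) blast
  then show ?thesis using le by (rule lepoll_trans)
qed

section \<open>Sets, ordinals and cardinals in the universe\<close>

lemma small_elts [simp, intro]: "small (elts x)"
  by (auto simp: small_def)

lemma small_subset: "A \<subseteq> B \<Longrightarrow> small B \<Longrightarrow> small A"
proof -
  assume "A \<subseteq> B" "small B"
  then obtain x where x: "A \<subseteq> elts x" by (auto simp: small_def)
  obtain y where "elts y = {z \<in> elts x. z \<in> A}" using separation by metis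
  then show ?thesis using x by (auto simp: small_def intro!: exI[of _ y])
qed

lemma small_image: "small A \<Longrightarrow> small (f ` A)" for f :: "'v::zfc \<Rightarrow> 'v"
proof -
  assume "small A"
  then obtain x where "elts x = A" unfolding small_def ..
  moreover obtain y where "elts y = f ` elts x" using replacement[of f x] by blast
  ultimately show ?thesis unfolding small_def by auto
qed

lemma small_UN:
  fixes B :: "'v::zfc \<Rightarrow> 'v set"
  assumes "small A" "\<And>a. a \<in> A \<Longrightarrow> small (B a)"
  shows "small (\<Union>a\<in>A. B a)"
proof -
  obtain x where x: "elts x = (\<lambda>a. vset (B a)) ` A"
    using small_image[OF assms(1)] unfolding small_def by blast
  obtain u where "elts u = (\<Union>y\<in>elts x. elts y)" using union by blast
  then have "elts u = (\<Union>a\<in>A. B a)"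
    using assms(2) by (simp add: x elts_vset)
  then show ?thesis by (auto simp: small_def)
qed

lemma small_doubleton [simp, intro]: "small {a, b}"
  using pairing by (metis small_def)

lemma small_singleton [simp, intro]: "small {a}"
  using small_doubleton[of a a] by simp

lemma small_empty [simp, intro]: "small {}"
  using small_subset[OF empty_subsetI small_singleton] .

lemma small_Pow: "small {y. elts y \<subseteq> elts x}"
  using powerset by (metis small_def)

lemma small_lepoll:
  fixes x :: "'v::zfc" and A :: "'v set"
  assumes "A \<lesssim> elts x" shows "small A"
proof -
  obtain g where "A \<subseteq> g ` elts x" using assms by (auto simp: lepoll_iff)
  then show ?thesis using small_subset small_image small_elts by blast
qed

lemma vset_inject: "small A \<Longrightarrow> small B \<Longrightarrow> vset A = vset B \<longleftrightarrow> A = B"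
  by (metis elts_vset)

definition kpair :: "'v::zfc \<Rightarrow> 'v \<Rightarrow> 'v" where
  "kpair a b = vset {vset {a, a}, vset {a, b}}"

lemma kpair_inject [simp]: "kpair a b = kpair c d \<longleftrightarrow> a = c \<and> b = d"
  unfolding kpair_def by (auto simp: vset_inject doubleton_eq_iff)

lemma small_times: "small ((\<lambda>(a, b). kpair a b) ` (elts x \<times> elts y))"
proof -
  have "(\<lambda>(a, b). kpair a b) ` (elts x \<times> elts y) = (\<Union>a\<in>elts x. kpair a ` elts y)" by auto
  then show ?thesis by (simp add: small_UN small_image)
qed

section \<open>Ordinals and their linear order\<close>

lemma eps_induct: "(\<And>x. (\<And>y. y \<in> elts x \<Longrightarrow> P y) \<Longrightarrow> P x) \<Longrightarrow> P x"
  using wf_induct_rule[OF foundation, of P x] by auto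

lemma mem_irrefl [simp]: "x \<notin> elts x"
  using foundation wf_irrefl by (metis (mono_tags) case_prod_conv mem_Collect_eq)

lemma Ord_in_Ord: "Ord \<alpha> \<Longrightarrow> \<beta> \<in> elts \<alpha> \<Longrightarrow> Ord \<beta>"
  unfolding Ord_def transitive_set_def by blast

lemma Ord_trans: "Ord \<alpha> \<Longrightarrow> \<beta> \<in> elts \<alpha> \<Longrightarrow> \<gamma> \<in> elts \<beta> \<Longrightarrow> \<gamma> \<in> elts \<alpha>"
  unfolding Ord_def transitive_set_def by blast

lemma Ord_linear: "Ord \<alpha> \<Longrightarrow> Ord \<beta> \<Longrightarrow> \<alpha> \<in> elts \<beta> \<or> \<alpha> = \<beta> \<or> \<beta> \<in> elts \<alpha>"
proof (induction \<alpha> arbitrary: \<beta> rule: eps_induct)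
  case (1 \<alpha>)
  note \<alpha> = 1
  show ?case using 1(3)
  proof (induction \<beta> rule: eps_induct)
    case (1 \<beta>)
    show ?case
    proof (rule ccontr)
      assume n: "\<not> ?thesis"
      have "a \<in> elts \<beta>" if "a \<in> elts \<alpha>" for a
        using \<alpha>(1)[OF that Ord_in_Ord[OF \<alpha>(2) that] 1(2)] n that Ord_trans[OF \<alpha>(2)] by auto
      moreover have "b \<in> elts \<alpha>" if "b \<in> elts \<beta>" for b
        using 1(1)[OF that Ord_in_Ord[OF 1(2) that]] n that Ord_trans[OF 1(2)] by auto
      ultimately have "\<alpha> = \<beta>" by (intro extensionality) blast
      then show False using n by simp
    qed
  qed
qed

lemma Ord_not_mem: "Ord \<alpha> \<Longrightarrow> Ord \<beta> \<Longrightarrow> \<beta> \<notin> elts \<alpha> \<Longrightarrow> elts \<alpha> \<subseteq> elts \<beta>"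
  using Ord_linear Ord_trans by blast

lemma Ord_subset_mem: "Ord \<alpha> \<Longrightarrow> Ord \<beta> \<Longrightarrow> elts \<alpha> \<subseteq> elts \<beta> \<Longrightarrow> \<alpha> = \<beta> \<or> \<alpha> \<in> elts \<beta>"
  using Ord_linear mem_irrefl by blast

lemma Ord_subset: "Ord \<alpha> \<Longrightarrow> \<beta> \<in> elts \<alpha> \<Longrightarrow> elts \<beta> \<subseteq> elts \<alpha>"
  using Ord_trans by blast

lemma Ord_vset:
  assumes "small A" "\<And>x. x \<in> A \<Longrightarrow> Ord x" "\<And>x y. x \<in> A \<Longrightarrow> y \<in> elts x \<Longrightarrow> y \<in> A"
  shows "Ord (vset A)"
  using assms unfolding Ord_def transitive_set_def by (auto simp: elts_vset[OF assms(1)])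

text \<open>The ordinal is the Mostowski collapse of a well-order of \<open>A\<close>.\<close>

lemma small_eqpoll_Ord:
  fixes A :: "'v::zfc set"
  assumes "small A"
  shows "\<exists>\<alpha>::'v. Ord \<alpha> \<and> elts \<alpha> \<approx> A"
proof -
  obtain r where r: "well_order_on A r" using well_order_on by blast
  define s where "s = r - Id"
  have wf: "wf s" using r by (auto simp: well_order_on_def s_def)
  have sA: "s \<subseteq> A \<times> A"
    using r unfolding s_def well_order_on_def linear_order_on_def partial_order_on_def
      preorder_on_def by auto
  then have sA': "(x, y) \<in> s \<Longrightarrow> x \<in> A" for x y by blast
  have trans: "trans s"
    using r unfolding s_def well_order_on_def linear_order_on_def partial_order_on_def
      preorder_on_def by (auto intro: trans_diff_Id)
  have total: "x = y \<or> (x, y) \<in> s \<or> (y, x) \<in> s" if "x \<in> A" "y \<in> A" for x y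
    using r that unfolding s_def well_order_on_def linear_order_on_def total_on_def by auto
  define f :: "'v \<Rightarrow> 'v" where "f = wfrec s (\<lambda>f a. vset (f ` {b. (b, a) \<in> s}))"
  have f_eq: "f a = vset (f ` {b. (b, a) \<in> s})" for a
  proof -
    have "f a = vset (cut f s a ` {b. (b, a) \<in> s})"
      unfolding f_def by (rule wfrec[OF wf])
    also have "cut f s a ` {b. (b, a) \<in> s} = f ` {b. (b, a) \<in> s}"
      by (intro image_cong) (auto simp: cut_def)
    finally show ?thesis .
  qed
  have sm: "small {b. (b, a) \<in> s}" for a
    by (rule small_subset[OF _ assms]) (use sA in auto)
  then have elts_f: "elts (f a) = f ` {b. (b, a) \<in> s}" for a
    by (subst f_eq) (simp add: elts_vset small_image sm)
  have Ord_f: "Ord (f a)" for a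
  proof (induction a rule: wf_induct_rule[OF wf])
    case (1 a)
    then have "Ord (vset (f ` {b. (b, a) \<in> s}))"
      using trans sm by (intro Ord_vset) (auto simp: small_image elts_f dest: transD intro!: imageI)
    then show ?case by (simp only: f_eq[symmetric])
  qed
  have inj: "inj_on f A"
  proof (rule inj_onI, rule ccontr)
    fix x y assume "x \<in> A" "y \<in> A" "f x = f y" "x \<noteq> y"
    then have "f x \<in> elts (f y) \<or> f y \<in> elts (f x)"
      using total[of x y] unfolding elts_f by blast
    then show False using \<open>f x = f y\<close> by simp
  qed
  have "small (f ` A)" by (rule small_image[OF assms])
  moreover have "Ord (vset (f ` A))"
    using Ord_f sA calculation by (intro Ord_vset) (auto simp: elts_f sA')
  ultimately show ?thesis
    using inj_on_image_eqpoll_self[OF inj] by (intro exI[of _ "vset (f ` A)"]) (simp add: elts_vset)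
qed

section \<open>Cardinals, and a regular cardinal above a given ordinal\<close>

lemma Card_Ord: "Card \<kappa> \<Longrightarrow> Ord \<kappa>"
  by (simp add: Card_def)

lemma Card_eqpoll_eq: "Card \<kappa> \<Longrightarrow> Card \<mu> \<Longrightarrow> elts \<kappa> \<approx> elts \<mu> \<Longrightarrow> \<kappa> = \<mu>"
  unfolding Card_def using Ord_linear eqpoll_sym by blast

text \<open>The injection into \<open>elts x\<close> replaces \<open>A\<close>, which may have any
  type, by a small set of the universe. The least ordinal equipollent to it is a cardinal, and the
  only one, so the description in \<open>vcard\<close> is proper.\<close>

lemma vcard_props:
  fixes x :: "'v::zfc"
  assumes "A \<lesssim> elts x"
  shows "Card (vcard A :: 'v)" "elts (vcard A :: 'v) \<approx> A"
proof -
  obtain h where "inj_on h A" "h ` A \<subseteq> elts x" using assms by (auto simp: lepoll_def)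
  then have hA: "h ` A \<approx> A" "small (h ` A)"
    using inj_on_image_eqpoll_self small_subset by blast+
  then obtain \<alpha> :: 'v where "Ord \<alpha> \<and> elts \<alpha> \<approx> A"
    using small_eqpoll_Ord eqpoll_trans by blast
  then have "\<exists>\<alpha>::'v. Ord \<alpha> \<and> elts \<alpha> \<approx> A \<and> (\<forall>\<beta>\<in>elts \<alpha>. \<not> elts \<beta> \<approx> A)"
  proof (induction \<alpha> rule: eps_induct)
    case (1 \<alpha>)
    then show ?case using Ord_in_Ord[of \<alpha>] by (cases "\<exists>\<beta>\<in>elts \<alpha>. elts \<beta> \<approx> A") metis+
  qed
  then obtain \<mu> :: 'v where \<mu>: "Ord \<mu>" "elts \<mu> \<approx> A" "\<forall>\<beta>\<in>elts \<mu>. \<not> elts \<beta> \<approx> A" by blast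
  then have "Card \<mu>" unfolding Card_def using eqpoll_trans by blast
  then have "Card (vcard A :: 'v) \<and> elts (vcard A :: 'v) \<approx> A"
    unfolding vcard_def using \<mu>(2)
    by (intro theI[of "\<lambda>\<mu>. Card \<mu> \<and> elts \<mu> \<approx> A" \<mu>]) (auto intro: Card_eqpoll_eq eqpoll_sym eqpoll_trans)
  then show "Card (vcard A :: 'v)" "elts (vcard A :: 'v) \<approx> A" by auto
qed

lemma Card_mem_lesspoll: "Card \<kappa> \<Longrightarrow> \<alpha> \<in> elts \<kappa> \<Longrightarrow> elts \<alpha> \<prec> elts \<kappa>"
  unfolding Card_def lesspoll_def by (simp add: Ord_subset subset_imp_lepoll)

lemma vcard_mem:
  assumes "Card \<kappa>" "A \<prec> elts \<kappa>"
  shows "vcard A \<in> elts \<kappa>"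
proof (rule ccontr)
  assume "vcard A \<notin> elts \<kappa>"
  note v = vcard_props[OF lesspoll_imp_lepoll[OF assms(2)]]
  have "elts \<kappa> \<subseteq> elts (vcard A)"
    using Ord_not_mem[OF Card_Ord[OF assms(1)] Card_Ord[OF v(1)]] \<open>vcard A \<notin> elts \<kappa>\<close> by blast
  then have "elts \<kappa> \<lesssim> A" using v(2) subset_imp_lepoll lepoll_trans2 by blast
  then show False using assms(2) not_lepoll_iff_lesspoll by blast
qed

text \<open>The witness is the Hartogs number of \<open>w\<close>, the successor cardinal of its
  cardinality. It is a set because its elements lie in an ordinal \<open>P\<close> of the size of
  the power set of \<open>w\<close>. It is regular because a union of at most |w| ordinals, each of
  size at most |w|, again has size at most |w|.\<close>

lemma ex_regular_above:
  fixes w :: "'v::zfc"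
  assumes "Ord w" and inf: "infinite (elts w)"
  shows "\<exists>\<theta>. regular \<theta> \<and> w \<in> elts \<theta>"
proof -
  obtain p where p: "elts p = {y. elts y \<subseteq> elts w}" using powerset by blast
  obtain P :: 'v where P: "Ord P" "elts P \<approx> elts p" using small_eqpoll_Ord[of "elts p"] by blast
  define T :: "'v set" where "T = {\<alpha>. Ord \<alpha> \<and> elts \<alpha> \<lesssim> elts w}"
  have lt: "elts w \<prec> elts p"
  proof -
    have "elts ` elts p = Pow (elts w)"
    proof (intro equalityI subsetI)
      fix B assume "B \<in> Pow (elts w)"
      then have "small B" "B \<subseteq> elts w" using small_subset[OF _ small_elts] by auto
      then show "B \<in> elts ` elts p"
        by (intro image_eqI[of _ _ "vset B"]) (auto simp: p elts_vset)
    qed (auto simp: p)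
    moreover have "inj_on elts (elts p)" by (auto intro: inj_onI extensionality)
    ultimately have "elts p \<approx> Pow (elts w)"
      using inj_on_image_eqpoll_self eqpoll_sym by metis
    then show ?thesis using lesspoll_Pow_self eqpoll_sym lesspoll_eq_trans by blast
  qed
  have "T \<subseteq> elts P"
  proof
    fix \<alpha> assume "\<alpha> \<in> T"
    then have \<alpha>: "Ord \<alpha>" "elts \<alpha> \<lesssim> elts w" by (auto simp: T_def)
    show "\<alpha> \<in> elts P"
    proof (rule ccontr)
      assume "\<alpha> \<notin> elts P"
      then have "elts P \<lesssim> elts w"
        using Ord_not_mem[OF P(1) \<alpha>(1)] \<alpha>(2) subset_imp_lepoll lepoll_trans by blast
      then have "elts p \<lesssim> elts w" using P(2) eqpoll_sym lepoll_trans1 by blast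
      then show False using lt not_lepoll_iff_lesspoll by blast
    qed
  qed
  then have smT: "small T" using small_subset small_elts by blast
  define \<theta> where "\<theta> = vset T"
  have elts_\<theta>: "elts \<theta> = T" using smT by (simp add: \<theta>_def elts_vset)
  have Ord_\<theta>: "Ord \<theta>" unfolding \<theta>_def
    using smT by (intro Ord_vset)
      (auto simp: T_def intro: Ord_in_Ord dest: Ord_subset subset_imp_lepoll lepoll_trans)
  have not_le: "\<not> elts \<theta> \<lesssim> elts w"
  proof
    assume "elts \<theta> \<lesssim> elts w"
    then have "\<theta> \<in> elts \<theta>" using Ord_\<theta> elts_\<theta> by (simp add: T_def)
    then show False by simp
  qed
  have w: "w \<in> elts \<theta>" using assms(1) by (simp add: elts_\<theta> T_def)
  have Card: "Card \<theta>" unfolding Card_def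
  proof (intro conjI ballI notI)
    fix \<alpha> assume "\<alpha> \<in> elts \<theta>" "elts \<alpha> \<approx> elts \<theta>"
    then have "elts \<theta> \<lesssim> elts w" unfolding elts_\<theta> T_def
      using eqpoll_sym lepoll_trans1 by blast
    then show False using not_le by blast
  qed (rule Ord_\<theta>)
  have infinite: "infinite (elts \<theta>)"
    using inf Ord_subset[OF Ord_\<theta> w] finite_subset by blast
  have "\<exists>\<beta>\<in>elts \<theta>. \<forall>\<alpha>\<in>A. \<alpha> \<in> elts \<beta>" if A: "A \<subseteq> elts \<theta>" "A \<prec> elts \<theta>" for A
  proof -
    have "A \<lesssim> elts w"
    proof -
      have "vcard A \<in> elts \<theta>" using vcard_mem[OF Card A(2)] .
      then have "elts (vcard A :: 'v) \<lesssim> elts w" by (simp add: elts_\<theta> T_def)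
      then show ?thesis
        using vcard_props(2)[OF lesspoll_imp_lepoll[OF A(2)]] eqpoll_sym lepoll_trans1 by blast
    qed
    \<comment> \<open>Inserting each \<alpha> itself makes the bound strict: the members of
      \<open>A\<close> become elements of \<open>vset B\<close>.\<close>
    define B where "B = (\<Union>\<alpha>\<in>A. insert \<alpha> (elts \<alpha>))"
    have "B \<lesssim> elts w" unfolding B_def
    proof (rule UN_lepoll_infinite[OF inf \<open>A \<lesssim> elts w\<close>])
      fix \<alpha> assume "\<alpha> \<in> A"
      then have "elts \<alpha> \<lesssim> elts w" using A(1) by (auto simp: elts_\<theta> T_def)
      then have "{\<alpha>} \<union> elts \<alpha> \<lesssim> elts w"
        using inf by (intro Un_lepoll_infinite) (auto simp: finite_lepoll_infinite)
      then show "insert \<alpha> (elts \<alpha>) \<lesssim> elts w" by simp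
    qed
    moreover have sm: "small B" using calculation small_lepoll by blast
    moreover have "Ord (vset B)"
      using sm A(1) by (intro Ord_vset)
        (auto simp: B_def elts_\<theta> T_def intro: Ord_in_Ord Ord_trans)
    ultimately have "vset B \<in> elts \<theta>" by (simp add: elts_\<theta> T_def elts_vset)
    moreover have "\<forall>\<alpha>\<in>A. \<alpha> \<in> elts (vset B)" unfolding elts_vset[OF sm] by (auto simp: B_def)
    ultimately show ?thesis by blast
  qed
  then show ?thesis using Card infinite w by (auto simp: regular_def)
qed

section \<open>First-order definability\<close>

text \<open>A predicate is definable if one formula defines it in all structures. Assignments are
  treated as de Bruijn environments, so that the variable bound by a quantifier is number 0.\<close>

definition definable :: "('a set \<Rightarrow> ('a \<Rightarrow> 'a \<Rightarrow> bool) \<Rightarrow> (nat \<Rightarrow> 'a) \<Rightarrow> bool) \<Rightarrow> bool" where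
  "definable P \<longleftrightarrow> (\<exists>\<phi>. \<forall>A R e. range e \<subseteq> A \<longrightarrow> set_sat A R \<phi> e = P A R e)"

primrec var_bound :: "set_fm \<Rightarrow> nat" where
  "var_bound (Set_Mem m n) = Suc (max m n)"
| "var_bound (Set_Eq m n) = Suc (max m n)"
| "var_bound (Set_Neg \<phi>) = var_bound \<phi>"
| "var_bound (Set_And \<phi> \<psi>) = max (var_bound \<phi>) (var_bound \<psi>)"
| "var_bound (Set_Ex n \<phi>) = max (Suc n) (var_bound \<phi>)"

lemma set_sat_cong: "(\<And>k. k < var_bound \<phi> \<Longrightarrow> e k = e' k) \<Longrightarrow> set_sat A R \<phi> e = set_sat A R \<phi> e'"
proof (induction \<phi> arbitrary: e e')
  case (Set_And \<phi> \<psi>)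
  have "set_sat A R \<phi> e = set_sat A R \<phi> e'"
    by (rule Set_And.IH(1)) (simp add: Set_And.prems)
  moreover have "set_sat A R \<psi> e = set_sat A R \<psi> e'"
    by (rule Set_And.IH(2)) (simp add: Set_And.prems)
  ultimately show ?case by simp
next
  case (Set_Ex n \<phi>)
  have "set_sat A R \<phi> (e(n := x)) = set_sat A R \<phi> (e'(n := x))" for x
    using Set_Ex.prems by (intro Set_Ex.IH) auto
  then show ?case by simp
next
  case (Set_Neg \<phi>)
  have "set_sat A R \<phi> e = set_sat A R \<phi> e'"
    by (rule Set_Neg.IH) (simp add: Set_Neg.prems)
  then show ?case by simp
qed simp_all

text \<open>The renaming \<open>f\<close> need not be injective. Under a quantifier the bound
  variable moves to \<open>m\<close>, beyond the images of all variables of the formula, so nothing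
  is captured.\<close>

lemma set_sat_rename: "\<exists>\<psi>. \<forall>(A :: 'a set) R e. set_sat A R \<psi> e = set_sat A R \<phi> (\<lambda>k. e (f k))"
proof (induction \<phi> arbitrary: f)
  case (Set_Mem m n) show ?case by (rule exI[of _ "Set_Mem (f m) (f n)"]) simp
next
  case (Set_Eq m n) show ?case by (rule exI[of _ "Set_Eq (f m) (f n)"]) simp
next
  case (Set_Neg \<phi>)
  obtain \<psi> where "\<forall>(A :: 'a set) R e. set_sat A R \<psi> e = set_sat A R \<phi> (\<lambda>k. e (f k))" using Set_Neg by blast
  then show ?case by (intro exI[of _ "Set_Neg \<psi>"]) simp
next
  case (Set_And \<phi>1 \<phi>2)
  obtain \<psi>1 \<psi>2 where "\<forall>(A :: 'a set) R e. set_sat A R \<psi>1 e = set_sat A R \<phi>1 (\<lambda>k. e (f k))"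
    "\<forall>(A :: 'a set) R e. set_sat A R \<psi>2 e = set_sat A R \<phi>2 (\<lambda>k. e (f k))" using Set_And by metis
  then show ?case by (intro exI[of _ "Set_And \<psi>1 \<psi>2"]) simp
next
  case (Set_Ex n \<phi>)
  define m where "m = Suc (Max (f ` {..var_bound \<phi>}))"
  have m: "f k \<noteq> m" if "k < var_bound \<phi>" for k
  proof -
    have "f k \<le> Max (f ` {..var_bound \<phi>})" using that by (intro Max_ge) auto
    then show ?thesis by (simp add: m_def)
  qed
  obtain \<psi> where \<psi>: "\<forall>(A :: 'a set) R e. set_sat A R \<psi> e = set_sat A R \<phi> (\<lambda>k. e ((f(n := m)) k))"
    using Set_Ex by blast
  have "set_sat A R \<phi> (\<lambda>k. (e(m := x)) ((f(n := m)) k)) = set_sat A R \<phi> ((\<lambda>k. e (f k))(n := x))" for A R and e :: "nat \<Rightarrow> 'a" and x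
    by (rule set_sat_cong) (auto dest: m)
  then show ?case using \<psi> by (intro exI[of _ "Set_Ex m \<psi>"]) simp
qed

lemma definable_mem: "definable (\<lambda>A R e. R (e m) (e n))"
  unfolding definable_def by (rule exI[of _ "Set_Mem m n"]) simp

lemma definable_eq: "definable (\<lambda>A R e. e m = e n)"
  unfolding definable_def by (rule exI[of _ "Set_Eq m n"]) simp

lemma definable_not: "definable P \<Longrightarrow> definable (\<lambda>A R e. \<not> P A R e)"
proof -
  assume "definable P"
  then obtain \<phi> where "\<forall>A R e. range e \<subseteq> A \<longrightarrow> set_sat A R \<phi> e = P A R e"
    unfolding definable_def by blast
  then show ?thesis unfolding definable_def by (intro exI[of _ "Set_Neg \<phi>"]) simp
qed

lemma definable_conj:
  assumes "definable P" "definable Q" shows "definable (\<lambda>A R e. P A R e \<and> Q A R e)"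
proof -
  from assms obtain \<phi> \<psi> where "\<forall>A R e. range e \<subseteq> A \<longrightarrow> set_sat A R \<phi> e = P A R e"
    "\<forall>A R e. range e \<subseteq> A \<longrightarrow> set_sat A R \<psi> e = Q A R e" unfolding definable_def by metis
  then show ?thesis unfolding definable_def by (intro exI[of _ "Set_And \<phi> \<psi>"]) simp
qed

lemma definable_disj:
  assumes "definable P" "definable Q" shows "definable (\<lambda>A R e. P A R e \<or> Q A R e)"
  using definable_not[OF definable_conj[OF definable_not definable_not, OF assms]] by simp

lemma definable_imp:
  assumes "definable P" "definable Q" shows "definable (\<lambda>A R e. P A R e \<longrightarrow> Q A R e)"
  using definable_disj[OF definable_not, OF assms] by (simp only: imp_conv_disj)

lemma definable_iff:
  assumes "definable P" "definable Q" shows "definable (\<lambda>A R e. P A R e \<longleftrightarrow> Q A R e)"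
proof -
  have "(\<lambda>A R e. P A R e \<longleftrightarrow> Q A R e)
      = (\<lambda>A R e. (P A R e \<longrightarrow> Q A R e) \<and> (Q A R e \<longrightarrow> P A R e))"
    by (intro ext) blast
  then show ?thesis
    using definable_conj[OF definable_imp[OF assms] definable_imp[OF assms(2,1)]] by simp
qed

text \<open>Translates a de Bruijn binder into a named quantifier: variable 0 becomes
  \<open>N\<close>, and \<open>k\<close> becomes \<open>k - 1\<close>. As \<open>N\<close> is a
  variable bound of \<phi>, no other variable of \<phi> is sent to \<open>N\<close>.\<close>

lemma definable_ex:
  fixes P :: "'a set \<Rightarrow> ('a \<Rightarrow> 'a \<Rightarrow> bool) \<Rightarrow> (nat \<Rightarrow> 'a) \<Rightarrow> 'a \<Rightarrow> bool"
  assumes "definable (\<lambda>A R e. P A R (\<lambda>n. e (Suc n)) (e 0))"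
  shows "definable (\<lambda>A R e. \<exists>x\<in>A. P A R e x)"
proof -
  obtain \<phi> where \<phi>: "\<forall>A R e. range e \<subseteq> A \<longrightarrow> set_sat A R \<phi> e = P A R (\<lambda>n. e (Suc n)) (e 0)"
    using assms unfolding definable_def by blast
  define N where "N = var_bound \<phi>"
  define f where "f k = (if k = 0 then N else k - 1)" for k
  obtain \<psi> where \<psi>: "\<And>(A :: 'a set) R e. set_sat A R \<psi> e = set_sat A R \<phi> (\<lambda>k. e (f k))"
    using set_sat_rename by metis
  have "set_sat A R \<psi> (e(N := x)) = P A R e x" if "range e \<subseteq> A" "x \<in> A" for A R e x
  proof -
    have "set_sat A R \<psi> (e(N := x)) = set_sat A R \<phi> (case_nat x e)"
      unfolding \<psi>
      by (rule set_sat_cong) (auto simp: f_def N_def split: nat.split)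
    also have "\<dots> = P A R e x"
    proof -
      have "range (case_nat x e) \<subseteq> A" using that by (auto split: nat.splits simp: image_subset_iff)
      then show ?thesis using \<phi>[rule_format, of "case_nat x e" A R] by simp
    qed
    finally show ?thesis .
  qed
  then show ?thesis unfolding definable_def by (intro exI[of _ "Set_Ex N \<psi>"]) simp
qed

lemma definable_all:
  assumes "definable (\<lambda>A R e. P A R (\<lambda>n. e (Suc n)) (e 0))"
  shows "definable (\<lambda>A R e. \<forall>x\<in>A. P A R e x)"
  using definable_not[OF definable_ex[OF definable_not, OF assms]] by simp

text \<open>The second hypothesis is the same predicate under two binders, as the uniqueness clause
  requires: there variable 0 is the competitor \<open>y\<close>, variable 1 is \<open>x\<close>, and
  the parameters start at 2.\<close>

lemma definable_ex1:
  assumes "definable (\<lambda>A R e. P A R (\<lambda>n. e (Suc n)) (e 0))"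
    and "definable (\<lambda>A R e. P A R (\<lambda>n. e (Suc (Suc n))) (e 0))"
  shows "definable (\<lambda>A R e. \<exists>!x. x \<in> A \<and> P A R e x)"
proof -
  have "definable (\<lambda>A R e. \<exists>x\<in>A. P A R e x \<and> (\<forall>y\<in>A. P A R e y \<longrightarrow> y = x))"
    by (intro definable_ex definable_conj definable_all definable_imp definable_eq assms)
  moreover have "(\<lambda>A R e. \<exists>!x. x \<in> A \<and> P A R e x)
      = (\<lambda>A R e. \<exists>x\<in>A. P A R e x \<and> (\<forall>y\<in>A. P A R e y \<longrightarrow> y = x))"
    by (intro ext) blast
  ultimately show ?thesis by simp
qed

lemmas definable_intros = definable_mem definable_eq definable_not definable_conj definable_disj
  definable_imp definable_iff definable_ex definable_all definable_ex1

lemma definable_upair: "definable (\<lambda>A R e. int_upair A R (e p) (e a) (e b))"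
  unfolding int_upair_def by (intro definable_intros)

lemma definable_pair: "definable (\<lambda>A R e. int_pair A R (e p) (e a) (e b))"
  unfolding int_pair_def by (intro definable_intros definable_upair)

lemma definable_maps: "definable (\<lambda>A R e. int_maps A R (e f) (e a) (e b))"
  unfolding int_maps_def by (intro definable_intros definable_pair)

lemma definable_bij: "definable (\<lambda>A R e. int_bij A R (e f) (e a) (e b))"
  unfolding int_bij_def by (intro definable_intros definable_maps definable_pair)

lemma definable_Ord: "definable (\<lambda>A R e. int_Ord A R (e a))"
  unfolding int_Ord_def int_transitive_def by (intro definable_intros)

lemma definable_card_less: "definable (\<lambda>A R e. int_card_less A R (e a) (e b))"
  unfolding int_card_less_def int_is_card_def int_eqpoll_def
  by (intro definable_intros definable_Ord definable_bij)

section \<open>Elementary embeddings and submodels, evaluated at finite lists of parameters\<close>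

definition env :: "'a \<Rightarrow> 'a list \<Rightarrow> nat \<Rightarrow> 'a" where
  "env d xs k = (if k < length xs then xs ! k else d)"

lemma env_range: "d \<in> A \<Longrightarrow> set xs \<subseteq> A \<Longrightarrow> range (env d xs) \<subseteq> A"
  by (auto simp: env_def)

lemma env_Cons [simp]:
  "env d (x # xs) 0 = x" "env d (x # xs) (Suc k) = env d xs k"
  by (auto simp: env_def)

lemma env_comp: "f \<circ> env d xs = env (f d) (map f xs)"
  by (auto simp: env_def)

lemma elementary_embeddingD:
  fixes j :: "'a \<Rightarrow> 'a"
  assumes "elementary_embedding j A R B S" "definable P" "range e \<subseteq> A"
  shows "P A R e \<longleftrightarrow> P B S (j \<circ> e)"
proof -
  obtain \<phi> where "\<forall>A R e. range e \<subseteq> A \<longrightarrow> set_sat A R \<phi> e = P A R e"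
    using assms(2) unfolding definable_def by blast
  moreover have "range (j \<circ> e) \<subseteq> B"
    using assms(1,3) unfolding elementary_embedding_def by auto
  ultimately show ?thesis
    using assms(1,3) unfolding elementary_embedding_def by metis
qed

text \<open>Elementarity speaks of assignments with all values in \<open>A\<close>; padding the list
  by its own first member keeps the assignment inside \<open>A\<close> and commutes with
  \<open>j\<close>.\<close>

lemma elementary_embeddingD_list:
  fixes j :: "'a \<Rightarrow> 'a"
  assumes "elementary_embedding j A R B S" "definable P" "a \<in> A" "set xs \<subseteq> A"
  shows "P A R (env a (a # xs)) \<longleftrightarrow> P B S (env (j a) (j a # map j xs))"
  using elementary_embeddingD[OF assms(1,2), of "env a (a # xs)"] assms(3,4)
    env_range[of a A "a # xs"] by (simp add: env_comp)

lemma elementary_embedding_inj: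
  fixes j :: "'a \<Rightarrow> 'a"
  assumes "elementary_embedding j A R B S" shows "inj_on j A"
proof (rule inj_onI)
  fix x y assume "x \<in> A" "y \<in> A" "j x = j y"
  then show "x = y"
    using elementary_embeddingD_list[OF assms definable_eq[of 0 1], of x "[y]"] by simp
qed

lemma elementary_embedding_rel:
  fixes j :: "'a \<Rightarrow> 'a"
  assumes "elementary_embedding j A R B S" "x \<in> A" "y \<in> A"
  shows "S (j x) (j y) \<longleftrightarrow> R x y"
  using elementary_embeddingD_list[OF assms(1) definable_mem[of 0 1], of x "[y]"] assms(2,3) by simp

lemma elementary_embedding_in: "elementary_embedding j A R B S \<Longrightarrow> x \<in> A \<Longrightarrow> j x \<in> B"
  by (auto simp: elementary_embedding_def)

text \<open>The Tarski-Vaught property. The existential statement is pulled down to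
  \<open>M\<close>, a witness is chosen there, and elementarity lifts its property back to
  \<open>H\<close>.\<close>

lemma elementary_submodel_witness:
  assumes "elementary_submodel M H" "definable P" "a \<in> M" "set xs \<subseteq> M"
    and "\<exists>x\<in>H. P H mem (env a (x # a # xs))"
  shows "\<exists>x\<in>M. P H mem (env a (x # a # xs))"
proof -
  have emb: "elementary_embedding id M mem H mem"
    using assms(1) by (simp add: elementary_submodel_def)
  have "definable (\<lambda>A R e. \<exists>x\<in>A. P A R (case_nat x e))"
  proof (rule definable_ex)
    have "(case_nat (e 0) (\<lambda>n. e (Suc n))) = e" for e :: "nat \<Rightarrow> 'a"
      by (auto split: nat.split)
    then show "definable (\<lambda>A R e. P A R (case_nat (e 0) (\<lambda>n. e (Suc n))))"
      using assms(2) by simp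
  qed
  note iff = elementary_embeddingD_list[OF emb this assms(3,4)]
  have env: "case_nat x (env a (a # xs)) = env a (x # a # xs)" for x
    by (auto simp: env_def split: nat.split)
  from iff assms(5) obtain x where x: "x \<in> M" "P M mem (env a (x # a # xs))"
    by (auto simp: env)
  have "range (env a (x # a # xs)) \<subseteq> M"
    using x(1) assms(3,4) by (intro env_range) auto
  then show ?thesis using elementary_embeddingD[OF emb assms(2)] x by auto
qed

text \<open>The external bijection is read off from the two uniqueness clauses alone. Hence it is
  available also for an ill-founded \<open>(A, R)\<close>, in particular for the target of an
  embedding.\<close>

lemma int_bij_iff:
  assumes "int_bij A R f x y"
  shows "{a\<in>A. R a x} \<approx> {b\<in>A. R b y}"
proof -
  define g where "g a = (THE b. b \<in> A \<and> R b y \<and> int_maps A R f a b)" for a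
  have g: "g a \<in> A \<and> R (g a) y \<and> int_maps A R f a (g a)" if "a \<in> A" "R a x" for a
  proof -
    have "\<exists>!b. b \<in> A \<and> R b y \<and> int_maps A R f a b"
      using assms that unfolding int_bij_def by blast
    then show ?thesis unfolding g_def by (rule theI')
  qed
  have "bij_betw g {a\<in>A. R a x} {b\<in>A. R b y}"
    unfolding bij_betw_def
  proof (intro conjI inj_onI equalityI subsetI)
    fix a a' assume a: "a \<in> {a\<in>A. R a x}" "a' \<in> {a\<in>A. R a x}" "g a = g a'"
    then have "\<exists>!c. c \<in> A \<and> R c x \<and> int_maps A R f c (g a)"
      using assms g[of a] unfolding int_bij_def by blast
    then show "a = a'" using a g[of a] g[of a'] by auto
  next
    fix b assume b: "b \<in> {b\<in>A. R b y}"
    then obtain a where a: "a \<in> A" "R a x" "int_maps A R f a b"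
      using assms unfolding int_bij_def by blast
    moreover have "\<exists>!b. b \<in> A \<and> R b y \<and> int_maps A R f a b"
      using assms a unfolding int_bij_def by blast
    ultimately have "g a = b" using g[of a] b by blast
    then show "b \<in> g ` {a\<in>A. R a x}" using a by blast
  qed (use g in auto)
  then show ?thesis unfolding eqpoll_def by blast
qed

section \<open>The sets of hereditary cardinality less than a regular cardinal\<close>

lemma regular_Card: "regular \<theta> \<Longrightarrow> Card \<theta>" and regular_infinite: "regular \<theta> \<Longrightarrow> infinite (elts \<theta>)"
  by (auto simp: regular_def)

text \<open>By regularity the cardinals of the sets \<open>B i\<close> have a common bound \<beta>
  below \<theta>, so the union is covered by an image of \<open>I \<times> elts \<beta>\<close>, a
  product of two sets smaller than \<theta>.\<close>

lemma UN_lesspoll_regular: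
  fixes \<theta> :: "'v::zfc"
  assumes reg: "regular \<theta>" and I: "I \<prec> elts \<theta>" and B: "\<And>i. i \<in> I \<Longrightarrow> B i \<prec> elts \<theta>"
  shows "(\<Union>i\<in>I. B i) \<prec> elts \<theta>"
proof -
  note Card = regular_Card[OF reg]
  define A :: "'v set" where "A = (\<lambda>i. vcard (B i)) ` I"
  have "A \<subseteq> elts \<theta>" unfolding A_def using vcard_mem[OF Card B] by blast
  moreover have "A \<prec> elts \<theta>" unfolding A_def by (rule lesspoll_trans1[OF image_lepoll I])
  ultimately obtain \<beta> where \<beta>: "\<beta> \<in> elts \<theta>" "\<forall>\<alpha>\<in>A. \<alpha> \<in> elts \<beta>"
    using reg unfolding regular_def by blast
  have "B i \<lesssim> elts \<beta>" if "i \<in> I" for i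
  proof -
    have "elts (vcard (B i) :: 'v) \<approx> B i"
      by (rule vcard_props(2)[OF lesspoll_imp_lepoll[OF B[OF that]]])
    moreover have "elts (vcard (B i)) \<subseteq> elts \<beta>"
      using \<beta> that by (intro Ord_subset[OF Ord_in_Ord[OF Card_Ord[OF Card] \<beta>(1)]]) (auto simp: A_def)
    ultimately show ?thesis
      using lepoll_trans1[OF eqpoll_sym subset_imp_lepoll] by blast
  qed
  then have "\<forall>i\<in>I. \<exists>g. B i \<subseteq> g ` elts \<beta>" by (simp add: lepoll_iff)
  then obtain g where g: "\<forall>i\<in>I. B i \<subseteq> g i ` elts \<beta>" by metis
  have "(\<Union>i\<in>I. B i) \<subseteq> (\<lambda>(i, b). g i b) ` (I \<times> elts \<beta>)"
    using g by fastforce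
  then have "(\<Union>i\<in>I. B i) \<lesssim> I \<times> elts \<beta>" by (rule subset_image_lepoll)
  then show ?thesis
    by (rule lesspoll_trans1) (rule times_lesspoll_infinite[OF regular_infinite[OF reg] I
        Card_mem_lesspoll[OF Card \<beta>(1)]])
qed

lemma trcl_least:
  assumes "elts x \<subseteq> A" "\<And>y z. y \<in> A \<Longrightarrow> z \<in> elts y \<Longrightarrow> z \<in> A"
  shows "trcl x \<subseteq> A"
proof
  fix y assume "y \<in> trcl x"
  then have "(y, x) \<in> {(a, b). a \<in> elts b}\<^sup>+" by (simp add: trcl_def)
  then show "y \<in> A"
    by (induction rule: converse_trancl_induct) (use assms in auto)
qed

lemma trcl_elts: "elts x \<subseteq> trcl x"
  by (auto simp: trcl_def)

lemma trcl_trans: "y \<in> trcl x \<Longrightarrow> trcl y \<subseteq> trcl x"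
  by (auto simp: trcl_def)

lemma trcl_mono: "elts x \<subseteq> elts y \<Longrightarrow> trcl x \<subseteq> trcl y"
  using trcl_least[of x "trcl y"] trcl_elts trcl_trans by blast

lemma Hset_mem: "x \<in> Hset \<theta> \<Longrightarrow> y \<in> elts x \<Longrightarrow> y \<in> Hset \<theta>"
  unfolding Hset_def mem_Collect_eq
  by (rule lesspoll_trans1[OF subset_imp_lepoll[OF trcl_trans]]) (use trcl_elts in blast)

lemma Hset_subset: "y \<in> Hset \<theta> \<Longrightarrow> elts x \<subseteq> elts y \<Longrightarrow> x \<in> Hset \<theta>"
  unfolding Hset_def mem_Collect_eq
  by (rule lesspoll_trans1[OF subset_imp_lepoll[OF trcl_mono]])

lemma Hset_lesspoll: "x \<in> Hset \<theta> \<Longrightarrow> elts x \<prec> elts \<theta>"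
  unfolding Hset_def mem_Collect_eq
  by (rule lesspoll_trans1[OF subset_imp_lepoll[OF trcl_elts]])

text \<open>The transitive closure of \<open>vset A\<close> is covered by \<open>A\<close> together
  with fewer than \<theta> transitive closures, each smaller than \<theta>; regularity bounds the
  union.\<close>

lemma Hset_vset:
  assumes reg: "regular \<theta>" and A: "A \<subseteq> Hset \<theta>" "A \<prec> elts \<theta>"
  shows "small A" "vset A \<in> Hset \<theta>"
proof -
  show sm: "small A" by (rule small_lepoll[OF lesspoll_imp_lepoll[OF A(2)]])
  have "trcl (vset A) \<subseteq> A \<union> (\<Union>a\<in>A. trcl a)"
    using trcl_elts trcl_trans by (intro trcl_least) (auto simp: elts_vset[OF sm], blast+)
  moreover have "A \<union> (\<Union>a\<in>A. trcl a) \<prec> elts \<theta>"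
    using A by (intro Un_lesspoll_infinite UN_lesspoll_regular reg regular_infinite[OF reg])
      (auto simp: Hset_def)
  ultimately show "vset A \<in> Hset \<theta>"
    unfolding Hset_def mem_Collect_eq using lesspoll_trans1[OF subset_imp_lepoll] by blast
qed

lemma Hset_Ord:
  assumes "Card \<theta>" "\<alpha> \<in> elts \<theta>" shows "\<alpha> \<in> Hset \<theta>"
proof -
  have "trcl \<alpha> \<subseteq> elts \<alpha>"
    using Ord_trans[OF Ord_in_Ord[OF Card_Ord[OF assms(1)] assms(2)]] by (intro trcl_least) auto
  then show ?thesis
    unfolding Hset_def mem_Collect_eq
    using lesspoll_trans1[OF subset_imp_lepoll Card_mem_lesspoll[OF assms]] by blast
qed

lemma Hset_upair:
  assumes "regular \<theta>" "a \<in> Hset \<theta>" "b \<in> Hset \<theta>"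
  shows "vset {a, b} \<in> Hset \<theta>"
  using assms regular_infinite[OF assms(1)]
  by (intro Hset_vset) (auto simp: finite_lesspoll_infinite)

lemma Hset_kpair:
  assumes "regular \<theta>" "a \<in> Hset \<theta>" "b \<in> Hset \<theta>"
  shows "kpair a b \<in> Hset \<theta>"
  unfolding kpair_def by (intro Hset_upair assms)

lemma Hset_int_upair:
  assumes "regular \<theta>" "p \<in> Hset \<theta>" "a \<in> Hset \<theta>" "b \<in> Hset \<theta>"
  shows "int_upair (Hset \<theta>) mem p a b \<longleftrightarrow> p = vset {a, b}"
proof
  assume "int_upair (Hset \<theta>) mem p a b"
  then have "elts p = {a, b}"
    using assms Hset_mem[OF assms(2)] unfolding int_upair_def mem_def by blast
  then show "p = vset {a, b}" by (metis vset_elts)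
qed (simp add: int_upair_def mem_def elts_vset)

lemma Hset_int_pair:
  assumes "regular \<theta>" "p \<in> Hset \<theta>" "a \<in> Hset \<theta>" "b \<in> Hset \<theta>"
  shows "int_pair (Hset \<theta>) mem p a b \<longleftrightarrow> p = kpair a b"
proof -
  have "int_pair (Hset \<theta>) mem p a b
      \<longleftrightarrow> (\<exists>s\<in>Hset \<theta>. \<exists>t\<in>Hset \<theta>. s = vset {a, a} \<and> t = vset {a, b} \<and> p = vset {s, t})"
    unfolding int_pair_def using Hset_int_upair[OF assms(1)] assms by (intro bex_cong refl) auto
  then show ?thesis
    using Hset_upair[OF assms(1,3,3)] Hset_upair[OF assms(1,3,4)] unfolding kpair_def by simp
qed

lemma Hset_int_maps:
  assumes "regular \<theta>" "f \<in> Hset \<theta>" "a \<in> Hset \<theta>" "b \<in> Hset \<theta>"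
  shows "int_maps (Hset \<theta>) mem f a b \<longleftrightarrow> kpair a b \<in> elts f"
  unfolding int_maps_def mem_def[of _ f]
  using Hset_int_pair[OF assms(1) _ assms(3,4)] Hset_kpair[OF assms(1,3,4)] by auto

text \<open>Absoluteness of equipollence: the graph of a bijection is a subset of H(\<theta>) of
  size less than \<theta>, hence an element of H(\<theta>).\<close>

lemma Hset_int_eqpoll:
  assumes reg: "regular \<theta>" and x: "x \<in> Hset \<theta>" and y: "y \<in> Hset \<theta>"
  shows "int_eqpoll (Hset \<theta>) mem x y \<longleftrightarrow> elts x \<approx> elts y"
proof
  assume "int_eqpoll (Hset \<theta>) mem x y"
  then obtain f where "int_bij (Hset \<theta>) mem f x y" by (auto simp: int_eqpoll_def)
  from int_bij_iff[OF this] show "elts x \<approx> elts y"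
    using Hset_mem[OF x] Hset_mem[OF y] by (simp add: mem_def Int_absorb1 subsetI Collect_conj_eq)
next
  assume "elts x \<approx> elts y"
  then obtain g where g: "bij_betw g (elts x) (elts y)" by (auto simp: eqpoll_def)
  define G where "G = (\<lambda>a. kpair a (g a)) ` elts x"
  have gy: "g a \<in> elts y" if "a \<in> elts x" for a using g that by (auto simp: bij_betw_def)
  have "G \<subseteq> Hset \<theta>"
    using Hset_mem[OF x] Hset_mem[OF y gy] Hset_kpair[OF reg] by (auto simp: G_def)
  moreover have "G \<prec> elts \<theta>"
    unfolding G_def by (rule lesspoll_trans1[OF image_lepoll Hset_lesspoll[OF x]])
  ultimately have "small G" and GH: "vset G \<in> Hset \<theta>" using Hset_vset[OF reg] by auto
  then have elts_G: "elts (vset G) = (\<lambda>a. kpair a (g a)) ` elts x"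
    by (simp add: elts_vset G_def)
  have maps: "int_maps (Hset \<theta>) mem (vset G) a b \<longleftrightarrow> a \<in> elts x \<and> b = g a"
    if "a \<in> Hset \<theta>" "b \<in> Hset \<theta>" for a b
    unfolding Hset_int_maps[OF reg GH that] elts_G by auto
  have "int_bij (Hset \<theta>) mem (vset G) x y"
    unfolding int_bij_def
  proof (intro conjI ballI impI)
    fix p assume "p \<in> Hset \<theta>" "mem p (vset G)"
    then obtain a where a: "a \<in> elts x" "p = kpair a (g a)"
      unfolding mem_def elts_G by blast
    then show "\<exists>a\<in>Hset \<theta>. \<exists>b\<in>Hset \<theta>. mem a x \<and> mem b y \<and> int_pair (Hset \<theta>) mem p a b"
      using Hset_mem[OF x] Hset_mem[OF y] gy Hset_int_pair[OF reg \<open>p \<in> Hset \<theta>\<close>]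
      by (intro bexI[of _ a] bexI[of _ "g a"]) (auto simp: mem_def)
  next
    fix a assume "a \<in> Hset \<theta>" "mem a x"
    then show "\<exists>!b. b \<in> Hset \<theta> \<and> mem b y \<and> int_maps (Hset \<theta>) mem (vset G) a b"
      using maps gy Hset_mem[OF y gy] by (intro ex1I[of _ "g a"]) (auto simp: mem_def)
  next
    fix b assume b: "b \<in> Hset \<theta>" "mem b y"
    then obtain a where a: "a \<in> elts x" "b = g a" using g by (auto simp: mem_def bij_betw_def)
    show "\<exists>!a. a \<in> Hset \<theta> \<and> mem a x \<and> int_maps (Hset \<theta>) mem (vset G) a b"
      using maps a b Hset_mem[OF x] g
      by (intro ex1I[of _ a]) (auto simp: mem_def bij_betw_def dest: inj_onD)
  qed
  then show "int_eqpoll (Hset \<theta>) mem x y" unfolding int_eqpoll_def using GH by blast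
qed

lemma Hset_int_Ord:
  assumes "m \<in> Hset \<theta>" shows "int_Ord (Hset \<theta>) mem m \<longleftrightarrow> Ord m"
proof -
  have "int_transitive (Hset \<theta>) mem x \<longleftrightarrow> transitive_set x" if "x \<in> Hset \<theta>" for x
    using Hset_mem[OF that] Hset_mem unfolding int_transitive_def transitive_set_def mem_def by blast
  then show ?thesis
    using assms Hset_mem[OF assms] unfolding int_Ord_def Ord_def by (auto simp: mem_def)
qed

lemma Hset_int_card_less:
  assumes reg: "regular \<theta>" and x: "x \<in> Hset \<theta>" and \<kappa>: "Card \<kappa>" "\<kappa> \<in> Hset \<theta>"
  shows "int_card_less (Hset \<theta>) mem x \<kappa> \<longleftrightarrow> elts x \<prec> elts \<kappa>"
proof
  assume "int_card_less (Hset \<theta>) mem x \<kappa>"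
  then obtain m where "m \<in> Hset \<theta>" "int_eqpoll (Hset \<theta>) mem x m" "m \<in> elts \<kappa>"
    by (auto simp: int_card_less_def int_is_card_def mem_def)
  then show "elts x \<prec> elts \<kappa>"
    using Hset_int_eqpoll[OF reg x] Card_mem_lesspoll[OF \<kappa>(1)] eq_lesspoll_trans by blast
next
  assume lt: "elts x \<prec> elts \<kappa>"
  note v = vcard_props[OF lesspoll_imp_lepoll[OF lt]] and m = vcard_mem[OF \<kappa>(1) lt]
  have mH: "vcard (elts x) \<in> Hset \<theta>" using Hset_mem[OF \<kappa>(2) m] .
  have "\<not> elts x \<approx> elts n" if "n \<in> elts (vcard (elts x))" for n :: 'a
    using v that unfolding Card_def using eqpoll_sym eqpoll_trans by blast
  then have "int_is_card (Hset \<theta>) mem (vcard (elts x)) x"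
    unfolding int_is_card_def
    using Hset_int_Ord[OF mH] Hset_int_eqpoll[OF reg x] mH eqpoll_sym[OF v(2)] Card_Ord[OF v(1)]
    by (auto simp: mem_def)
  then show "int_card_less (Hset \<theta>) mem x \<kappa>"
    unfolding int_card_less_def using m mH by (auto simp: mem_def)
qed

text \<open>The witness that elementarity produces in \<open>M\<close> can only be \<open>x\<close>,
  as nothing else in \<open>H\<close> satisfies \<open>P\<close>. This is how definable objects are
  shown to belong to \<open>M\<close>.\<close>

lemma elementary_submodel_unique:
  assumes sub: "elementary_submodel M H" and def: "definable P" and a: "a \<in> M" "set xs \<subseteq> M"
    and x: "x \<in> H" "P H mem (env a (x # a # xs))"
    and uniq: "\<And>y. y \<in> H \<Longrightarrow> P H mem (env a (y # a # xs)) \<Longrightarrow> y = x"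
  shows "x \<in> M"
proof -
  obtain y where "y \<in> M" "P H mem (env a (y # a # xs))"
    using elementary_submodel_witness[OF sub def a] x by blast
  moreover have "y \<in> H" using \<open>y \<in> M\<close> sub by (auto simp: elementary_submodel_def)
  ultimately show ?thesis using uniq by blast
qed

section \<open>The set of small subsets of a cardinal\<close>

lemma elts_Pkl: "elts (Pkl \<kappa> lam) = {x. elts x \<subseteq> elts lam \<and> elts x \<prec> elts \<kappa>}"
  unfolding Pkl_def by (rule elts_vset[OF small_subset[OF _ small_Pow[of lam]]]) blast

lemma finite_Ord_mem: "Ord n \<Longrightarrow> finite (elts n) \<Longrightarrow> Ord \<kappa> \<Longrightarrow> infinite (elts \<kappa>) \<Longrightarrow> n \<in> elts \<kappa>"
  using Ord_not_mem[of \<kappa> n] finite_subset by blast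

definition zero :: "'v::zfc" where "zero = vset {}"
definition two :: "'v::zfc" where "two = vset {zero, vset {zero}}"

lemma elts_zero: "elts zero = {}" by (simp add: zero_def elts_vset)
lemma elts_two: "elts two = {zero, vset {zero}}" by (simp add: two_def elts_vset)
lemma Ord_zero: "Ord zero" by (simp add: Ord_def transitive_set_def elts_zero)
lemma Ord_two: "Ord two"
  by (auto simp: Ord_def transitive_set_def elts_two elts_zero elts_vset)

lemma one_neq_zero: "vset {zero} \<noteq> zero"
  unfolding zero_def by (simp add: vset_inject)

text \<open>A function is coded by its graph, a subset of a product set. Such an embedding into a
  set is what \<open>vcard_props\<close> requires before \<open>cpower\<close> can be used.\<close>

lemma funset_lepoll: "\<exists>x :: 'v::zfc. (elts (\<mu> :: 'v) \<rightarrow>\<^sub>E elts (lam :: 'v)) \<lesssim> elts x"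
proof -
  define P where "P = (\<lambda>(a, b). kpair a b) ` (elts \<mu> \<times> elts lam)"
  have sP: "small P" unfolding P_def by (rule small_times)
  obtain p where p: "elts p = {y. elts y \<subseteq> elts (vset P)}" using powerset by blast
  define g where "g f = vset ((\<lambda>i. kpair i (f i)) ` elts \<mu>)" for f :: "'v \<Rightarrow> 'v"
  have elts_g: "elts (g f) = (\<lambda>i. kpair i (f i)) ` elts \<mu>" for f
    unfolding g_def by (intro elts_vset small_image small_elts)
  have "inj_on g (elts \<mu> \<rightarrow>\<^sub>E elts lam)"
  proof (rule inj_onI)
    fix f f' assume f: "f \<in> elts \<mu> \<rightarrow>\<^sub>E elts lam" "f' \<in> elts \<mu> \<rightarrow>\<^sub>E elts lam" "g f = g f'"
    show "f = f'"
    proof (rule PiE_ext[OF f(1,2)])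
      fix i assume "i \<in> elts \<mu>"
      then have "kpair i (f i) \<in> elts (g f')" unfolding f(3)[symmetric] elts_g by blast
      then show "f i = f' i" unfolding elts_g by auto
    qed
  qed
  moreover have "g ` (elts \<mu> \<rightarrow>\<^sub>E elts lam) \<subseteq> elts p"
  proof (rule image_subsetI)
    fix f assume "f \<in> elts \<mu> \<rightarrow>\<^sub>E elts lam"
    then have "elts (g f) \<subseteq> P" unfolding elts_g P_def by fastforce
    then show "g f \<in> elts p" unfolding p elts_vset[OF sP] by simp
  qed
  ultimately show ?thesis unfolding lepoll_def by blast
qed

lemma cpower_props:
  fixes lam :: "'v::zfc"
  shows "Card (cpower lam \<mu>)" "elts (cpower lam \<mu>) \<approx> (elts \<mu> \<rightarrow>\<^sub>E elts lam)"
proof -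
  obtain x :: 'v where "(elts \<mu> \<rightarrow>\<^sub>E elts lam) \<lesssim> elts x" using funset_lepoll by blast
  from vcard_props[OF this] show "Card (cpower lam \<mu>)" "elts (cpower lam \<mu>) \<approx> (elts \<mu> \<rightarrow>\<^sub>E elts lam)"
    unfolding cpower_def by auto
qed

lemma elts_weak_cpower:
  "elts (weak_cpower lam \<kappa>) = (\<Union>\<mu>\<in>{\<mu>\<in>elts \<kappa>. Card \<mu>}. elts (cpower lam \<mu>))"
proof -
  have "small {\<mu>\<in>elts \<kappa>. Card \<mu>}" by (rule small_subset[OF _ small_elts[of \<kappa>]]) blast
  then show ?thesis unfolding weak_cpower_def by (intro elts_vset small_UN small_elts)
qed

lemma funset_lepoll_weak_cpower:
  assumes "Card \<mu>" "\<mu> \<in> elts \<kappa>"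
  shows "(elts \<mu> \<rightarrow>\<^sub>E elts lam) \<lesssim> elts (weak_cpower lam \<kappa>)"
proof -
  have "elts (cpower lam \<mu>) \<subseteq> elts (weak_cpower lam \<kappa>)"
    unfolding elts_weak_cpower using assms by blast
  then show ?thesis
    by (rule lepoll_trans1[OF eqpoll_sym[OF cpower_props(2)] subset_imp_lepoll])
qed

lemma lepoll_weak_cpower:
  assumes "Card \<kappa>" "infinite (elts \<kappa>)"
  shows "elts lam \<lesssim> elts (weak_cpower lam \<kappa>)"
proof -
  \<comment> \<open>The exponent 1 already contributes a copy of \<open>lam\<close> to the weak
    power.\<close>
  define one where "one = vset {zero :: 'a}"
  have elts_one: "elts one = {zero}" by (simp add: one_def elts_vset)
  have "Ord one" by (simp add: Ord_def transitive_set_def elts_one elts_zero)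
  then have "one \<in> elts \<kappa>" "Card one"
    using finite_Ord_mem[OF _ _ Card_Ord[OF assms(1)] assms(2), of one] eqpoll_sym
    by (auto simp: elts_one Card_def elts_zero dest: eqpoll_sym)
  from funset_lepoll_weak_cpower[OF this(2,1), of lam] show ?thesis
    unfolding elts_one by (rule lepoll_trans1[OF eqpoll_sym[OF PiE_sing_eqpoll_self]])
qed

text \<open>Every \<open>x\<close> is the range of a function into \<open>lam\<close> whose domain
  is the cardinality \<mu> < \<kappa> of \<open>x\<close>. For each such \<mu> there are at most as
  many functions as the weak power has elements, and \<kappa> itself is no larger than the weak
  power.\<close>

lemma Pkl_lepoll:
  fixes \<kappa> lam :: "'v::zfc"
  assumes \<kappa>: "Card \<kappa>" "infinite (elts \<kappa>)" and sub: "elts \<kappa> \<subseteq> elts lam"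
  shows "elts (Pkl \<kappa> lam) \<lesssim> elts (weak_cpower lam \<kappa>)"
proof -
  let ?W = "elts (weak_cpower lam \<kappa>)"
  have "elts \<kappa> \<lesssim> ?W"
    by (rule lepoll_trans[OF subset_imp_lepoll[OF sub] lepoll_weak_cpower[OF \<kappa>]])
  then have inf: "infinite ?W" using \<kappa>(2) by (meson finite_lepoll_infinite lepoll_def inj_on_finite)
  have "{\<mu>\<in>elts \<kappa>. Card \<mu>} \<lesssim> ?W"
    by (rule lepoll_trans[OF subset_imp_lepoll \<open>elts \<kappa> \<lesssim> ?W\<close>]) blast
  then have le: "(\<Union>\<mu>\<in>{\<mu>\<in>elts \<kappa>. Card \<mu>}. (\<lambda>f. f ` elts \<mu>) ` (elts \<mu> \<rightarrow>\<^sub>E elts lam)) \<lesssim> ?W"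
    using lepoll_trans[OF image_lepoll funset_lepoll_weak_cpower] inf
    by (intro UN_lepoll_infinite) auto
  have "elts ` elts (Pkl \<kappa> lam)
      \<subseteq> (\<Union>\<mu>\<in>{\<mu>\<in>elts \<kappa>. Card \<mu>}. (\<lambda>f. f ` elts \<mu>) ` (elts \<mu> \<rightarrow>\<^sub>E elts lam))"
  proof (rule image_subsetI)
    fix x assume x: "x \<in> elts (Pkl \<kappa> lam)"
    then have lt: "elts x \<prec> elts \<kappa>" and xl: "elts x \<subseteq> elts lam" by (auto simp: elts_Pkl)
    note v = vcard_props[OF lesspoll_imp_lepoll[OF lt]]
    obtain g where g: "bij_betw g (elts (vcard (elts x) :: 'v)) (elts x)"
      using v(2) by (auto simp: eqpoll_def)
    then have "elts x = restrict g (elts (vcard (elts x))) ` elts (vcard (elts x))"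
      "restrict g (elts (vcard (elts x))) \<in> elts (vcard (elts x)) \<rightarrow>\<^sub>E elts lam"
      using xl by (auto simp: bij_betw_def)
    then show "elts x \<in> (\<Union>\<mu>\<in>{\<mu>\<in>elts \<kappa>. Card \<mu>}. (\<lambda>f. f ` elts \<mu>) ` (elts \<mu> \<rightarrow>\<^sub>E elts lam))"
      using v(1) vcard_mem[OF \<kappa>(1) lt] by blast
  qed
  then have "elts ` elts (Pkl \<kappa> lam) \<lesssim> ?W" by (rule lepoll_trans[OF subset_imp_lepoll le])
  moreover have "inj_on elts (elts (Pkl \<kappa> lam))" by (auto intro: inj_onI extensionality)
  ultimately show ?thesis by simp
qed

text \<open>A set \<open>y\<close> codes the family of the sets \<open>Y\<^sub>\<xi> = {x. (\<xi>, x) \<in> y}\<close>, \<open>\<xi> < lam\<close>, and \<open>u\<close> codes a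
  fine, \<open><\<delta>\<close>-complete ultrafilter on the algebra generated by them: \<open>\<xi> \<in> u\<close> says that \<open>Y\<^sub>\<xi>\<close> belongs to
  the ultrafilter.\<close>

definition family_measure :: "'v::zfc \<Rightarrow> 'v \<Rightarrow> 'v \<Rightarrow> bool" where
  "family_measure \<delta> \<kappa> lam \<longleftrightarrow> (\<forall>y. \<exists>u. \<forall>a\<in>elts (Pkl \<delta> lam). \<exists>x\<in>elts (Pkl \<kappa> lam). \<forall>\<xi>\<in>elts a.
     \<xi> \<in> elts x \<and> (\<xi> \<in> elts u \<longleftrightarrow> kpair \<xi> x \<in> elts y))"

section \<open>A fixed elementary submodel \<open>M\<close> of H(\<theta>), and
  \<open>family_measure\<close> derived from it\<close>

locale submodel_setting =
  fixes \<delta> \<kappa> lam \<theta> :: "'v::zfc" and M :: "'v set"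
  assumes \<delta>: "uncountable_Card \<delta>" and \<kappa>: "uncountable_Card \<kappa>" and lam: "uncountable_Card lam"
    and \<delta>\<kappa>: "elts \<delta> \<subseteq> elts \<kappa>" and \<kappa>lam: "elts \<kappa> \<subseteq> elts lam"
    and \<theta>: "regular_above \<kappa> lam \<theta>" and M: "good_submodel lam \<theta> M"
begin

lemma reg: "regular \<theta>" using \<theta> by (simp add: regular_above_def)

lemma Cards: "Card \<delta>" "Card \<kappa>" "Card lam" "Card \<theta>"
  and infinites: "infinite (elts \<delta>)" "infinite (elts \<kappa>)" "infinite (elts lam)" "infinite (elts \<theta>)"
  using \<delta> \<kappa> lam reg by (auto simp: uncountable_Card_def regular_def countable_finite)

lemma sub: "elementary_submodel M (Hset \<theta>)" and M_size: "M \<approx> elts lam" and lam_M: "lam \<in> M"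
  and lam_sub: "elts lam \<subseteq> M"
  using M by (auto simp: good_submodel_def)

lemma MH: "x \<in> M \<Longrightarrow> x \<in> Hset \<theta>"
  using sub by (auto simp: elementary_submodel_def)

lemma emb_id: "elementary_embedding id M mem (Hset \<theta>) mem"
  using sub by (simp add: elementary_submodel_def)

lemma Ord_le_lam: "Ord \<alpha> \<Longrightarrow> elts \<alpha> \<subseteq> elts lam \<Longrightarrow> \<alpha> \<in> M"
  using Ord_subset_mem[OF _ Card_Ord[OF Cards(3)]] lam_M lam_sub by blast

lemma \<kappa>_M: "\<kappa> \<in> M" and \<delta>_M: "\<delta> \<in> M"
  using Ord_le_lam Card_Ord Cards \<delta>\<kappa> \<kappa>lam by blast+

lemma W_lesspoll: "elts (weak_cpower lam \<kappa>) \<prec> elts \<theta>"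
  using \<theta> Card_mem_lesspoll[OF Cards(4)] by (simp add: regular_above_def)

text \<open>This is the use of the lower bound on \<theta>: P_\<kappa>(lam) is no larger than the
  weak power, hence smaller than \<theta>.\<close>

lemma Pkl_H: "Pkl \<kappa> lam \<in> Hset \<theta>"
proof -
  have lamH: "lam \<in> Hset \<theta>" using MH[OF lam_M] .
  have P: "elts (Pkl \<kappa> lam) \<prec> elts \<theta>"
    by (rule lesspoll_trans1[OF Pkl_lepoll[OF Cards(2) infinites(2) \<kappa>lam] W_lesspoll])
  have "elts (Pkl \<kappa> lam) \<subseteq> Hset \<theta>" using Hset_subset[OF lamH] by (auto simp: elts_Pkl)
  from Hset_vset(2)[OF reg this P] show ?thesis by simp
qed

lemma Pkl_mono: "elts (Pkl \<delta> lam) \<subseteq> elts (Pkl \<kappa> lam)"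
  unfolding elts_Pkl using lesspoll_trans2[OF _ subset_imp_lepoll[OF \<delta>\<kappa>]] by blast

lemma Pkl_\<delta>_H: "Pkl \<delta> lam \<in> Hset \<theta>"
  by (rule Hset_subset[OF Pkl_H Pkl_mono])

lemma Pkl_in_M:
  assumes "Card \<mu>" "\<mu> \<in> M" "Pkl \<mu> lam \<in> Hset \<theta>"
  shows "Pkl \<mu> lam \<in> M"
proof -
  define P where "P = (\<lambda>(A :: 'v set) R e. \<forall>x\<in>A. R x (e 0) \<longleftrightarrow>
      (\<forall>z\<in>A. R z x \<longrightarrow> R z (e (Suc 0))) \<and> int_card_less A R x (e (Suc (Suc 0))))"
  have "definable P" unfolding P_def by (intro definable_intros definable_card_less)
  have eq: "(x \<in> elts (Pkl \<mu> lam)) \<longleftrightarrow>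
      (\<forall>z\<in>Hset \<theta>. z \<in> elts x \<longrightarrow> z \<in> elts lam) \<and> int_card_less (Hset \<theta>) mem x \<mu>"
    if "x \<in> Hset \<theta>" for x
    unfolding elts_Pkl Hset_int_card_less[OF reg that assms(1) MH[OF assms(2)]]
    using Hset_mem[OF that] by blast
  show ?thesis
  proof (rule elementary_submodel_unique[OF sub \<open>definable P\<close> lam_M, of "[\<mu>]"])
    show "P (Hset \<theta>) mem (env lam [Pkl \<mu> lam, lam, \<mu>])"
      unfolding P_def using eq by (simp add: mem_def)
    fix y assume y: "y \<in> Hset \<theta>" "P (Hset \<theta>) mem (env lam [y, lam, \<mu>])"
    have "x \<in> elts y \<longleftrightarrow> x \<in> elts (Pkl \<mu> lam)" if "x \<in> Hset \<theta>" for x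
      using y(2) eq[OF that] that unfolding P_def by (simp add: mem_def)
    then show "y = Pkl \<mu> lam"
      using Hset_mem[OF y(1)] Hset_mem[OF assms(3)] by (intro extensionality) blast
  qed (use assms in auto)
qed

lemma Pkl_M: "Pkl \<kappa> lam \<in> M" "Pkl \<delta> lam \<in> M"
  using Pkl_in_M Cards \<kappa>_M \<delta>_M Pkl_H Pkl_\<delta>_H by auto

text \<open>In H(\<theta>), \<open>S\<close> is the only set with these elements. Inside
  \<open>P\<close>, variable 0 is the element, variable 1 is \<open>X\<close>, and the further
  parameters start at 2; the indices in later applications follow this scheme.\<close>

lemma separation_in_M:
  assumes "definable P" "X \<in> M" "set xs \<subseteq> M"
    and "S = vset {x \<in> elts X. P (Hset \<theta>) mem (env X (x # X # xs))}"
  shows "S \<in> M"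
proof -
  have el: "elts S = {x \<in> elts X. P (Hset \<theta>) mem (env X (x # X # xs))}"
    unfolding assms(4) by (rule elts_vset[OF small_subset[OF _ small_elts[of X]]]) blast
  have SH: "S \<in> Hset \<theta>" by (rule Hset_subset[OF MH[OF assms(2)]]) (auto simp: el)
  define Q where "Q = (\<lambda>A R e. \<forall>x\<in>A. R x (e 0) \<longleftrightarrow> R x (e (Suc 0)) \<and> P A R (case_nat x (\<lambda>n. e (Suc n))))"
  have "definable (\<lambda>A R e. P A R (case_nat (e 0) (\<lambda>n. e (Suc (Suc n)))))"
  proof -
    obtain \<phi> where \<phi>: "\<forall>A R e. range e \<subseteq> A \<longrightarrow> set_sat A R \<phi> e = P A R e"
      using assms(1) unfolding definable_def by blast
    \<comment> \<open>The renaming skips variable 1, which in the body of \<open>Q\<close> stands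
      for the set that is being defined.\<close>
    obtain \<psi> where \<psi>: "\<forall>(A::'v set) R e. set_sat A R \<psi> e = set_sat A R \<phi> (\<lambda>k. e (case k of 0 \<Rightarrow> 0 | Suc n \<Rightarrow> Suc (Suc n)))"
      using set_sat_rename by blast
    have "(\<lambda>k. e (case k of 0 \<Rightarrow> 0 | Suc n \<Rightarrow> Suc (Suc n))) = case_nat (e 0) (\<lambda>n. e (Suc (Suc n)))"
      for e :: "nat \<Rightarrow> 'v"
      by (auto split: nat.split)
    moreover have "range (case_nat (e 0) (\<lambda>n. e (Suc (Suc n)))) \<subseteq> A" if "range e \<subseteq> A" for e and A :: "'v set"
      using that by (auto split: nat.splits simp: image_subset_iff)
    ultimately show ?thesis unfolding definable_def using \<phi> \<psi> by (intro exI[of _ \<psi>]) simp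
  qed
  then have "definable Q" unfolding Q_def by (intro definable_intros)
  have env: "case_nat x (\<lambda>n. env X (y # X # xs) (Suc n)) = env X (x # X # xs)" for x y
    by (auto simp: env_def split: nat.split)
  show ?thesis
  proof (rule elementary_submodel_unique[OF sub \<open>definable Q\<close> assms(2,3) SH])
    show "Q (Hset \<theta>) mem (env X (S # X # xs))"
      unfolding Q_def env by (simp add: mem_def el)
    fix y assume y: "y \<in> Hset \<theta>" "Q (Hset \<theta>) mem (env X (y # X # xs))"
    then have "x \<in> elts y \<longleftrightarrow> x \<in> elts S" if "x \<in> Hset \<theta>" for x
      using that unfolding Q_def env by (simp add: mem_def el)
    then show "y = S"
      using Hset_mem[OF y(1)] Hset_mem[OF SH] by (intro extensionality) blast
  qed
qed

text \<open>\<open>family_measure\<close> is a first-order statement about \<open>H(\<theta>)\<close> with parameters in \<open>M\<close>, so a counterexample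
  \<open>y\<close> would already exist in \<open>M\<close>. The witness \<open>u\<close> need not be in \<open>M\<close>.\<close>

lemma family_measure_reflect:
  assumes "\<And>y. y \<in> M \<Longrightarrow> \<exists>u. \<forall>a\<in>elts (Pkl \<delta> lam). \<exists>x\<in>elts (Pkl \<kappa> lam). \<forall>\<xi>\<in>elts a.
     \<xi> \<in> elts x \<and> (\<xi> \<in> elts u \<longleftrightarrow> kpair \<xi> x \<in> elts y)"
  shows "family_measure \<delta> \<kappa> lam"
proof (rule ccontr)
  let ?H = "Hset \<theta>" and ?X = "Pkl \<kappa> lam" and ?D = "Pkl \<delta> lam"
  define B where "B y \<longleftrightarrow> (\<exists>u. \<forall>a\<in>elts ?D. \<exists>x\<in>elts ?X. \<forall>\<xi>\<in>elts a.
     \<xi> \<in> elts x \<and> (\<xi> \<in> elts u \<longleftrightarrow> kpair \<xi> x \<in> elts y))" for y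
  assume "\<not> family_measure \<delta> \<kappa> lam"
  then obtain y0 where y0: "\<not> B y0" unfolding family_measure_def B_def by blast
  \<comment> \<open>An arbitrary \<open>y0\<close> may lie outside H(\<theta>). Only its pairs in
    the product of \<open>lam\<close> and P_\<kappa>(lam) matter, and these form an element of
    H(\<theta>).\<close>
  define Y where "Y = elts y0 \<inter> (\<lambda>(a, b). kpair a b) ` (elts lam \<times> elts ?X)"
  have lamH: "lam \<in> ?H" by (rule MH[OF lam_M])
  have "Y \<subseteq> ?H" unfolding Y_def using Hset_kpair[OF reg Hset_mem[OF lamH] Hset_mem[OF Pkl_H]] by auto
  moreover have "Y \<prec> elts \<theta>"
  proof -
    have "Y \<lesssim> elts lam \<times> elts ?X" unfolding Y_def by (rule subset_image_lepoll) blast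
    then show ?thesis
      by (rule lesspoll_trans1) (intro times_lesspoll_infinite infinites Hset_lesspoll lamH Pkl_H)
  qed
  ultimately have sY: "small Y" and YH: "vset Y \<in> ?H" using Hset_vset[OF reg] by auto
  have kp: "kpair \<xi> x \<in> elts (vset Y) \<longleftrightarrow> kpair \<xi> x \<in> elts y0"
    if "\<xi> \<in> elts a" "a \<in> elts ?D" "x \<in> elts ?X" for \<xi> x a
  proof -
    have "kpair \<xi> x \<in> (\<lambda>(a, b). kpair a b) ` (elts lam \<times> elts ?X)"
      using that unfolding elts_Pkl[of \<delta>] by blast
    then show ?thesis unfolding elts_vset[OF sY] by (simp add: Y_def)
  qed
  have "\<not> B (vset Y)" using y0 kp unfolding B_def by meson
  define P where "P = (\<lambda>(A :: 'v set) R e. \<not> (\<exists>u\<in>A. \<forall>a\<in>A. R a (e (Suc (Suc 0))) \<longrightarrow>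
      (\<exists>x\<in>A. R x (e (Suc 0)) \<and> (\<forall>\<xi>\<in>A. R \<xi> a \<longrightarrow> R \<xi> x \<and> (R \<xi> u \<longleftrightarrow> int_maps A R (e 0) \<xi> x)))))"
  have "definable P" unfolding P_def by (intro definable_intros definable_maps)
  have P_iff: "P ?H mem (env ?X [y, ?X, ?D]) \<longleftrightarrow> \<not> B y" if y: "y \<in> ?H" for y
  proof -
    have "B y \<longleftrightarrow> (\<exists>u\<in>?H. \<forall>a\<in>elts ?D. \<exists>x\<in>elts ?X. \<forall>\<xi>\<in>elts a.
       \<xi> \<in> elts x \<and> (\<xi> \<in> elts u \<longleftrightarrow> kpair \<xi> x \<in> elts y))" (is "_ \<longleftrightarrow> (\<exists>u\<in>?H. ?G u)")
    proof
      assume "B y"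
      then obtain u where u: "?G u" unfolding B_def by blast
      \<comment> \<open>The witness is cut down in the same way: all tested \<xi> are below
        \<open>lam\<close>, and a subset of \<open>lam\<close> lies in H(\<theta>).\<close>
      define U where "U = elts u \<inter> elts lam"
      have sU: "small U" by (rule small_subset[OF _ small_elts[of u]]) (simp add: U_def)
      have eU: "elts (vset U) = elts u \<inter> elts lam" using elts_vset[OF sU] by (simp only: U_def)
      then have "\<xi> \<in> elts (vset U) \<longleftrightarrow> \<xi> \<in> elts u" if "\<xi> \<in> elts a" "a \<in> elts ?D" for \<xi> a
        using that unfolding elts_Pkl[of \<delta>] by blast
      then have "?G (vset U)" using u by simp
      moreover have "vset U \<in> ?H"
        by (rule Hset_subset[OF lamH]) (simp add: eU)
      ultimately show "\<exists>u\<in>?H. ?G u" by blast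
    next
      show "\<exists>u\<in>?H. ?G u \<Longrightarrow> B y" unfolding B_def by blast
    qed
    also have "\<dots> \<longleftrightarrow> (\<exists>u\<in>?H. \<forall>a\<in>?H. a \<in> elts ?D \<longrightarrow> (\<exists>x\<in>?H. x \<in> elts ?X \<and> (\<forall>\<xi>\<in>?H. \<xi> \<in> elts a \<longrightarrow>
        \<xi> \<in> elts x \<and> (\<xi> \<in> elts u \<longleftrightarrow> int_maps ?H mem y \<xi> x))))"
    proof -
      define G where "G a x u \<longleftrightarrow>
        (\<forall>\<xi>\<in>elts a. \<xi> \<in> elts x \<and> (\<xi> \<in> elts u \<longleftrightarrow> kpair \<xi> x \<in> elts y))" for a x u
      define G' where "G' a x u \<longleftrightarrow>
        (\<forall>\<xi>\<in>?H. \<xi> \<in> elts a \<longrightarrow> \<xi> \<in> elts x \<and> (\<xi> \<in> elts u \<longleftrightarrow> int_maps ?H mem y \<xi> x))" for a x u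
      have "G a x u = G' a x u" if "a \<in> ?H" "x \<in> ?H" for a x u
        unfolding G_def G'_def
        using Hset_int_maps[OF reg y _ that(2)] Hset_mem[OF that(1)] by blast
      then have "(\<exists>u\<in>?H. \<forall>a\<in>elts ?D. \<exists>x\<in>elts ?X. G a x u)
          \<longleftrightarrow> (\<exists>u\<in>?H. \<forall>a\<in>?H. a \<in> elts ?D \<longrightarrow> (\<exists>x\<in>?H. x \<in> elts ?X \<and> G' a x u))"
        using Hset_mem[OF Pkl_H] Hset_mem[OF Pkl_\<delta>_H] by (intro bex_cong refl) blast
      then show ?thesis unfolding G_def G'_def .
    qed
    finally show ?thesis unfolding P_def by (simp add: mem_def[of _ "Pkl _ _"] mem_def[of _ "_::'v"])
  qed
  have "\<exists>y\<in>M. P ?H mem (env ?X [y, ?X, ?D])"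
  proof (rule elementary_submodel_witness[OF sub \<open>definable P\<close>])
    show "\<exists>y\<in>?H. P ?H mem (env ?X [y, ?X, ?D])" using P_iff[OF YH] YH \<open>\<not> B (vset Y)\<close> by blast
  qed (use Pkl_M in auto)
  then obtain y where "y \<in> M" "\<not> B y" using P_iff MH by blast
  then show False using assms unfolding B_def by blast
qed

text \<open>For each \<xi> in \<open>a\<close>, \<open>U\<close> contains either the coded set or
  its complement, and also the set of all x containing \<xi>. These are fewer than \<delta> members
  of \<open>U\<close>, and any common point of them is the required x.\<close>

lemma family_measure_if_ultrafilter:
  assumes "complete_fine_ultrafilter \<delta> M \<kappa> lam U"
  shows "family_measure \<delta> \<kappa> lam"
proof (rule family_measure_reflect)
  let ?X = "Pkl \<kappa> lam"
  have meas: "measures ?X (subsets_in M ?X) U"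
    and compl: "complete_filter \<delta> ?X (subsets_in M ?X) U" and fine: "fine M \<kappa> lam U"
    using assms by (auto simp: complete_fine_ultrafilter_def M_ultrafilter_def)
  have XU: "?X \<in> U" using compl by (simp add: complete_filter_def)
  have inter: "\<exists>x\<in>elts ?X. \<forall>Y\<in>G. x \<in> elts Y" if G: "G \<subseteq> U" "G \<prec> elts \<delta>" for G
  proof -
    \<comment> \<open>Adding \<open>?X\<close> forces the common point into \<open>?X\<close> even
      when \<open>G\<close> is empty.\<close>
    let ?G = "insert ?X G"
    have "{?X} \<union> G \<prec> elts \<delta>"
      using G(2) infinites(1) by (intro Un_lesspoll_infinite) (auto simp: finite_lesspoll_infinite)
    then have lt: "?G \<prec> elts \<delta>" by simp
    define \<mu> :: 'v where "\<mu> = vcard ?G"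
    have \<mu>: "\<mu> \<in> elts \<delta>" unfolding \<mu>_def by (rule vcard_mem[OF Cards(1) lt])
    obtain g where g: "bij_betw g (elts \<mu>) ?G"
      using vcard_props(2)[OF lesspoll_imp_lepoll[OF lt]] unfolding \<mu>_def by (auto simp: eqpoll_def)
    have surj: "g ` elts \<mu> = ?G" using g by (rule bij_betw_imp_surj_on)
    then have "\<forall>i\<in>elts \<mu>. g i \<in> U" using G(1) XU by (metis imageI insert_iff subsetD)
    then have "(\<Inter>i\<in>elts \<mu>. elts (g i)) \<noteq> {}"
      using compl \<mu> unfolding complete_filter_def by blast
    then obtain x where x: "\<forall>i\<in>elts \<mu>. x \<in> elts (g i)" by blast
    then have "\<forall>Y\<in>g ` elts \<mu>. x \<in> elts Y" by blast
    then show ?thesis unfolding surj by blast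
  qed
  fix y assume y: "y \<in> M"
  define S where "S \<xi> = vset {x \<in> elts ?X. kpair \<xi> x \<in> elts y}" for \<xi>
  have elts_S: "elts (S \<xi>) = {x \<in> elts ?X. kpair \<xi> x \<in> elts y}" for \<xi>
    unfolding S_def by (rule elts_vset[OF small_subset[OF _ small_elts[of ?X]]]) blast
  have SM: "S \<xi> \<in> subsets_in M ?X" if \<xi>: "\<xi> \<in> elts lam" for \<xi>
  proof -
    have "S \<xi> \<in> M"
    proof (rule separation_in_M[OF definable_maps[of "Suc (Suc (Suc 0))" "Suc (Suc 0)" 0] Pkl_M(1)])
      show "set [\<xi>, y] \<subseteq> M" using \<xi> lam_sub y by auto
      then show "S \<xi> = vset {x \<in> elts ?X. int_maps (Hset \<theta>) mem
            (env ?X [x, ?X, \<xi>, y] (Suc (Suc (Suc 0)))) (env ?X [x, ?X, \<xi>, y] (Suc (Suc 0)))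
            (env ?X [x, ?X, \<xi>, y] 0)}"
        unfolding S_def env_Cons
        using Hset_int_maps[OF reg] MH Hset_mem[OF Pkl_H] by (intro arg_cong[of _ _ vset]) auto
    qed
    then show ?thesis by (auto simp: subsets_in_def elts_S)
  qed
  define u where "u = vset {\<xi> \<in> elts lam. S \<xi> \<in> U}"
  have elts_u: "elts u = {\<xi> \<in> elts lam. S \<xi> \<in> U}"
    unfolding u_def by (rule elts_vset[OF small_subset[OF _ small_elts[of lam]]]) blast
  have "\<exists>x\<in>elts ?X. \<forall>\<xi>\<in>elts a. \<xi> \<in> elts x \<and> (\<xi> \<in> elts u \<longleftrightarrow> kpair \<xi> x \<in> elts y)"
    if a: "a \<in> elts (Pkl \<delta> lam)" for a
  proof -
    have al: "elts a \<subseteq> elts lam" "elts a \<prec> elts \<delta>" using a by (auto simp: elts_Pkl)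
    define f where "f \<xi> = (if S \<xi> \<in> U then S \<xi> else vset (elts ?X - elts (S \<xi>)))" for \<xi>
    define h where "h \<xi> = vset {x \<in> elts ?X. \<xi> \<in> elts x}" for \<xi>
    have elts_h: "elts (h \<xi>) = {x \<in> elts ?X. \<xi> \<in> elts x}" for \<xi>
      unfolding h_def by (rule elts_vset[OF small_subset[OF _ small_elts[of ?X]]]) blast
    have sub: "f ` elts a \<union> h ` elts a \<subseteq> U"
    proof (intro Un_least image_subsetI)
      fix \<xi> assume "\<xi> \<in> elts a"
      then have \<xi>: "\<xi> \<in> elts lam" using al(1) by blast
      show "f \<xi> \<in> U" using meas SM[OF \<xi>] unfolding f_def measures_def by auto
      show "h \<xi> \<in> U" using fine \<xi> lam_sub unfolding h_def fine_def by blast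
    qed
    have "f ` elts a \<union> h ` elts a \<prec> elts \<delta>"
      by (rule Un_lesspoll_infinite[OF infinites(1)]; rule lesspoll_trans1[OF image_lepoll al(2)])
    from inter[OF sub this]
    obtain x where x: "x \<in> elts ?X" "\<forall>Y\<in>f ` elts a \<union> h ` elts a. x \<in> elts Y" by blast
    have "\<xi> \<in> elts x \<and> (\<xi> \<in> elts u \<longleftrightarrow> kpair \<xi> x \<in> elts y)" if "\<xi> \<in> elts a" for \<xi>
    proof
      show "\<xi> \<in> elts x" using x that elts_h by auto
      have "x \<in> elts (f \<xi>)" using x that by blast
      moreover have "elts (vset (elts ?X - elts (S \<xi>))) = elts ?X - elts (S \<xi>)"
        by (rule elts_vset[OF small_subset[OF _ small_elts[of ?X]]]) blast
      ultimately have "S \<xi> \<in> U \<longleftrightarrow> x \<in> elts (S \<xi>)"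
        unfolding f_def by (auto split: if_splits)
      then show "\<xi> \<in> elts u \<longleftrightarrow> kpair \<xi> x \<in> elts y"
        using x(1) that al(1) unfolding elts_u elts_S by blast
    qed
    then show ?thesis using x(1) by blast
  qed
  then show "\<exists>u. \<forall>a\<in>elts (Pkl \<delta> lam). \<exists>x\<in>elts ?X. \<forall>\<xi>\<in>elts a.
      \<xi> \<in> elts x \<and> (\<xi> \<in> elts u \<longleftrightarrow> kpair \<xi> x \<in> elts y)" by blast
qed

text \<open>The assumption on \<open>lam\<close> gives P_\<delta>(lam) exactly \<open>lam\<close>
  many elements. A bijection with \<open>lam\<close> exists in H(\<theta>), hence in
  \<open>M\<close>, and each \<open>a\<close> is the preimage of some \<open>b\<close> below
  \<open>lam\<close>, so it is definable from parameters in \<open>M\<close>.\<close>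

lemma Pkl_\<delta>_subset_M:
  assumes W: "weak_cpower lam \<delta> = lam"
  shows "elts (Pkl \<delta> lam) \<subseteq> M"
proof
  let ?D = "Pkl \<delta> lam"
  fix a assume a: "a \<in> elts ?D"
  have "elts ?D \<approx> elts lam"
  proof (rule lepoll_antisym)
    show "elts ?D \<lesssim> elts lam"
      using Pkl_lepoll[OF Cards(1) infinites(1), of lam] \<delta>\<kappa> \<kappa>lam W by auto
    have "inj_on (\<lambda>\<xi>. vset {\<xi>}) (elts lam)"
      by (rule inj_onI) (simp add: vset_inject)
    moreover have "(\<lambda>\<xi>. vset {\<xi>}) ` elts lam \<subseteq> elts ?D"
      using infinites(1) by (auto simp: elts_Pkl elts_vset finite_lesspoll_infinite)
    ultimately show "elts lam \<lesssim> elts ?D" unfolding lepoll_def by blast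
  qed
  then have "\<exists>f\<in>Hset \<theta>. int_bij (Hset \<theta>) mem f ?D lam"
    using Hset_int_eqpoll[OF reg Pkl_\<delta>_H MH[OF lam_M]] by (simp add: int_eqpoll_def)
  then obtain f where f: "f \<in> M" "int_bij (Hset \<theta>) mem f ?D lam"
    using elementary_submodel_witness[OF sub definable_bij[of 0 "Suc 0" "Suc (Suc 0)"] Pkl_M(2), of "[lam]"] lam_M
    by auto
  have aH: "a \<in> Hset \<theta>" using Hset_mem[OF Pkl_\<delta>_H a] .
  then obtain b where b: "b \<in> elts lam" "int_maps (Hset \<theta>) mem f a b"
    using f(2) a unfolding int_bij_def mem_def[of _ ?D] mem_def[of _ lam] by blast
  have def: "definable (\<lambda>(A :: 'v set) R e. R (e 0) (e (Suc 0)) \<and> int_maps A R (e (Suc (Suc 0))) (e 0) (e (Suc (Suc (Suc 0)))))"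
    by (intro definable_intros definable_maps)
  show "a \<in> M"
  proof (rule elementary_submodel_unique[OF sub def Pkl_M(2) _ aH, of "[f, b]"])
    show "set [f, b] \<subseteq> M" using f b lam_sub by auto
    show "mem (env ?D [a, ?D, f, b] 0) (env ?D [a, ?D, f, b] (Suc 0)) \<and>
        int_maps (Hset \<theta>) mem (env ?D [a, ?D, f, b] (Suc (Suc 0))) (env ?D [a, ?D, f, b] 0)
          (env ?D [a, ?D, f, b] (Suc (Suc (Suc 0))))"
      using a b(2) by (simp add: mem_def[of _ ?D])
    fix c assume "c \<in> Hset \<theta>" "mem (env ?D [c, ?D, f, b] 0) (env ?D [c, ?D, f, b] (Suc 0)) \<and>
        int_maps (Hset \<theta>) mem (env ?D [c, ?D, f, b] (Suc (Suc 0))) (env ?D [c, ?D, f, b] 0)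
          (env ?D [c, ?D, f, b] (Suc (Suc (Suc 0))))"
    then have "c \<in> Hset \<theta> \<and> mem c ?D \<and> int_maps (Hset \<theta>) mem f c b" by simp
    moreover have "a \<in> Hset \<theta> \<and> mem a ?D \<and> int_maps (Hset \<theta>) mem f a b"
      using aH a b(2) by (simp add: mem_def[of _ ?D])
    moreover have "\<exists>!c. c \<in> Hset \<theta> \<and> mem c ?D \<and> int_maps (Hset \<theta>) mem f c b"
      using f(2) b(1) Hset_mem[OF MH[OF lam_M] b(1)] unfolding int_bij_def mem_def[of _ lam] by blast
    ultimately show "c = a" by blast
  qed
qed

lemma embedding_transfer:
  assumes "elementary_embedding j M mem N R" "definable P" "a \<in> M" "set xs \<subseteq> M"
  shows "P (Hset \<theta>) mem (env a (a # xs)) \<longleftrightarrow> P N R (env (j a) (j a # map j xs))"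
  using elementary_embeddingD_list[OF emb_id assms(2-4)] elementary_embeddingD_list[OF assms] by simp

text \<open>\<open>M\<close> contains a bijection \<open>f\<close> of \<open>a\<close> with a
  cardinal \<mu> < \<delta>. In N, \<open>j f\<close> sends \<open>z\<close> below
  \<open>j \<mu>\<close>, where by \<open>fixd\<close> only values of \<open>j\<close> occur;
  pulling such a value \<open>j i\<close> back along \<open>f\<close> gives
  \<open>w\<close>.\<close>

lemma embedding_small_ext:
  fixes j :: "'v \<Rightarrow> 'v"
  assumes emb: "elementary_embedding j M mem N R"
    and fixd: "\<And>\<beta>. \<beta> \<in> elts \<delta> \<Longrightarrow> {z\<in>N. R z (j \<beta>)} \<subseteq> j ` elts \<beta>"
    and a: "a \<in> M" "elts a \<prec> elts \<delta>" and z: "z \<in> N" "R z (j a)"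
  shows "\<exists>w\<in>elts a. z = j w"
proof -
  define \<mu> :: 'v where "\<mu> = vcard (elts a)"
  have \<mu>: "\<mu> \<in> elts \<delta>" "elts \<mu> \<approx> elts a" "\<mu> \<in> M"
    using vcard_mem[OF Cards(1) a(2)] vcard_props(2)[OF lesspoll_imp_lepoll[OF a(2)]] \<delta>\<kappa> \<kappa>lam lam_sub
    unfolding \<mu>_def by blast+
  have "\<exists>f\<in>Hset \<theta>. int_bij (Hset \<theta>) mem f a \<mu>"
    using Hset_int_eqpoll[OF reg MH[OF a(1)] MH[OF \<mu>(3)]] eqpoll_sym[OF \<mu>(2)] by (simp add: int_eqpoll_def)
  then obtain f where f: "f \<in> M" "int_bij (Hset \<theta>) mem f a \<mu>"
    using elementary_submodel_witness[OF sub definable_bij[of 0 "Suc 0" "Suc (Suc 0)"] a(1), of "[\<mu>]"] \<mu>(3)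
    by auto
  have bijM: "int_bij M mem f a \<mu>"
    using elementary_embeddingD_list[OF emb_id definable_bij[of 0 "Suc 0" "Suc (Suc 0)"] f(1), of "[a, \<mu>]"]
      f a(1) \<mu>(3) by simp
  have bijN: "int_bij N R (j f) (j a) (j \<mu>)"
    using embedding_transfer[OF emb definable_bij[of 0 "Suc 0" "Suc (Suc 0)"] f(1), of "[a, \<mu>]"]
      f a(1) \<mu>(3) by simp
  obtain b where b: "b \<in> N" "R b (j \<mu>)" "int_maps N R (j f) z b"
    using bijN z unfolding int_bij_def by blast
  then obtain i where i: "i \<in> elts \<mu>" "b = j i" using fixd[OF \<mu>(1)] by blast
  have iM: "i \<in> M"
    using i(1) \<mu>(1) Ord_trans[OF Card_Ord[OF Cards(1)]] \<delta>\<kappa> \<kappa>lam lam_sub by blast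
  obtain w where w: "w \<in> M" "w \<in> elts a" "int_maps M mem f w i"
    using bijM i(1) iM unfolding int_bij_def mem_def[of _ \<mu>] mem_def[of _ a] by blast
  have "int_maps N R (j f) (j w) (j i)"
    using elementary_embeddingD_list[OF emb definable_maps[of 0 "Suc 0" "Suc (Suc 0)"] f(1), of "[w, i]"]
      w iM by simp
  moreover have "R (j w) (j a)"
    using elementary_embedding_rel[OF emb w(1) a(1)] w(2) by (simp add: mem_def)
  moreover have "j w \<in> N" by (rule elementary_embedding_in[OF emb w(1)])
  moreover have "\<exists>!c. c \<in> N \<and> R c (j a) \<and> int_maps N R (j f) c b"
    using bijN b unfolding int_bij_def by blast
  ultimately have "z = j w" using z b i by blast
  then show ?thesis using w by blast
qed

lemma family_measure_if_embedding:
  assumes W: "weak_cpower lam \<delta> = lam" and cov: "covering_embedding \<delta> M \<kappa> lam j N R D"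
  shows "family_measure \<delta> \<kappa> lam"
proof (rule family_measure_reflect)
  let ?X = "Pkl \<kappa> lam" and ?H = "Hset \<theta>"
  have emb: "elementary_embedding j M mem N R" and crit: "crit_ge j M N R \<delta>"
    and D: "D \<in> N" "\<And>\<gamma>. \<gamma> \<in> elts lam \<Longrightarrow> R (j \<gamma>) D" "int_card_less N R D (j \<kappa>)"
    using cov lam_sub unfolding covering_embedding_def by auto
  have fixd: "{z\<in>N. R z (j \<beta>)} \<subseteq> j ` elts \<beta>" if \<beta>: "\<beta> \<in> elts \<delta>" for \<beta>
  proof -
    obtain \<gamma> where "is_crit j M N R \<gamma>" "elts \<delta> \<subseteq> elts \<gamma>" using crit unfolding crit_ge_def by blast
    then have "\<not> moved j M N R \<beta>" using \<beta> unfolding is_crit_def by blast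
    moreover have \<beta>M: "\<beta> \<in> M" "Ord \<beta>"
      using \<beta> \<delta>\<kappa> \<kappa>lam lam_sub Ord_in_Ord[OF Card_Ord[OF Cards(1)]] by blast+
    moreover have "j ` (elts \<beta> \<inter> M) \<subseteq> {z\<in>N. R z (j \<beta>)}"
      using elementary_embedding_rel[OF emb _ \<beta>M(1)] elementary_embedding_in[OF emb]
      by (auto simp: mem_def)
    ultimately show ?thesis unfolding moved_def by blast
  qed
  \<comment> \<open>\<open>P\<close> says that every set of size less than \<kappa> meets
    \<open>lam\<close> in an element of P_\<kappa>(lam). The set \<open>D\<close> may have elements
    outside \<open>j lam\<close>; read in N, \<open>P\<close> trims it to an element
    \<open>D'\<close> of \<open>j ?X\<close>.\<close>
  define P where "P = (\<lambda>(A :: 'v set) R e. \<forall>d\<in>A. int_card_less A R d (e 0) \<longrightarrow>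
      (\<exists>d'\<in>A. R d' (e (Suc (Suc 0))) \<and> (\<forall>z\<in>A. R z d' \<longleftrightarrow> R z d \<and> R z (e (Suc 0)))))"
  have defP: "definable P" unfolding P_def by (intro definable_intros definable_card_less)
  have "P ?H mem (env \<kappa> [\<kappa>, lam, ?X])"
    unfolding P_def env_Cons
  proof (intro ballI impI)
    fix d assume d: "d \<in> ?H" "int_card_less ?H mem d \<kappa>"
    then have lt: "elts d \<prec> elts \<kappa>"
      using Hset_int_card_less[OF reg d(1) Cards(2) MH[OF \<kappa>_M]] by simp
    have el: "elts (vset (elts d \<inter> elts lam)) = elts d \<inter> elts lam"
      by (rule elts_vset[OF small_subset[OF _ small_elts[of d]]]) blast
    have "elts d \<inter> elts lam \<prec> elts \<kappa>"
      by (rule lesspoll_trans1[OF subset_imp_lepoll lt]) blast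
    then have "vset (elts d \<inter> elts lam) \<in> elts ?X" by (simp add: elts_Pkl el)
    then show "\<exists>d'\<in>?H. mem d' ?X \<and> (\<forall>z\<in>?H. mem z d' \<longleftrightarrow> mem z d \<and> mem z lam)"
      using Hset_mem[OF Pkl_H] by (intro bexI[of _ "vset (elts d \<inter> elts lam)"]) (auto simp: mem_def el)
  qed
  then have "P N R (env (j \<kappa>) [j \<kappa>, j lam, j ?X])"
    using embedding_transfer[OF emb defP \<kappa>_M, of "[lam, ?X]"] lam_M Pkl_M by simp
  then obtain D' where D': "D' \<in> N" "R D' (j ?X)" "\<And>z. z \<in> N \<Longrightarrow> R z D' \<longleftrightarrow> R z D \<and> R z (j lam)"
    using D(1,3) unfolding P_def env_Cons by blast
  have covD: "R (j \<xi>) D'" if "\<xi> \<in> elts lam" for \<xi>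
  proof -
    have "\<xi> \<in> M" using that lam_sub by blast
    then show ?thesis
      using D'(3)[OF elementary_embedding_in[OF emb]] D(2)[OF that]
        elementary_embedding_rel[OF emb _ lam_M] that by (simp add: mem_def)
  qed
  fix y assume y: "y \<in> M"
  define u where "u = vset {\<xi> \<in> elts lam. int_maps N R (j y) (j \<xi>) D'}"
  have elts_u: "elts u = {\<xi> \<in> elts lam. int_maps N R (j y) (j \<xi>) D'}"
    unfolding u_def by (rule elts_vset[OF small_subset[OF _ small_elts[of lam]]]) blast
  have "\<exists>x\<in>elts ?X. \<forall>\<xi>\<in>elts a. \<xi> \<in> elts x \<and> (\<xi> \<in> elts u \<longleftrightarrow> kpair \<xi> x \<in> elts y)"
    if a: "a \<in> elts (Pkl \<delta> lam)" for a
  proof -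
    have al: "elts a \<subseteq> elts lam" "elts a \<prec> elts \<delta>" and aM: "a \<in> M"
      using a Pkl_\<delta>_subset_M[OF W] by (auto simp: elts_Pkl)
    \<comment> \<open>The set \<open>u\<close> is defined outside of \<open>M\<close> and need not
      belong to it, but its trace on \<open>a\<close> does. With \<open>b\<close> in place of
      \<open>u\<close> the statement \<open>Q\<close> has all its parameters in
      \<open>M\<close>.\<close>
    define b where "b = vset (elts a \<inter> elts u)"
    have elts_b: "elts b = elts a \<inter> elts u"
      unfolding b_def by (rule elts_vset[OF small_subset[OF _ small_elts[of a]]]) blast
    have "elts b \<prec> elts \<delta>"
      by (rule lesspoll_trans1[OF subset_imp_lepoll al(2)]) (simp add: elts_b)
    then have "b \<in> elts (Pkl \<delta> lam)" using al by (auto simp: elts_Pkl elts_b)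
    then have bM: "b \<in> M" using Pkl_\<delta>_subset_M[OF W] by blast
    define Q where "Q = (\<lambda>(A :: 'v set) R e. \<exists>x\<in>A. R x (e 0) \<and> (\<forall>\<xi>\<in>A. R \<xi> (e (Suc 0)) \<longrightarrow>
      R \<xi> x \<and> (R \<xi> (e (Suc (Suc 0))) \<longleftrightarrow> int_maps A R (e (Suc (Suc (Suc 0)))) \<xi> x)))"
    have defQ: "definable Q" unfolding Q_def by (intro definable_intros definable_maps)
    \<comment> \<open>In N the witness is \<open>D'\<close>, since the elements of
      \<open>j a\<close> are exactly the points \<open>j \<xi>\<close>. Elementarity then returns a
      genuine x in P_\<kappa>(lam).\<close>
    have "Q N R (env (j ?X) [j ?X, j a, j b, j y])"
      unfolding Q_def env_Cons
    proof (intro bexI[OF _ D'(1)] conjI D'(2) ballI impI)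
      fix z assume z: "z \<in> N" "R z (j a)"
      obtain \<xi> where \<xi>: "\<xi> \<in> elts a" "z = j \<xi>"
        using embedding_small_ext[OF emb fixd aM al(2) z] by blast
      then have "\<xi> \<in> M" using al lam_sub by blast
      show "R z D'" using covD \<xi> al by blast
      have "R z (j b) \<longleftrightarrow> \<xi> \<in> elts b"
        using elementary_embedding_rel[OF emb \<open>\<xi> \<in> M\<close> bM] \<xi> by (simp add: mem_def)
      then show "R z (j b) \<longleftrightarrow> int_maps N R (j y) z D'"
        using \<xi> al by (auto simp: elts_b elts_u)
    qed
    then have "Q ?H mem (env ?X [?X, a, b, y])"
      using embedding_transfer[OF emb defQ Pkl_M(1), of "[a, b, y]"] aM bM y by simp
    then obtain x where x: "x \<in> ?H" "x \<in> elts ?X" "\<And>\<xi>. \<xi> \<in> ?H \<Longrightarrow> \<xi> \<in> elts a \<Longrightarrow>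
        \<xi> \<in> elts x \<and> (\<xi> \<in> elts b \<longleftrightarrow> int_maps ?H mem y \<xi> x)"
      unfolding Q_def env_Cons mem_def[of _ "_::'v"] by blast
    have "\<xi> \<in> elts x \<and> (\<xi> \<in> elts u \<longleftrightarrow> kpair \<xi> x \<in> elts y)" if "\<xi> \<in> elts a" for \<xi>
      using x(3)[OF Hset_mem[OF MH[OF aM] that] that] that
        Hset_int_maps[OF reg MH[OF y] Hset_mem[OF MH[OF aM] that] x(1)]
      by (simp add: elts_b)
    then show ?thesis using x(2) by blast
  qed
  then show "\<exists>u. \<forall>a\<in>elts (Pkl \<delta> lam). \<exists>x\<in>elts ?X. \<forall>\<xi>\<in>elts a.
      \<xi> \<in> elts x \<and> (\<xi> \<in> elts u \<longleftrightarrow> kpair \<xi> x \<in> elts y)" by blast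
qed

end

section \<open>Counting formulas\<close>

lemma lang_terms_lepoll:
  fixes L :: "'a lang"
  assumes "infinite C" "funs L \<lesssim> C"
  shows "lang_terms L \<lesssim> C"
proof -
  define g where "g s ts = (case s of Inl n \<Rightarrow> Var n | Inr f \<Rightarrow> Fun f ts)"
    for s :: "nat + 'a" and ts :: "'a tm list"
  have "t \<in> hull (UNIV <+> funs L) g" if "t \<in> lang_terms L" for t
    using that
  proof induction
    case (1 n)
    have "g (Inl n) [] \<in> hull (UNIV <+> funs L) g" by (rule hull.intros) auto
    moreover have "g (Inl n) [] = Var n" by (simp add: g_def)
    ultimately show ?case by simp
  next
    case (2 f ts)
    have "g (Inr f) ts \<in> hull (UNIV <+> funs L) g" by (rule hull.intros) (use 2 in auto)
    moreover have "g (Inr f) ts = Fun f ts" by (simp add: g_def)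
    ultimately show ?case by simp
  qed
  then have "lang_terms L \<lesssim> hull (UNIV <+> funs L) g" by (intro subset_imp_lepoll) blast
  moreover have "hull (UNIV <+> funs L) g \<lesssim> C"
    using assms by (intro hull_lepoll Plus_lepoll_infinite) (auto simp: infinite_le_lepoll)
  ultimately show ?thesis by (rule lepoll_trans)
qed

type_synonym 'v node = "nat \<times> nat \<times> 'v list \<times> 'v \<times> ('v \<Rightarrow> 'v)"

text \<open>A formula is coded by \<open>J\<close> applied to its topmost node, in which immediate subformulas are
  replaced by their codes; \<open>fm_node\<close> is that node.\<close>

primrec fm_code :: "('v::zfc node \<Rightarrow> 'v) \<Rightarrow> ('v tm \<Rightarrow> 'v) \<Rightarrow> ('v \<Rightarrow> 'v) \<Rightarrow> 'v fm \<Rightarrow> 'v" where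
  "fm_code J tc rc (Eq s t) = J (0, 0, [tc s, tc t], zero, \<lambda>_. undefined)"
| "fm_code J tc rc (Rel r ts) = J (1, 0, rc r # map tc ts, zero, \<lambda>_. undefined)"
| "fm_code J tc rc (Neg \<phi>) = J (2, 0, [fm_code J tc rc \<phi>], zero, \<lambda>_. undefined)"
| "fm_code J tc rc (Conj \<mu> \<Phi>) = J (3, 0, [], \<mu>, restrict (\<lambda>i. fm_code J tc rc (\<Phi> i)) (elts \<mu>))"
| "fm_code J tc rc (Disj \<mu> \<Phi>) = J (4, 0, [], \<mu>, restrict (\<lambda>i. fm_code J tc rc (\<Phi> i)) (elts \<mu>))"
| "fm_code J tc rc (Ex n \<phi>) = J (5, n, [fm_code J tc rc \<phi>], zero, \<lambda>_. undefined)"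
| "fm_code J tc rc (All n \<phi>) = J (6, n, [fm_code J tc rc \<phi>], zero, \<lambda>_. undefined)"

primrec fm_node :: "('v::zfc node \<Rightarrow> 'v) \<Rightarrow> ('v tm \<Rightarrow> 'v) \<Rightarrow> ('v \<Rightarrow> 'v) \<Rightarrow> 'v fm \<Rightarrow> 'v node" where
  "fm_node J tc rc (Eq s t) = (0, 0, [tc s, tc t], zero, \<lambda>_. undefined)"
| "fm_node J tc rc (Rel r ts) = (1, 0, rc r # map tc ts, zero, \<lambda>_. undefined)"
| "fm_node J tc rc (Neg \<phi>) = (2, 0, [fm_code J tc rc \<phi>], zero, \<lambda>_. undefined)"
| "fm_node J tc rc (Conj \<mu> \<Phi>) = (3, 0, [], \<mu>, restrict (\<lambda>i. fm_code J tc rc (\<Phi> i)) (elts \<mu>))"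
| "fm_node J tc rc (Disj \<mu> \<Phi>) = (4, 0, [], \<mu>, restrict (\<lambda>i. fm_code J tc rc (\<Phi> i)) (elts \<mu>))"
| "fm_node J tc rc (Ex n \<phi>) = (5, n, [fm_code J tc rc \<phi>], zero, \<lambda>_. undefined)"
| "fm_node J tc rc (All n \<phi>) = (6, n, [fm_code J tc rc \<phi>], zero, \<lambda>_. undefined)"

lemma fm_code_eq: "fm_code J tc rc \<phi> = J (fm_node J tc rc \<phi>)"
  by (cases \<phi>) simp_all

text \<open>Conjunctions are indexed by arbitrary ordinals below \<delta>, while the weak power
  ranges over cardinal exponents; this passes from the former to the latter.\<close>

lemma PiE_lepoll_domain:
  assumes "A \<approx> B" shows "(A \<rightarrow>\<^sub>E C) \<lesssim> (B \<rightarrow>\<^sub>E C)"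
proof -
  obtain b where b: "bij_betw b B A" using eqpoll_sym[OF assms] by (auto simp: eqpoll_def)
  then have bB: "b ` B = A" by (simp add: bij_betw_def)
  have "inj_on (\<lambda>s. restrict (\<lambda>i. s (b i)) B) (A \<rightarrow>\<^sub>E C)"
  proof (rule inj_onI)
    fix s s' assume s: "s \<in> A \<rightarrow>\<^sub>E C" "s' \<in> A \<rightarrow>\<^sub>E C"
      and eq: "restrict (\<lambda>i. s (b i)) B = restrict (\<lambda>i. s' (b i)) B"
    show "s = s'"
    proof (rule PiE_ext[OF s])
      fix a assume "a \<in> A"
      then obtain i where "i \<in> B" "a = b i" using bB by blast
      then show "s a = s' a" using fun_cong[OF eq, of i] by simp
    qed
  qed
  moreover have "(\<lambda>s. restrict (\<lambda>i. s (b i)) B) ` (A \<rightarrow>\<^sub>E C) \<subseteq> (B \<rightarrow>\<^sub>E C)"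
    using bB by auto
  ultimately show ?thesis unfolding lepoll_def by blast
qed

text \<open>A node carries two numbers, a finite list of codes and a sequence of codes of length
  less than \<delta>, so by the assumption on \<open>lam\<close> the nodes inject into
  \<open>lam\<close> by some \<open>J\<close>. Equal codes then have equal nodes, which reveal the
  constructor and the codes of the immediate subformulas; injectivity follows by induction.\<close>

lemma formulas_lepoll:
  fixes \<delta> lam :: "'v::zfc"
  assumes \<delta>: "Card \<delta>" "infinite (elts \<delta>)" and \<delta>lam: "elts \<delta> \<subseteq> elts lam"
    and W: "weak_cpower lam \<delta> = lam" and L: "rels L <+> funs L \<lesssim> elts lam"
  shows "formulas \<delta> L \<lesssim> elts lam"
proof -
  let ?K = "elts lam"
  have inf: "infinite ?K" using \<delta>(2) \<delta>lam finite_subset by blast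
  have "rels L \<lesssim> rels L <+> funs L" "funs L \<lesssim> rels L <+> funs L"
    unfolding lepoll_def by (rule exI[of _ Inl], auto) (rule exI[of _ Inr], auto)
  then have rels: "rels L \<lesssim> ?K" and funs: "funs L \<lesssim> ?K" using lepoll_trans[OF _ L] by auto
  obtain tc where tc: "inj_on tc (lang_terms L)" "tc ` lang_terms L \<subseteq> ?K"
    using lang_terms_lepoll[OF inf funs] unfolding lepoll_def by blast
  obtain rc where rc: "inj_on rc (rels L)" "rc ` rels L \<subseteq> ?K"
    using rels unfolding lepoll_def by blast
  define Seq where "Seq = (\<Union>\<mu>\<in>elts \<delta>. Pair \<mu> ` (elts \<mu> \<rightarrow>\<^sub>E ?K))"
  define Node :: "'v node set" where "Node = UNIV \<times> UNIV \<times> lists ?K \<times> Seq"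
  have "Seq \<lesssim> ?K" unfolding Seq_def
  proof (rule UN_lepoll_infinite[OF inf subset_imp_lepoll[OF \<delta>lam]])
    fix \<mu> assume \<mu>: "\<mu> \<in> elts \<delta>"
    have lt: "elts \<mu> \<prec> elts \<delta>" by (rule Card_mem_lesspoll[OF \<delta>(1) \<mu>])
    note v = vcard_props[OF lepoll_refl, of \<mu>]
    have "(elts \<mu> \<rightarrow>\<^sub>E ?K) \<lesssim> (elts (vcard (elts \<mu>) :: 'v) \<rightarrow>\<^sub>E ?K)"
      by (rule PiE_lepoll_domain[OF eqpoll_sym[OF v(2)]])
    also have "\<dots> \<lesssim> ?K"
      using funset_lepoll_weak_cpower[OF v(1) vcard_mem[OF \<delta>(1) lt], of lam] W by simp
    finally show "Pair \<mu> ` (elts \<mu> \<rightarrow>\<^sub>E ?K) \<lesssim> ?K" by (rule lepoll_trans[OF image_lepoll])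
  qed
  then have "Node \<lesssim> ?K" unfolding Node_def
    using inf by (intro times_lepoll_infinite lists_lepoll_infinite) (auto simp: infinite_le_lepoll)
  then obtain J where J: "inj_on J Node" "J ` Node \<subseteq> ?K" unfolding lepoll_def by blast
  let ?c = "fm_code J tc rc" and ?n = "fm_node J tc rc"
  have Seq: "(\<mu>, s) \<in> Seq \<longleftrightarrow> \<mu> \<in> elts \<delta> \<and> s \<in> elts \<mu> \<rightarrow>\<^sub>E ?K" for \<mu> s
    by (auto simp: Seq_def)
  have Node: "(m, n, xs, s) \<in> Node \<longleftrightarrow> set xs \<subseteq> ?K \<and> s \<in> Seq" for m n xs s
    by (auto simp: Node_def)
  have JK: "n \<in> Node \<Longrightarrow> J n \<in> ?K" for n using J(2) by blast
  \<comment> \<open>The constant \<open>undefined\<close> function is the member of the extensional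
    function space on the empty index set, so nodes padded by it also belong to
    \<open>Node\<close>.\<close>
  have zero: "(zero, \<lambda>_. undefined) \<in> Seq"
    unfolding Seq using finite_Ord_mem[OF Ord_zero _ Card_Ord[OF \<delta>(1)] \<delta>(2)] by (simp add: elts_zero)
  have node: "?n \<phi> \<in> Node" if "\<phi> \<in> formulas \<delta> L" for \<phi>
    using that
  proof induction
    case (1 s t) then show ?case using tc(2) zero by (auto simp: Node)
  next
    case (2 r ts)
    then have "tc ` set ts \<subseteq> ?K" "rc r \<in> ?K" using tc(2) rc(2) by blast+
    then show ?case using zero by (simp add: Node)
  next
    case (3 \<phi>) then show ?case using zero JK by (simp add: Node fm_code_eq)
  next
    case (4 \<mu> \<Phi>) then show ?case using JK by (simp add: Node fm_code_eq Seq)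
  next
    case (5 \<mu> \<Phi>) then show ?case using JK by (simp add: Node fm_code_eq Seq)
  next
    case (6 \<phi> n) then show ?case using zero JK by (simp add: Node fm_code_eq)
  next
    case (7 \<phi> n) then show ?case using zero JK by (simp add: Node fm_code_eq)
  qed
  have inj_n: "?c \<phi> = ?c \<psi> \<Longrightarrow> ?n \<phi> = ?n \<psi>" if "\<phi> \<in> formulas \<delta> L" "\<psi> \<in> formulas \<delta> L" for \<phi> \<psi>
    using inj_onD[OF J(1) _ node[OF that(1)] node[OF that(2)]] by (simp only: fm_code_eq)
  have restr: "\<Phi> = \<Psi>"
    if "\<Phi> \<in> extensional (elts \<mu>)" "\<Psi> \<in> extensional (elts \<mu>)"
      and "restrict (\<lambda>i. ?c (\<Phi> i)) (elts \<mu>) = restrict (\<lambda>i. ?c (\<Psi> i)) (elts \<mu>)"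
      and "\<And>i. i \<in> elts \<mu> \<Longrightarrow> ?c (\<Phi> i) = ?c (\<Psi> i) \<Longrightarrow> \<Phi> i = \<Psi> i"
    for \<Phi> \<Psi> \<mu>
  proof (rule extensionalityI[OF that(1,2)])
    fix i assume "i \<in> elts \<mu>"
    then show "\<Phi> i = \<Psi> i" using that(4) fun_cong[OF that(3), of i] by simp
  qed
  have "\<phi> = \<psi>" if "\<phi> \<in> formulas \<delta> L" "\<psi> \<in> formulas \<delta> L" "?c \<phi> = ?c \<psi>" for \<phi> \<psi>
    using that
  proof (induction arbitrary: \<psi>)
    case (1 s t)
    have "?n (Eq s t) = ?n \<psi>" using 1 by (intro inj_n formulas.intros)
    then show ?case using 1 tc(1) by (cases rule: formulas.cases[OF 1(3)]) (auto dest: inj_onD)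
  next
    case (2 r ts)
    have "?n (Rel r ts) = ?n \<psi>" using 2 by (intro inj_n formulas.intros)
    from 2(4) show ?case
    proof (cases rule: formulas.cases)
      case (2 r' ts')
      then have eq: "rc r = rc r'" "map tc ts = map tc ts'" using \<open>?n (Rel r ts) = ?n \<psi>\<close> by auto
      have "r = r'" using inj_onD[OF rc(1) eq(1)] 2 \<open>r \<in> rels L\<close> by blast
      moreover have "inj_on tc (set ts \<union> set ts')"
        by (rule inj_on_subset[OF tc(1)]) (simp add: 2(4) \<open>set ts \<subseteq> lang_terms L\<close>)
      ultimately show ?thesis using inj_on_map_eq_map[of tc ts ts'] eq(2) 2(1) by simp
    qed (use \<open>?n (Rel r ts) = ?n \<psi>\<close> in auto)
  next
    case (3 \<phi>)
    have "?n (Neg \<phi>) = ?n \<psi>" using 3(1,3,4) by (intro inj_n formulas.intros)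
    from 3(3) this show ?case by (cases rule: formulas.cases) (use 3(2,4) in auto)
  next
    case (4 \<mu> \<Phi>)
    have n: "?n (Conj \<mu> \<Phi>) = ?n \<psi>" using 4 by (intro inj_n formulas.intros)
    note ext = 4(2) and IH = "4.IH"
    from "4.prems"(1) show ?case
    proof (cases rule: formulas.cases)
      case (4 \<mu>' \<Psi>)
      then have eq: "\<mu> = \<mu>'" and
        restrict: "restrict (\<lambda>i. ?c (\<Phi> i)) (elts \<mu>) = restrict (\<lambda>i. ?c (\<Psi> i)) (elts \<mu>)"
        using n by auto
      have "\<Phi> = \<Psi>"
      proof (rule restr[OF ext _ restrict])
        show "\<Psi> \<in> extensional (elts \<mu>)" using 4(3) eq by simp
        fix i assume "i \<in> elts \<mu>" "?c (\<Phi> i) = ?c (\<Psi> i)"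
        then show "\<Phi> i = \<Psi> i" using 4(4) eq IH by simp
      qed
      then show ?thesis using 4(1) eq by simp
    qed (use n in auto)
  next
    case (5 \<mu> \<Phi>)
    have n: "?n (Disj \<mu> \<Phi>) = ?n \<psi>" using 5 by (intro inj_n formulas.intros)
    note ext = 5(2) and IH = "5.IH"
    from "5.prems"(1) show ?case
    proof (cases rule: formulas.cases)
      case (5 \<mu>' \<Psi>)
      then have eq: "\<mu> = \<mu>'" and
        restrict: "restrict (\<lambda>i. ?c (\<Phi> i)) (elts \<mu>) = restrict (\<lambda>i. ?c (\<Psi> i)) (elts \<mu>)"
        using n by auto
      have "\<Phi> = \<Psi>"
      proof (rule restr[OF ext _ restrict])
        show "\<Psi> \<in> extensional (elts \<mu>)" using 5(3) eq by simp
        fix i assume "i \<in> elts \<mu>" "?c (\<Phi> i) = ?c (\<Psi> i)"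
        then show "\<Phi> i = \<Psi> i" using 5(4) eq IH by simp
      qed
      then show ?thesis using 5(1) eq by simp
    qed (use n in auto)
  next
    case (6 \<phi> n)
    have "?n (Ex n \<phi>) = ?n \<psi>" using 6 by (intro inj_n formulas.intros)
    from 6(3) this show ?case by (cases rule: formulas.cases) (use 6(2,4) in auto)
  next
    case (7 \<phi> n)
    have "?n (All n \<phi>) = ?n \<psi>" using 7 by (intro inj_n formulas.intros)
    from 7(3) this show ?case by (cases rule: formulas.cases) (use 7(2,4) in auto)
  qed
  then have "inj_on ?c (formulas \<delta> L)" by (intro inj_onI)
  moreover have "?c ` formulas \<delta> L \<subseteq> ?K" using node J(2) by (auto simp: fm_code_eq)
  ultimately show ?thesis unfolding lepoll_def by blast
qed

section \<open>Free variables\<close>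

lemma tm_val_cong: "(\<And>k. k \<in> tm_vars t \<Longrightarrow> e k = e' k) \<Longrightarrow> tm_val S e t = tm_val S e' t"
proof (induction t)
  case (Fun f ts)
  have "map (tm_val S e) ts = map (tm_val S e') ts"
    using Fun by (intro map_cong refl) auto
  then show ?case by (simp only: tm_val.simps)
qed simp

lemma sat_cong: "(\<And>k. k \<in> free_vars \<phi> \<Longrightarrow> e k = e' k) \<Longrightarrow> sat S \<phi> e = sat S \<phi> e'"
proof (induction \<phi> arbitrary: e e')
  case (Eq s t)
  then show ?case using tm_val_cong[of s e e' S] tm_val_cong[of t e e' S] by simp
next
  case (Rel r ts)
  have "map (tm_val S e) ts = map (tm_val S e') ts"
    using Rel by (auto intro: tm_val_cong)
  then show ?case by (simp only: sat.simps)
next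
  case (Neg \<phi>)
  have "sat S \<phi> e = sat S \<phi> e'" by (rule Neg.IH) (simp add: Neg.prems)
  then show ?case by simp
next
  case (Conj \<mu> \<Phi>)
  have "sat S (\<Phi> i) e = sat S (\<Phi> i) e'" if "i \<in> elts \<mu>" for i
    by (rule Conj.IH) (use that Conj.prems in auto)
  then show ?case by simp
next
  case (Disj \<mu> \<Phi>)
  have "sat S (\<Phi> i) e = sat S (\<Phi> i) e'" if "i \<in> elts \<mu>" for i
    by (rule Disj.IH) (use that Disj.prems in auto)
  then show ?case by simp
next
  case (Ex n \<phi>)
  have "sat S \<phi> (e(n := x)) = sat S \<phi> (e'(n := x))" for x
    by (rule Ex.IH) (use Ex.prems in auto)
  then show ?case by simp
next
  case (All n \<phi>)
  have "sat S \<phi> (e(n := x)) = sat S \<phi> (e'(n := x))" for x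
    by (rule All.IH) (use All.prems in auto)
  then show ?case by simp
qed

lemma finite_tm_vars: "finite (tm_vars t)"
  by (induction t) auto

lemma finite_free_vars: "\<phi> \<in> formulas \<delta> L \<Longrightarrow> finite (free_vars \<phi>)"
  by (induction rule: formulas.induct) (auto simp: finite_tm_vars)

section \<open>Ultraproducts of definable functions\<close>

text \<open>The sets are coded into one \<open>y\<close> along an injection \<open>h\<close> of
  \<open>I\<close> into \<open>lam\<close>. Testing the single set consisting of \<open>a\<close>
  and the image of \<open>A\<close> under \<open>h\<close> yields one x that both covers
  \<open>a\<close> and decides the indices in \<open>A\<close>.\<close>

lemma family_measure_index:
  fixes \<delta> \<kappa> lam :: "'v::zfc"
  assumes family_measure: "family_measure \<delta> \<kappa> lam" and inf: "infinite (elts \<delta>)" and I: "I \<lesssim> elts lam"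
  shows "\<exists>V. \<forall>A\<subseteq>I. \<forall>a\<subseteq>elts lam. A \<prec> elts \<delta> \<longrightarrow> a \<prec> elts \<delta> \<longrightarrow>
    (\<exists>x\<in>elts (Pkl \<kappa> lam). a \<subseteq> elts x \<and> (\<forall>i\<in>A. V i \<longleftrightarrow> P i x))"
proof -
  let ?X = "Pkl \<kappa> lam"
  obtain h where h: "inj_on h I" "h ` I \<subseteq> elts lam" using I unfolding lepoll_def by blast
  define Y where "Y = {kpair (h i) x |i x. i \<in> I \<and> x \<in> elts ?X \<and> P i x}"
  have "Y \<subseteq> (\<lambda>(a, b). kpair a b) ` (elts lam \<times> elts ?X)"
    using h(2) by (fastforce simp: Y_def)
  then have sY: "small Y" by (rule small_subset[OF _ small_times])
  have Y: "kpair (h i) x \<in> Y \<longleftrightarrow> P i x" if "i \<in> I" "x \<in> elts ?X" for i x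
    using that inj_onD[OF h(1)] unfolding Y_def by auto
  obtain u where u: "\<forall>a\<in>elts (Pkl \<delta> lam). \<exists>x\<in>elts ?X. \<forall>\<xi>\<in>elts a.
     \<xi> \<in> elts x \<and> (\<xi> \<in> elts u \<longleftrightarrow> kpair \<xi> x \<in> elts (vset Y))"
    using family_measure unfolding family_measure_def by blast
  have "\<exists>x\<in>elts ?X. a \<subseteq> elts x \<and> (\<forall>i\<in>A. h i \<in> elts u \<longleftrightarrow> P i x)"
    if A: "A \<subseteq> I" "a \<subseteq> elts lam" "A \<prec> elts \<delta>" "a \<prec> elts \<delta>" for A a
  proof -
    have sub: "a \<union> h ` A \<subseteq> elts lam" using A h(2) by blast
    have "a \<union> h ` A \<prec> elts \<delta>"
      using A(3,4) by (intro Un_lesspoll_infinite[OF inf] lesspoll_trans1[OF image_lepoll])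
    moreover have el: "elts (vset (a \<union> h ` A)) = a \<union> h ` A"
      by (rule elts_vset[OF small_subset[OF sub small_elts]])
    ultimately have "vset (a \<union> h ` A) \<in> elts (Pkl \<delta> lam)"
      using sub by (simp add: elts_Pkl)
    with u el obtain x where x: "x \<in> elts ?X" "\<forall>\<xi>\<in>a \<union> h ` A.
        \<xi> \<in> elts x \<and> (\<xi> \<in> elts u \<longleftrightarrow> kpair \<xi> x \<in> elts (vset Y))" by metis
    have "h i \<in> elts u \<longleftrightarrow> P i x" if "i \<in> A" for i
      using x that Y[of i x] A(1) unfolding elts_vset[OF sY] by blast
    then show ?thesis using x by blast
  qed
  then show ?thesis by (intro exI[of _ "\<lambda>i. h i \<in> elts u"]) blast
qed

section \<open>Pointwise Skolem functions\<close>

definition sk_default :: "('v::zfc \<Rightarrow> 'v struct) \<Rightarrow> 'v \<Rightarrow> 'v" where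
  "sk_default S x = (SOME v. v \<in> univ (S x))"

text \<open>Two closure conditions in one operation: \<open>Inl f\<close> lets the ultraproduct
  interpret \<open>f\<close>, and \<open>Inr (\<phi>, n)\<close> provides the witnesses for
  quantifiers in Los's theorem. The list \<open>gs\<close> assigns functions to the variables 0, 1,
  and so on. The default values make it total, since \<open>hull\<close> applies it to lists of
  every length.\<close>

definition skolem :: "'v::zfc lang \<Rightarrow> ('v \<Rightarrow> 'v struct) \<Rightarrow> 'v + 'v fm \<times> nat \<Rightarrow> ('v \<Rightarrow> 'v) list \<Rightarrow> 'v \<Rightarrow> 'v" where
  "skolem L S s gs x = (case s of
     Inl f \<Rightarrow> if length gs = fun_arity L f then fun_int (S x) f (map (\<lambda>g. g x) gs) else sk_default S x
   | Inr (\<phi>, n) \<Rightarrow>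
       if \<exists>v\<in>univ (S x). sat (S x) \<phi> ((\<lambda>k. env (sk_default S) gs k x)(n := v))
       then SOME v. v \<in> univ (S x) \<and> sat (S x) \<phi> ((\<lambda>k. env (sk_default S) gs k x)(n := v))
       else sk_default S x)"

definition skolem_funs :: "'v::zfc \<Rightarrow> 'v lang \<Rightarrow> ('v \<Rightarrow> 'v struct) \<Rightarrow> ('v \<Rightarrow> 'v) set" where
  "skolem_funs \<delta> L S = hull (funs L <+> formulas \<delta> L \<times> UNIV) (skolem L S)"

text \<open>\<open>insert 0\<close> keeps \<open>Max\<close> meaningful for sentences. The bound
  exists because formulas have finitely many free variables, and it lets a finite list of functions
  replace an infinite assignment.\<close>

definition fv_bound :: "'v::zfc fm \<Rightarrow> nat" where
  "fv_bound \<phi> = Suc (Max (insert 0 (free_vars \<phi>)))"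

lemma less_fv_bound: "\<phi> \<in> formulas \<delta> L \<Longrightarrow> k \<in> free_vars \<phi> \<Longrightarrow> k < fv_bound \<phi>"
  unfolding fv_bound_def by (simp add: finite_free_vars less_Suc_eq_le)

context
  fixes \<delta> lam :: "'v::zfc" and L :: "'v lang" and S :: "'v \<Rightarrow> 'v struct" and X :: "'v set"
  assumes \<delta>: "Card \<delta>" "infinite (elts \<delta>)"
    and S: "\<And>x. x \<in> X \<Longrightarrow> is_struct L (S x)"
begin

abbreviation "sk_funs \<equiv> skolem_funs \<delta> L S"

lemma sk_default: "x \<in> X \<Longrightarrow> sk_default S x \<in> univ (S x)"
  unfolding sk_default_def using S[of x] by (auto simp: is_struct_def some_in_eq)

lemma skolem_funs_univ: "g \<in> sk_funs \<Longrightarrow> x \<in> X \<Longrightarrow> g x \<in> univ (S x)"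
  unfolding skolem_funs_def
proof (induction arbitrary: x rule: hull.induct)
  case (1 s gs)
  show ?case
  proof (cases s)
    case (Inl f)
    then have "f \<in> funs L" using 1(1) by auto
    moreover have "set (map (\<lambda>g. g x) gs) \<subseteq> univ (S x)" using 1(3,4) by auto
    ultimately show ?thesis
      using S[OF 1(4)] sk_default[OF 1(4)] unfolding is_struct_def skolem_def Inl by simp
  next
    case (Inr p)
    obtain \<phi> n where p: "p = (\<phi>, n)" by (cases p)
    show ?thesis
      unfolding skolem_def Inr p using sk_default[OF 1(4)]
      by (auto intro: someI2_bex)
  qed
qed

lemma skolem_funs_app:
  assumes "f \<in> funs L" "set gs \<subseteq> sk_funs" "length gs = fun_arity L f"
  shows "(\<lambda>x. fun_int (S x) f (map (\<lambda>g. g x) gs)) \<in> sk_funs"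
proof -
  have "skolem L S (Inl f) gs \<in> sk_funs"
    unfolding skolem_funs_def using assms by (intro hull.intros) (auto simp: skolem_funs_def)
  moreover have "skolem L S (Inl f) gs = (\<lambda>x. fun_int (S x) f (map (\<lambda>g. g x) gs))"
    using assms(3) by (intro ext) (simp add: skolem_def)
  ultimately show ?thesis by simp
qed

text \<open>One \<open>g\<close> has to serve all x simultaneously. The formula sees only the part
  of \<open>e\<close> below its variable bound, and that part is a list to which the operation
  \<open>skolem\<close> applies.\<close>

lemma skolem_funs_witness:
  assumes \<phi>: "\<phi> \<in> formulas \<delta> L" and e: "range e \<subseteq> sk_funs"
  shows "\<exists>g\<in>sk_funs. \<forall>x\<in>X. (\<exists>v\<in>univ (S x). sat (S x) \<phi> ((\<lambda>k. e k x)(n := v)))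
    \<longrightarrow> sat (S x) \<phi> (\<lambda>k. (e(n := g)) k x)"
proof -
  define gs where "gs = map e [0..<fv_bound \<phi>]"
  define g where "g = skolem L S (Inr (\<phi>, n)) gs"
  have "g \<in> sk_funs"
    unfolding g_def skolem_funs_def using \<phi> e
    by (intro hull.intros) (auto simp: skolem_funs_def gs_def)
  moreover have "sat (S x) \<phi> (\<lambda>k. (e(n := g)) k x)"
    if ex: "\<exists>v\<in>univ (S x). sat (S x) \<phi> ((\<lambda>k. e k x)(n := v))" for x
  proof -
    have eq: "sat (S x) \<phi> ((\<lambda>k. env (sk_default S) gs k x)(n := v)) = sat (S x) \<phi> ((\<lambda>k. e k x)(n := v))" for v
      by (rule sat_cong) (use less_fv_bound[OF \<phi>] in \<open>auto simp: env_def gs_def\<close>)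
    have "g x = (SOME v. v \<in> univ (S x) \<and> sat (S x) \<phi> ((\<lambda>k. e k x)(n := v)))"
      unfolding g_def skolem_def using ex by (simp add: eq)
    then have "sat (S x) \<phi> ((\<lambda>k. e k x)(n := g x))" using ex by (metis (mono_tags, lifting) someI_ex)
    moreover have "(\<lambda>k. e k x)(n := g x) = (\<lambda>k. (e(n := g)) k x)" by auto
    ultimately show ?thesis by simp
  qed
  ultimately show ?thesis by blast
qed

lemma skolem_funs_lepoll:
  assumes "infinite C" "funs L \<lesssim> C" "formulas \<delta> L \<lesssim> C"
  shows "sk_funs \<lesssim> C"
  unfolding skolem_funs_def using assms
  by (intro hull_lepoll Plus_lepoll_infinite times_lepoll_infinite) (auto simp: infinite_le_lepoll)

lemma skolem_funs_nonempty: "sk_funs \<noteq> {}"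
proof -
  have "Eq (Var 0) (Var 0) \<in> formulas \<delta> L" by (intro formulas.intros lang_terms.intros)
  then have "skolem L S (Inr (Eq (Var 0) (Var 0), 0)) [] \<in> sk_funs"
    unfolding skolem_funs_def by (intro hull.intros) auto
  then show ?thesis by blast
qed

text \<open>\<open>W \<phi> e\<close> says that the set of \<open>x\<close> with \<open>S x \<Turnstile> \<phi>[e x]\<close> is in the ultrafilter. Instead of
  closure properties of the ultrafilter we only use that fewer than \<open>\<delta>\<close> such statements are
  simultaneously decided correctly by some \<open>x\<close>.\<close>

context
  fixes W :: "'v fm \<Rightarrow> (nat \<Rightarrow> 'v \<Rightarrow> 'v) \<Rightarrow> bool" and c :: "('v \<Rightarrow> 'v) \<Rightarrow> 'v" and K :: 'v
  assumes pick: "\<And>A. A \<subseteq> {(\<phi>, e). \<phi> \<in> formulas \<delta> L \<and> range e \<subseteq> sk_funs} \<Longrightarrow> A \<prec> elts \<delta> \<Longrightarrow>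
      \<exists>x\<in>X. \<forall>(\<phi>, e)\<in>A. W \<phi> e \<longleftrightarrow> sat (S x) \<phi> (\<lambda>k. e k x)"
    and c: "inj_on c sk_funs" "c ` sk_funs \<subseteq> elts K"
begin

section \<open>The restricted ultraproduct and Los's theorem\<close>

definition ultra_correct :: "'v \<Rightarrow> 'v fm \<Rightarrow> (nat \<Rightarrow> 'v \<Rightarrow> 'v) \<Rightarrow> bool" where
  "ultra_correct x \<phi> e \<longleftrightarrow> (W \<phi> e \<longleftrightarrow> sat (S x) \<phi> (\<lambda>k. e k x))"

lemma pick_correct:
  assumes "A \<prec> elts \<delta>" "\<And>\<phi> e. (\<phi>, e) \<in> A \<Longrightarrow> \<phi> \<in> formulas \<delta> L \<and> range e \<subseteq> sk_funs"
  shows "\<exists>x\<in>X. \<forall>p q. (p, q) \<in> A \<longrightarrow> ultra_correct x p q"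
  using pick[OF _ assms(1)] assms(2) unfolding ultra_correct_def by fast

lemma pick_finite:
  assumes "finite A" "\<And>\<phi> e. (\<phi>, e) \<in> A \<Longrightarrow> \<phi> \<in> formulas \<delta> L \<and> range e \<subseteq> sk_funs"
  shows "\<exists>x\<in>X. \<forall>p q. (p, q) \<in> A \<longrightarrow> ultra_correct x p q"
  using assms \<delta>(2) by (intro pick_correct) (simp_all add: finite_lesspoll_infinite)

text \<open>Equality modulo the ultrafilter is expressed by a formula, so that \<open>W\<close>
  decides it together with all other statements.\<close>

definition eq_fm :: "'v fm" where "eq_fm = Eq (Var 0) (Var 1)"

definition ultra_eq :: "('v \<Rightarrow> 'v) \<Rightarrow> ('v \<Rightarrow> 'v) \<Rightarrow> bool" where
  "ultra_eq g h \<longleftrightarrow> W eq_fm (case_nat g (\<lambda>_. h))"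

lemma eq_fm: "eq_fm \<in> formulas \<delta> L"
  unfolding eq_fm_def by (intro formulas.intros lang_terms.intros)

lemma sat_eqf: "sat T eq_fm (\<lambda>k. (case_nat g (\<lambda>_. h)) k x) \<longleftrightarrow> g x = h x"
  by (simp add: eq_fm_def)

lemma range_case_nat: "g \<in> sk_funs \<Longrightarrow> h \<in> sk_funs \<Longrightarrow> range (case_nat g (\<lambda>_. h)) \<subseteq> sk_funs"
  by (auto split: nat.splits)

text \<open>Replaces the algebra of filter sets: when finitely many statements enter an argument, it
  is carried out at one x where all of them are decided correctly. Already symmetry and transitivity
  of \<open>ultra_eq\<close> are obtained like this.\<close>

lemma pick_eqv:
  assumes "finite A" "\<And>\<phi> e. (\<phi>, e) \<in> A \<Longrightarrow> \<phi> \<in> formulas \<delta> L \<and> range e \<subseteq> sk_funs"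
    and "finite B" "B \<subseteq> sk_funs \<times> sk_funs"
  shows "\<exists>x\<in>X. (\<forall>p q. (p, q) \<in> A \<longrightarrow> ultra_correct x p q) \<and> (\<forall>a b. (a, b) \<in> B \<longrightarrow> (ultra_eq a b \<longleftrightarrow> a x = b x))"
proof -
  have "\<exists>x\<in>X. \<forall>p q. (p, q) \<in> A \<union> (\<lambda>(g, h). (eq_fm, case_nat g (\<lambda>_. h))) ` B \<longrightarrow> ultra_correct x p q"
  proof (rule pick_finite)
    fix \<phi> e assume "(\<phi>, e) \<in> A \<union> (\<lambda>(g, h). (eq_fm, case_nat g (\<lambda>_. h))) ` B"
    then show "\<phi> \<in> formulas \<delta> L \<and> range e \<subseteq> sk_funs"
    proof
      assume "(\<phi>, e) \<in> (\<lambda>(g, h). (eq_fm, case_nat g (\<lambda>_. h))) ` B"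
      then obtain g h where "(g, h) \<in> B" "\<phi> = eq_fm" "e = case_nat g (\<lambda>_. h)" by auto
      then show ?thesis using assms(4) eq_fm range_case_nat[of g h] by blast
    qed (rule assms(2))
  qed (use assms in auto)
  then obtain x where x: "x \<in> X" "\<forall>p q. (p, q) \<in> A \<longrightarrow> ultra_correct x p q"
    "\<forall>p q. (p, q) \<in> (\<lambda>(g, h). (eq_fm, case_nat g (\<lambda>_. h))) ` B \<longrightarrow> ultra_correct x p q"
    by blast
  then have "\<forall>g h. (g, h) \<in> B \<longrightarrow> ultra_correct x eq_fm (case_nat g (\<lambda>_. h))"
    by (metis (no_types, lifting) case_prod_conv imageI)
  with x(1,2) show ?thesis unfolding ultra_eq_def ultra_correct_def[of _ eq_fm] sat_eqf by blast
qed

lemma eqv_refl: "g \<in> sk_funs \<Longrightarrow> ultra_eq g g"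
  using pick_eqv[of "{}" "{(g, g)}"] by auto

lemma eqv_sym: "g \<in> sk_funs \<Longrightarrow> h \<in> sk_funs \<Longrightarrow> ultra_eq g h \<Longrightarrow> ultra_eq h g"
proof -
  assume gh: "g \<in> sk_funs" "h \<in> sk_funs" "ultra_eq g h"
  obtain x where "\<forall>a b. (a, b) \<in> {(g, h), (h, g)} \<longrightarrow> (ultra_eq a b \<longleftrightarrow> a x = b x)"
    using pick_eqv[of "{}" "{(g, h), (h, g)}"] gh by blast
  then show ?thesis using gh(3) by simp
qed

lemma eqv_trans: "g \<in> sk_funs \<Longrightarrow> h \<in> sk_funs \<Longrightarrow> k \<in> sk_funs \<Longrightarrow> ultra_eq g h \<Longrightarrow> ultra_eq h k \<Longrightarrow> ultra_eq g k"
proof -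
  assume gh: "g \<in> sk_funs" "h \<in> sk_funs" "k \<in> sk_funs" "ultra_eq g h" "ultra_eq h k"
  obtain x where "\<forall>a b. (a, b) \<in> {(g, h), (h, k), (g, k)} \<longrightarrow> (ultra_eq a b \<longleftrightarrow> a x = b x)"
    using pick_eqv[of "{}" "{(g, h), (h, k), (g, k)}"] gh by blast
  then show ?thesis using gh(4,5) by simp
qed

definition ultra_rep :: "('v \<Rightarrow> 'v) \<Rightarrow> 'v \<Rightarrow> 'v" where
  "ultra_rep g = (SOME h. h \<in> sk_funs \<and> ultra_eq g h)"

lemma ultra_rep: "g \<in> sk_funs \<Longrightarrow> ultra_rep g \<in> sk_funs" "g \<in> sk_funs \<Longrightarrow> ultra_eq g (ultra_rep g)"
  unfolding ultra_rep_def using someI[of "\<lambda>h. h \<in> sk_funs \<and> ultra_eq g h" g] eqv_refl by auto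

lemma rep_eq:
  assumes "g \<in> sk_funs" "h \<in> sk_funs" shows "ultra_rep g = ultra_rep h \<longleftrightarrow> ultra_eq g h"
proof
  assume "ultra_rep g = ultra_rep h"
  then show "ultra_eq g h"
    using ultra_rep[OF assms(1)] ultra_rep[OF assms(2)] eqv_trans[of g "ultra_rep g" h] eqv_sym[of h "ultra_rep g"] assms by simp
next
  assume "ultra_eq g h"
  then have "(\<lambda>k. k \<in> sk_funs \<and> ultra_eq g k) = (\<lambda>k. k \<in> sk_funs \<and> ultra_eq h k)"
    using assms eqv_trans eqv_sym by (intro ext) blast
  then show "ultra_rep g = ultra_rep h" unfolding ultra_rep_def by simp
qed

text \<open>The universe of a structure must consist of elements of \<open>'v\<close>, so the class
  of a function is represented by the code under \<open>c\<close> of its chosen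
  representative.\<close>

definition ultra_univ :: "'v set" where "ultra_univ = c ` ultra_rep ` sk_funs"

definition ultra_dec :: "'v \<Rightarrow> 'v \<Rightarrow> 'v" where "ultra_dec = inv_into sk_funs c"

lemma dec_c: "g \<in> sk_funs \<Longrightarrow> ultra_dec (c g) = g"
  unfolding ultra_dec_def by (rule inv_into_f_f[OF c(1)])

lemma dec_univ:
  assumes "v \<in> ultra_univ" shows "ultra_dec v \<in> sk_funs" "ultra_rep (ultra_dec v) = ultra_dec v" "c (ultra_dec v) = v"
proof -
  obtain g where g: "g \<in> sk_funs" "v = c (ultra_rep g)" using assms by (auto simp: ultra_univ_def)
  then have d: "ultra_dec v = ultra_rep g" using dec_c ultra_rep by simp
  show "ultra_dec v \<in> sk_funs" "c (ultra_dec v) = v" using d g ultra_rep by auto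
  show "ultra_rep (ultra_dec v) = ultra_dec v" unfolding d using rep_eq ultra_rep g eqv_sym by metis
qed

lemma eqv_dec: "v \<in> ultra_univ \<Longrightarrow> w \<in> ultra_univ \<Longrightarrow> ultra_eq (ultra_dec v) (ultra_dec w) \<longleftrightarrow> v = w"
  using rep_eq dec_univ by metis

lemma c_rep: "g \<in> sk_funs \<Longrightarrow> c (ultra_rep g) \<in> ultra_univ" "g \<in> sk_funs \<Longrightarrow> ultra_dec (c (ultra_rep g)) = ultra_rep g"
  using dec_c ultra_rep by (auto simp: ultra_univ_def)

text \<open>A relation holds if \<open>W\<close> accepts the atomic formula in the variables 0, 1,
  and so on, with the arguments assigned to them; the padding keeps that assignment inside
  \<open>sk_funs\<close>.\<close>

definition ultra_struct :: "'v struct" where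
  "ultra_struct = \<lparr>univ = ultra_univ,
     rel_int = (\<lambda>r vs. W (Rel r (map Var [0..<length vs])) (env (ultra_rep (SOME g. g \<in> sk_funs)) (map ultra_dec vs))),
     fun_int = (\<lambda>f vs. c (ultra_rep (\<lambda>x. fun_int (S x) f (map (\<lambda>v. ultra_dec v x) vs))))\<rparr>"

lemma univ_ultra_struct: "univ ultra_struct = ultra_univ"
  by (simp add: ultra_struct_def)

lemma ultra_struct_fun:
  assumes "f \<in> funs L" "set vs \<subseteq> ultra_univ" "length vs = fun_arity L f"
  shows "(\<lambda>x. fun_int (S x) f (map (\<lambda>v. ultra_dec v x) vs)) \<in> sk_funs"
  using skolem_funs_app[of f "map ultra_dec vs"] assms dec_univ(1) by (auto simp: o_def)

lemma is_struct_ultra: "is_struct L ultra_struct"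
proof -
  have "ultra_univ \<subseteq> elts K" using c(2) ultra_rep by (auto simp: ultra_univ_def)
  then have "small ultra_univ" by (rule small_subset) simp
  moreover have "ultra_univ \<noteq> {}" using skolem_funs_nonempty by (auto simp: ultra_univ_def)
  ultimately show ?thesis
    using ultra_struct_fun c_rep by (auto simp: is_struct_def ultra_struct_def)
qed

lemma dec_range: "range e \<subseteq> ultra_univ \<Longrightarrow> range (\<lambda>k. ultra_dec (e k)) \<subseteq> sk_funs"
  using dec_univ(1) by blast

text \<open>The point is that the value of \<open>t\<close> is the class of its pointwise values. As
  \<open>W\<close> judges formulas only, the value is placed at a variable \<open>m\<close>;
  freshness of \<open>m\<close> leaves the evaluation of \<open>t\<close> undisturbed.\<close>

lemma ultra_tm:
  assumes "t \<in> lang_terms L" "range e \<subseteq> ultra_univ"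
  shows "tm_val ultra_struct e t \<in> ultra_univ \<and> (\<forall>m. m \<notin> tm_vars t \<longrightarrow>
    W (Eq (Var m) t) ((\<lambda>k. ultra_dec (e k))(m := ultra_dec (tm_val ultra_struct e t))))"
  using assms(1)
proof induction
  case (1 n)
  have "e n \<in> ultra_univ" using assms(2) by auto
  moreover have "W (Eq (Var m) (Var n)) ((\<lambda>k. ultra_dec (e k))(m := ultra_dec (e n)))" if "m \<noteq> n" for m
  proof -
    have "range ((\<lambda>k. ultra_dec (e k))(m := ultra_dec (e n))) \<subseteq> sk_funs"
      using dec_range[OF assms(2)] by auto
    then obtain x where "ultra_correct x (Eq (Var m) (Var n)) ((\<lambda>k. ultra_dec (e k))(m := ultra_dec (e n)))"
      using pick_finite[of "{(Eq (Var m) (Var n), (\<lambda>k. ultra_dec (e k))(m := ultra_dec (e n)))}"]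
        formulas.intros(1)[OF lang_terms.intros(1) lang_terms.intros(1)] by blast
    then show ?thesis using that by (simp add: ultra_correct_def)
  qed
  ultimately show ?case unfolding tm_val.simps tm_vars.simps by blast
next
  case (2 f ts)
  let ?v = "tm_val ultra_struct e"
  define g where "g = (\<lambda>x. fun_int (S x) f (map (\<lambda>v. ultra_dec v x) (map ?v ts)))"
  have v: "\<And>t. t \<in> set ts \<Longrightarrow> ?v t \<in> ultra_univ" using 2 by blast
  have gF: "g \<in> sk_funs" unfolding g_def using 2 v by (intro ultra_struct_fun) auto
  have val: "?v (Fun f ts) = c (ultra_rep g)" by (simp add: ultra_struct_def g_def)
  have dval: "ultra_dec (?v (Fun f ts)) = ultra_rep g" unfolding val by (rule c_rep[OF gF])
  have "W (Eq (Var m) (Fun f ts)) ((\<lambda>k. ultra_dec (e k))(m := ultra_rep g))" if m: "m \<notin> tm_vars (Fun f ts)" for m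
  proof -
    \<comment> \<open>At one x the equations for all arguments and for the whole term are decided,
      and \<open>g\<close> agrees with its representative there. What remains is the evaluation of a
      term in \<open>S x\<close>.\<close>
    let ?A = "insert (Eq (Var m) (Fun f ts), (\<lambda>k. ultra_dec (e k))(m := ultra_rep g))
        ((\<lambda>t. (Eq (Var m) t, (\<lambda>k. ultra_dec (e k))(m := ultra_dec (?v t)))) ` set ts)"
    have "\<exists>x\<in>X. (\<forall>p q. (p, q) \<in> ?A \<longrightarrow> ultra_correct x p q) \<and> (\<forall>a b. (a, b) \<in> {(g, ultra_rep g)} \<longrightarrow> (ultra_eq a b \<longleftrightarrow> a x = b x))"
    proof (rule pick_eqv)
      fix \<phi> e' assume "(\<phi>, e') \<in> ?A"
      then show "\<phi> \<in> formulas \<delta> L \<and> range e' \<subseteq> sk_funs"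
        using dec_range[OF assms(2)] ultra_rep(1)[OF gF] dec_univ(1)[OF v] 2
        by (auto intro!: formulas.intros lang_terms.intros simp: image_subset_iff)
    qed (use gF ultra_rep in auto)
    then obtain x where x: "x \<in> X" "\<forall>p q. (p, q) \<in> ?A \<longrightarrow> ultra_correct x p q" "g x = ultra_rep g x"
      using ultra_rep(2)[OF gF] by blast
    have "ultra_dec (?v t) x = tm_val (S x) (\<lambda>k. ((\<lambda>k. ultra_dec (e k))(m := ultra_rep g)) k x) t" if t: "t \<in> set ts" for t
    proof -
      have mt: "m \<notin> tm_vars t" using m t by auto
      then have "W (Eq (Var m) t) ((\<lambda>k. ultra_dec (e k))(m := ultra_dec (?v t)))" using 2 t by blast
      then have "sat (S x) (Eq (Var m) t) (\<lambda>k. ((\<lambda>k. ultra_dec (e k))(m := ultra_dec (?v t))) k x)"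
        using x(2) t unfolding ultra_correct_def by blast
      then have "ultra_dec (?v t) x = tm_val (S x) (\<lambda>k. ((\<lambda>k. ultra_dec (e k))(m := ultra_dec (?v t))) k x) t"
        unfolding sat.simps tm_val.simps fun_upd_same .
      also have "\<dots> = tm_val (S x) (\<lambda>k. ((\<lambda>k. ultra_dec (e k))(m := ultra_rep g)) k x) t"
        by (rule tm_val_cong) (use mt in auto)
      finally show ?thesis .
    qed
    then have eq: "map (\<lambda>v. ultra_dec v x) (map ?v ts) = map (tm_val (S x) (\<lambda>k. ((\<lambda>k. ultra_dec (e k))(m := ultra_rep g)) k x)) ts"
      by simp
    have "g x = tm_val (S x) (\<lambda>k. ((\<lambda>k. ultra_dec (e k))(m := ultra_rep g)) k x) (Fun f ts)"
      unfolding tm_val.simps eq[symmetric] by (simp only: g_def)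
    then have "sat (S x) (Eq (Var m) (Fun f ts)) (\<lambda>k. ((\<lambda>k. ultra_dec (e k))(m := ultra_rep g)) k x)"
      unfolding sat.simps tm_val.simps(1) fun_upd_same x(3) .
    then show ?thesis using x(2) unfolding ultra_correct_def by blast
  qed
  moreover have "?v (Fun f ts) \<in> ultra_univ" unfolding val by (rule c_rep(1)[OF gF])
  ultimately show ?case unfolding dval by blast
qed

lemma pick_terms:
  assumes e: "range e \<subseteq> ultra_univ" and ts: "set ts \<subseteq> lang_terms L"
    and A: "finite A" "\<And>\<phi> e. (\<phi>, e) \<in> A \<Longrightarrow> \<phi> \<in> formulas \<delta> L \<and> range e \<subseteq> sk_funs"
    and B: "finite B" "B \<subseteq> sk_funs \<times> sk_funs"
  shows "\<exists>x\<in>X. (\<forall>p q. (p, q) \<in> A \<longrightarrow> ultra_correct x p q) \<and> (\<forall>a b. (a, b) \<in> B \<longrightarrow> (ultra_eq a b \<longleftrightarrow> a x = b x)) \<and>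
    map (\<lambda>v. ultra_dec v x) (map (tm_val ultra_struct e) ts) = map (tm_val (S x) (\<lambda>k. ultra_dec (e k) x)) ts"
proof -
  let ?v = "tm_val ultra_struct e"
  have "\<exists>m. m \<notin> (\<Union>t\<in>set ts. tm_vars t)"
    by (rule ex_new_if_finite) (auto simp: finite_tm_vars)
  then obtain m where m: "\<And>t. t \<in> set ts \<Longrightarrow> m \<notin> tm_vars t" by blast
  have v: "\<And>t. t \<in> set ts \<Longrightarrow> ?v t \<in> ultra_univ" using ultra_tm[OF _ e] ts by blast
  let ?A = "A \<union> (\<lambda>t. (Eq (Var m) t, (\<lambda>k. ultra_dec (e k))(m := ultra_dec (?v t)))) ` set ts"
  have "\<exists>x\<in>X. (\<forall>p q. (p, q) \<in> ?A \<longrightarrow> ultra_correct x p q) \<and> (\<forall>a b. (a, b) \<in> B \<longrightarrow> (ultra_eq a b \<longleftrightarrow> a x = b x))"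
  proof (rule pick_eqv)
    fix \<phi> e' assume "(\<phi>, e') \<in> ?A"
    then show "\<phi> \<in> formulas \<delta> L \<and> range e' \<subseteq> sk_funs"
    proof
      assume "(\<phi>, e') \<in> A" then show ?thesis by (rule A(2))
    next
      assume "(\<phi>, e') \<in> (\<lambda>t. (Eq (Var m) t, (\<lambda>k. ultra_dec (e k))(m := ultra_dec (?v t)))) ` set ts"
      then show ?thesis
        using dec_range[OF e] dec_univ(1)[OF v] ts
        by (auto intro!: formulas.intros lang_terms.intros simp: image_subset_iff)
    qed
  qed (use A B in auto)
  then obtain x where x: "x \<in> X" "\<forall>p q. (p, q) \<in> ?A \<longrightarrow> ultra_correct x p q"
    "\<forall>a b. (a, b) \<in> B \<longrightarrow> (ultra_eq a b \<longleftrightarrow> a x = b x)" by blast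
  have "ultra_dec (?v t) x = tm_val (S x) (\<lambda>k. ultra_dec (e k) x) t" if t: "t \<in> set ts" for t
  proof -
    have "W (Eq (Var m) t) ((\<lambda>k. ultra_dec (e k))(m := ultra_dec (?v t)))" using ultra_tm[OF _ e] ts t m by blast
    then have "sat (S x) (Eq (Var m) t) (\<lambda>k. ((\<lambda>k. ultra_dec (e k))(m := ultra_dec (?v t))) k x)"
      using x(2) t unfolding ultra_correct_def by blast
    then have "ultra_dec (?v t) x = tm_val (S x) (\<lambda>k. ((\<lambda>k. ultra_dec (e k))(m := ultra_dec (?v t))) k x) t"
      unfolding sat.simps tm_val.simps fun_upd_same .
    also have "\<dots> = tm_val (S x) (\<lambda>k. ultra_dec (e k) x) t"
      by (rule tm_val_cong) (use m[OF t] in auto)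
    finally show ?thesis .
  qed
  then have "map (\<lambda>v. ultra_dec v x) (map ?v ts) = map (tm_val (S x) (\<lambda>k. ultra_dec (e k) x)) ts" by simp
  then show ?thesis using x by blast
qed

text \<open>In each case a single x decides the formula together with the subformulas involved, and
  the claim is the definition of \<open>sat\<close> at that x. Conjunctions and disjunctions need
  fewer than \<delta> simultaneous decisions; the other cases need finitely many.\<close>

theorem los:
  assumes "\<phi> \<in> formulas \<delta> L" "range e \<subseteq> ultra_univ"
  shows "sat ultra_struct \<phi> e \<longleftrightarrow> W \<phi> (\<lambda>k. ultra_dec (e k))"
  using assms
proof (induction arbitrary: e)
  case (1 s t)
  let ?v = "tm_val ultra_struct e"
  have v: "?v s \<in> ultra_univ" "?v t \<in> ultra_univ" using ultra_tm 1 by blast+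
  have "\<exists>x\<in>X. (\<forall>p q. (p, q) \<in> {(Eq s t, \<lambda>k. ultra_dec (e k))} \<longrightarrow> ultra_correct x p q) \<and>
    (\<forall>a b. (a, b) \<in> {(ultra_dec (?v s), ultra_dec (?v t))} \<longrightarrow> (ultra_eq a b \<longleftrightarrow> a x = b x)) \<and>
    map (\<lambda>v. ultra_dec v x) (map ?v [s, t]) = map (tm_val (S x) (\<lambda>k. ultra_dec (e k) x)) [s, t]"
    using 1 dec_range[OF 1(3)] dec_univ(1) v by (intro pick_terms) (auto intro: formulas.intros)
  then obtain x where "ultra_correct x (Eq s t) (\<lambda>k. ultra_dec (e k))" "ultra_eq (ultra_dec (?v s)) (ultra_dec (?v t)) \<longleftrightarrow> ultra_dec (?v s) x = ultra_dec (?v t) x"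
    "map (\<lambda>v. ultra_dec v x) (map ?v [s, t]) = map (tm_val (S x) (\<lambda>k. ultra_dec (e k) x)) [s, t]" by blast
  then show ?case using eqv_dec[OF v] by (simp add: ultra_correct_def)
next
  case (2 r ts)
  let ?v = "tm_val ultra_struct e"
  let ?R = "Rel r (map Var [0..<length ts])" and ?E = "env (ultra_rep (SOME g. g \<in> sk_funs)) (map ultra_dec (map ?v ts))"
  have v: "\<And>t. t \<in> set ts \<Longrightarrow> ?v t \<in> ultra_univ" using ultra_tm 2 by blast
  have "(SOME g. g \<in> sk_funs) \<in> sk_funs" using skolem_funs_nonempty some_in_eq by blast
  then have E: "range ?E \<subseteq> sk_funs"
    by (intro env_range) (auto simp: ultra_rep dec_univ(1)[OF v])
  have "\<exists>x\<in>X. (\<forall>p q. (p, q) \<in> {(Rel r ts, \<lambda>k. ultra_dec (e k)), (?R, ?E)} \<longrightarrow> ultra_correct x p q) \<and>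
    (\<forall>a b. (a, b) \<in> {} \<longrightarrow> (ultra_eq a b \<longleftrightarrow> a x = b x)) \<and>
    map (\<lambda>v. ultra_dec v x) (map ?v ts) = map (tm_val (S x) (\<lambda>k. ultra_dec (e k) x)) ts"
    using 2 dec_range[OF 2(4)] E
    by (intro pick_terms) (auto intro!: formulas.intros lang_terms.intros simp del: map_map)
  then obtain x where x: "ultra_correct x (Rel r ts) (\<lambda>k. ultra_dec (e k))" "ultra_correct x ?R ?E"
    "map (\<lambda>v. ultra_dec v x) (map ?v ts) = map (tm_val (S x) (\<lambda>k. ultra_dec (e k) x)) ts"
    by (elim bexE conjE) (rule that, simp_all only: insert_iff simp_thms)
  have "map (tm_val (S x) (\<lambda>k. ?E k x)) (map Var [0..<length ts]) = map (\<lambda>v. ultra_dec v x) (map ?v ts)"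
    by (rule nth_equalityI) (auto simp: env_def)
  then have "W ?R ?E \<longleftrightarrow> W (Rel r ts) (\<lambda>k. ultra_dec (e k))"
    using x(1,2) unfolding ultra_correct_def sat.simps x(3)[symmetric] by simp
  moreover have "sat ultra_struct (Rel r ts) e \<longleftrightarrow> W ?R ?E" by (simp add: ultra_struct_def)
  ultimately show ?case by simp
next
  case (3 \<phi>)
  have "\<exists>x\<in>X. \<forall>p q. (p, q) \<in> {(Neg \<phi>, \<lambda>k. ultra_dec (e k)), (\<phi>, \<lambda>k. ultra_dec (e k))} \<longrightarrow> ultra_correct x p q"
    using 3(1) dec_range[OF 3(3)] by (intro pick_finite) (auto intro: formulas.intros)
  then obtain x where "ultra_correct x (Neg \<phi>) (\<lambda>k. ultra_dec (e k))" "ultra_correct x \<phi> (\<lambda>k. ultra_dec (e k))" by blast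
  then show ?case using 3(2)[OF 3(3)] by (simp add: ultra_correct_def)
next
  case (4 \<mu> \<Phi>)
  let ?e = "\<lambda>k. ultra_dec (e k)"
  let ?A = "{(Conj \<mu> \<Phi>, ?e)} \<union> (\<lambda>i. (\<Phi> i, ?e)) ` elts \<mu>"
  have "\<exists>x\<in>X. \<forall>p q. (p, q) \<in> ?A \<longrightarrow> ultra_correct x p q"
  proof (rule pick_correct)
    show "?A \<prec> elts \<delta>"
      using lesspoll_trans1[OF image_lepoll Card_mem_lesspoll[OF \<delta>(1) 4(1)]] \<delta>(2)
      by (intro Un_lesspoll_infinite) (simp_all add: finite_lesspoll_infinite)
    fix \<phi> e' assume "(\<phi>, e') \<in> ?A"
    then show "\<phi> \<in> formulas \<delta> L \<and> range e' \<subseteq> sk_funs"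
      using "4.hyps" dec_range[OF "4.prems"] formulas.intros(4)[OF "4.hyps"] by blast
  qed
  then obtain x where "ultra_correct x (Conj \<mu> \<Phi>) ?e" "\<forall>i\<in>elts \<mu>. ultra_correct x (\<Phi> i) ?e" by blast
  then show ?case using "4.IH"[OF _ "4.prems"] by (simp add: ultra_correct_def)
next
  case (5 \<mu> \<Phi>)
  let ?e = "\<lambda>k. ultra_dec (e k)"
  let ?A = "{(Disj \<mu> \<Phi>, ?e)} \<union> (\<lambda>i. (\<Phi> i, ?e)) ` elts \<mu>"
  have "\<exists>x\<in>X. \<forall>p q. (p, q) \<in> ?A \<longrightarrow> ultra_correct x p q"
  proof (rule pick_correct)
    show "?A \<prec> elts \<delta>"
      using lesspoll_trans1[OF image_lepoll Card_mem_lesspoll[OF \<delta>(1) 5(1)]] \<delta>(2)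
      by (intro Un_lesspoll_infinite) (simp_all add: finite_lesspoll_infinite)
    fix \<phi> e' assume "(\<phi>, e') \<in> ?A"
    then show "\<phi> \<in> formulas \<delta> L \<and> range e' \<subseteq> sk_funs"
      using "5.hyps" dec_range[OF "5.prems"] formulas.intros(5)[OF "5.hyps"] by blast
  qed
  then obtain x where "ultra_correct x (Disj \<mu> \<Phi>) ?e" "\<forall>i\<in>elts \<mu>. ultra_correct x (\<Phi> i) ?e" by blast
  then show ?case using "5.IH"[OF _ "5.prems"] by (simp add: ultra_correct_def)
next
  case (6 \<phi> n)
  let ?e = "\<lambda>k. ultra_dec (e k)"
  note eF = dec_range[OF 6(3)]
  have IH: "sat ultra_struct \<phi> (e(n := v)) \<longleftrightarrow> W \<phi> (?e(n := ultra_dec v))" if "v \<in> ultra_univ" for v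
  proof -
    have "range (e(n := v)) \<subseteq> ultra_univ" using 6(3) that by auto
    moreover have "(\<lambda>k. ultra_dec ((e(n := v)) k)) = ?e(n := ultra_dec v)" by auto
    ultimately show ?thesis using 6(2) by simp
  qed
  have "W (Ex n \<phi>) ?e \<longleftrightarrow> (\<exists>v\<in>ultra_univ. W \<phi> (?e(n := ultra_dec v)))"
  proof
    assume Ex: "W (Ex n \<phi>) ?e"
    obtain g where g: "g \<in> sk_funs" "\<forall>x\<in>X. (\<exists>v\<in>univ (S x). sat (S x) \<phi> ((\<lambda>k. ?e k x)(n := v)))
      \<longrightarrow> sat (S x) \<phi> (\<lambda>k. (?e(n := g)) k x)"
      using skolem_funs_witness[OF 6(1) eF] by blast
    \<comment> \<open>The universe contains only the representative of \<open>g\<close>, so x must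
      also witness that \<open>g\<close> and its representative agree.\<close>
    have "\<exists>x\<in>X. (\<forall>p q. (p, q) \<in> {(Ex n \<phi>, ?e), (\<phi>, ?e(n := ultra_rep g))} \<longrightarrow> ultra_correct x p q) \<and>
        (\<forall>a b. (a, b) \<in> {(g, ultra_rep g)} \<longrightarrow> (ultra_eq a b \<longleftrightarrow> a x = b x))"
      using 6(1) eF ultra_rep(1)[OF g(1)] g(1) by (intro pick_eqv) (auto intro: formulas.intros)
    then obtain x where "x \<in> X" "ultra_correct x (Ex n \<phi>) ?e" "ultra_correct x \<phi> (?e(n := ultra_rep g))" "g x = ultra_rep g x"
      using ultra_rep(2)[OF g(1)] by (elim bexE conjE) (rule that, simp_all only: insert_iff simp_thms)
    then have x: "x \<in> X" "W (Ex n \<phi>) ?e \<longleftrightarrow> sat (S x) (Ex n \<phi>) (\<lambda>k. ?e k x)"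
      "W \<phi> (?e(n := ultra_rep g)) \<longleftrightarrow> sat (S x) \<phi> (\<lambda>k. (?e(n := ultra_rep g)) k x)" "g x = ultra_rep g x"
      unfolding ultra_correct_def by blast+
    have "sat (S x) \<phi> (\<lambda>k. (?e(n := g)) k x)" using g(2) x(1,2) Ex by simp
    moreover have "(\<lambda>k. (?e(n := g)) k x) = (\<lambda>k. (?e(n := ultra_rep g)) k x)" using x(4) by auto
    ultimately have "W \<phi> (?e(n := ultra_rep g))" using x(3) by simp
    then show "\<exists>v\<in>ultra_univ. W \<phi> (?e(n := ultra_dec v))"
      using c_rep[OF g(1)] by (intro bexI[of _ "c (ultra_rep g)"]) simp_all
  next
    assume "\<exists>v\<in>ultra_univ. W \<phi> (?e(n := ultra_dec v))"
    then obtain v where v: "v \<in> ultra_univ" "W \<phi> (?e(n := ultra_dec v))" by blast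
    have "\<exists>x\<in>X. \<forall>p q. (p, q) \<in> {(Ex n \<phi>, ?e), (\<phi>, ?e(n := ultra_dec v))} \<longrightarrow> ultra_correct x p q"
      using 6(1) eF dec_univ(1)[OF v(1)] by (intro pick_finite) (auto intro: formulas.intros)
    then obtain x where "x \<in> X" "ultra_correct x (Ex n \<phi>) ?e" "ultra_correct x \<phi> (?e(n := ultra_dec v))" by blast
    then have x: "x \<in> X" "W (Ex n \<phi>) ?e \<longleftrightarrow> sat (S x) (Ex n \<phi>) (\<lambda>k. ?e k x)"
      "sat (S x) \<phi> (\<lambda>k. (?e(n := ultra_dec v)) k x)" using v unfolding ultra_correct_def by blast+
    moreover have "(\<lambda>k. (?e(n := ultra_dec v)) k x) = (\<lambda>k. ?e k x)(n := ultra_dec v x)" by auto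
    ultimately show "W (Ex n \<phi>) ?e" using skolem_funs_univ[OF dec_univ(1)[OF v(1)] x(1)] by auto
  qed
  then show ?case using IH by (simp add: ultra_struct_def)
next
  case (7 \<phi> n)
  let ?e = "\<lambda>k. ultra_dec (e k)"
  note eF = dec_range[OF 7(3)]
  have IH: "sat ultra_struct \<phi> (e(n := v)) \<longleftrightarrow> W \<phi> (?e(n := ultra_dec v))" if "v \<in> ultra_univ" for v
  proof -
    have "range (e(n := v)) \<subseteq> ultra_univ" using 7(3) that by auto
    moreover have "(\<lambda>k. ultra_dec ((e(n := v)) k)) = ?e(n := ultra_dec v)" by auto
    ultimately show ?thesis using 7(2) by simp
  qed
  have "\<not> W (All n \<phi>) ?e \<longleftrightarrow> (\<exists>v\<in>ultra_univ. \<not> W \<phi> (?e(n := ultra_dec v)))"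
  proof
    assume All: "\<not> W (All n \<phi>) ?e"
    \<comment> \<open>A pointwise counterexample to the universal formula is a Skolem witness for
      the negated body.\<close>
    obtain g where g: "g \<in> sk_funs" "\<forall>x\<in>X. (\<exists>v\<in>univ (S x). sat (S x) (Neg \<phi>) ((\<lambda>k. ?e k x)(n := v)))
      \<longrightarrow> sat (S x) (Neg \<phi>) (\<lambda>k. (?e(n := g)) k x)"
      using skolem_funs_witness[OF formulas.intros(3)[OF 7(1)] eF] by blast
    have "\<exists>x\<in>X. (\<forall>p q. (p, q) \<in> {(All n \<phi>, ?e), (\<phi>, ?e(n := ultra_rep g))} \<longrightarrow> ultra_correct x p q) \<and>
        (\<forall>a b. (a, b) \<in> {(g, ultra_rep g)} \<longrightarrow> (ultra_eq a b \<longleftrightarrow> a x = b x))"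
      using 7(1) eF ultra_rep(1)[OF g(1)] g(1) by (intro pick_eqv) (auto intro: formulas.intros)
    then obtain x where "x \<in> X" "ultra_correct x (All n \<phi>) ?e" "ultra_correct x \<phi> (?e(n := ultra_rep g))" "g x = ultra_rep g x"
      using ultra_rep(2)[OF g(1)] by (elim bexE conjE) (rule that, simp_all only: insert_iff simp_thms)
    then have x: "x \<in> X" "W (All n \<phi>) ?e \<longleftrightarrow> sat (S x) (All n \<phi>) (\<lambda>k. ?e k x)"
      "W \<phi> (?e(n := ultra_rep g)) \<longleftrightarrow> sat (S x) \<phi> (\<lambda>k. (?e(n := ultra_rep g)) k x)" "g x = ultra_rep g x"
      unfolding ultra_correct_def by blast+
    have "\<not> sat (S x) \<phi> (\<lambda>k. (?e(n := g)) k x)" using g(2) x(1,2) All by simp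
    moreover have "(\<lambda>k. (?e(n := g)) k x) = (\<lambda>k. (?e(n := ultra_rep g)) k x)" using x(4) by auto
    ultimately have "\<not> W \<phi> (?e(n := ultra_rep g))" using x(3) by simp
    then show "\<exists>v\<in>ultra_univ. \<not> W \<phi> (?e(n := ultra_dec v))"
      using c_rep[OF g(1)] by (intro bexI[of _ "c (ultra_rep g)"]) simp_all
  next
    assume "\<exists>v\<in>ultra_univ. \<not> W \<phi> (?e(n := ultra_dec v))"
    then obtain v where v: "v \<in> ultra_univ" "\<not> W \<phi> (?e(n := ultra_dec v))" by blast
    have "\<exists>x\<in>X. \<forall>p q. (p, q) \<in> {(All n \<phi>, ?e), (\<phi>, ?e(n := ultra_dec v))} \<longrightarrow> ultra_correct x p q"
      using 7(1) eF dec_univ(1)[OF v(1)] by (intro pick_finite) (auto intro: formulas.intros)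
    then obtain x where "x \<in> X" "ultra_correct x (All n \<phi>) ?e" "ultra_correct x \<phi> (?e(n := ultra_dec v))" by blast
    then have x: "x \<in> X" "W (All n \<phi>) ?e \<longleftrightarrow> sat (S x) (All n \<phi>) (\<lambda>k. ?e k x)"
      "\<not> sat (S x) \<phi> (\<lambda>k. (?e(n := ultra_dec v)) k x)" using v unfolding ultra_correct_def by blast+
    moreover have "(\<lambda>k. (?e(n := ultra_dec v)) k x) = (\<lambda>k. ?e k x)(n := ultra_dec v x)" by auto
    ultimately show "\<not> W (All n \<phi>) ?e" using skolem_funs_univ[OF dec_univ(1)[OF v(1)] x(1)] by auto
  qed
  then show ?case using IH by (simp add: ultra_struct_def) blast
qed

end

end

text \<open>Coding the sentences of \<open>T\<close> below \<open>lam\<close> turns x in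
  P_\<kappa>(lam) into the name of a subtheory \<open>Tx x\<close> of size less than \<kappa>, with
  a model \<open>S x\<close>. Covering the code of \<phi> by x puts \<phi> into \<open>Tx x\<close>,
  so \<phi> is accepted in the ultraproduct of these models.\<close>

lemma family_measure_imp_compact:
  fixes \<delta> \<kappa> lam :: "'v::zfc"
  assumes \<delta>: "Card \<delta>" "infinite (elts \<delta>)" and \<delta>lam: "elts \<delta> \<subseteq> elts lam"
    and W: "weak_cpower lam \<delta> = lam" and family_measure: "family_measure \<delta> \<kappa> lam"
  shows "compact_Card \<delta> lam \<kappa>"
  unfolding compact_Card_def
proof (intro allI impI, elim conjE)
  fix L :: "'v lang" and T
  let ?X = "elts (Pkl \<kappa> lam)" and ?K = "elts lam" and ?Fm = "formulas \<delta> L"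
  assume L: "rels L <+> funs L \<lesssim> ?K" and T: "T \<subseteq> sentences \<delta> L"
    and models: "\<forall>T'\<subseteq>T. T' \<prec> elts \<kappa> \<longrightarrow> has_model L T'"
  have inf: "infinite ?K" using \<delta>(2) \<delta>lam finite_subset by blast
  have Fm: "?Fm \<lesssim> ?K" by (rule formulas_lepoll[OF \<delta> \<delta>lam W L])
  have funs: "funs L \<lesssim> ?K"
    by (rule lepoll_trans[OF _ L]) (unfold lepoll_def, rule exI[of _ Inr], auto)
  have TFm: "T \<subseteq> ?Fm" using T by (auto simp: sentences_def)
  obtain g where g: "inj_on g T" "g ` T \<subseteq> ?K"
    using lepoll_trans[OF subset_imp_lepoll[OF TFm] Fm] unfolding lepoll_def by blast
  define Tx where "Tx x = {\<sigma>\<in>T. g \<sigma> \<in> elts x}" for x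
  have "\<forall>x\<in>?X. \<exists>S. is_struct L S \<and> (\<forall>\<phi>\<in>Tx x. \<forall>e. range e \<subseteq> univ S \<longrightarrow> sat S \<phi> e)"
  proof
    fix x assume x: "x \<in> ?X"
    have "Tx x \<lesssim> elts x"
      unfolding lepoll_def using inj_on_subset[OF g(1), of "Tx x"] by (auto simp: Tx_def)
    moreover have "elts x \<prec> elts \<kappa>" using x by (simp add: elts_Pkl)
    ultimately have "Tx x \<prec> elts \<kappa>" by (rule lesspoll_trans1)
    moreover have "Tx x \<subseteq> T" by (auto simp: Tx_def)
    ultimately show "\<exists>S. is_struct L S \<and> (\<forall>\<phi>\<in>Tx x. \<forall>e. range e \<subseteq> univ S \<longrightarrow> sat S \<phi> e)"
      using models unfolding has_model_def by blast
  qed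
  then obtain S where S: "\<And>x. x \<in> ?X \<Longrightarrow> is_struct L (S x)"
    and S_sat: "\<And>x \<phi> e. x \<in> ?X \<Longrightarrow> \<phi> \<in> Tx x \<Longrightarrow> range e \<subseteq> univ (S x) \<Longrightarrow> sat (S x) \<phi> e"
    by metis
  let ?F = "skolem_funs \<delta> L S" and ?d = "sk_default S"
  have F: "?F \<lesssim> ?K" by (rule skolem_funs_lepoll[OF \<delta> S inf funs Fm])
  then obtain c where c: "inj_on c ?F" "c ` ?F \<subseteq> ?K" unfolding lepoll_def by blast
  define P where "P i x = sat (S x) (fst i) (\<lambda>k. env ?d (snd i) k x)" for i :: "'v fm \<times> ('v \<Rightarrow> 'v) list" and x
  have "?Fm \<times> lists ?F \<lesssim> ?K" by (intro times_lepoll_infinite lists_lepoll_infinite inf Fm F)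
  from family_measure_index[OF family_measure \<delta>(2) this, of P] obtain V where V: "\<forall>A\<subseteq>?Fm \<times> lists ?F.
      \<forall>a\<subseteq>?K. A \<prec> elts \<delta> \<longrightarrow> a \<prec> elts \<delta> \<longrightarrow> (\<exists>x\<in>?X. a \<subseteq> elts x \<and> (\<forall>i\<in>A. V i \<longleftrightarrow> P i x))" ..
  \<comment> \<open>An assignment enters only through its finite relevant part; this keeps the index
    set of statements at size at most \<open>lam\<close>.\<close>
  define cd where "cd \<phi> e = (\<phi>, map e [0..<fv_bound \<phi>])" for \<phi> :: "'v fm" and e :: "nat \<Rightarrow> 'v \<Rightarrow> 'v"
  define U where "U \<phi> e = V (cd \<phi> e)" for \<phi> e
  have P_cd: "P (cd \<phi> e) x \<longleftrightarrow> sat (S x) \<phi> (\<lambda>k. e k x)" if "\<phi> \<in> ?Fm" for \<phi> e x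
    unfolding P_def cd_def fst_conv snd_conv
    by (rule sat_cong) (use less_fv_bound[OF that] in \<open>auto simp: env_def\<close>)
  have pick': "\<exists>x\<in>?X. a \<subseteq> elts x \<and> (\<forall>(\<phi>, e)\<in>A. U \<phi> e \<longleftrightarrow> sat (S x) \<phi> (\<lambda>k. e k x))"
    if A: "A \<subseteq> {(\<phi>, e). \<phi> \<in> ?Fm \<and> range e \<subseteq> ?F}" "A \<prec> elts \<delta>" "a \<subseteq> ?K" "a \<prec> elts \<delta>" for A a
  proof -
    have "(\<lambda>(\<phi>, e). cd \<phi> e) ` A \<subseteq> ?Fm \<times> lists ?F"
      using A(1) by (fastforce simp: cd_def)
    from V[rule_format, OF this A(3) lesspoll_trans1[OF image_lepoll A(2)] A(4)]
    obtain x where x: "x \<in> ?X" "a \<subseteq> elts x" "\<forall>i\<in>(\<lambda>(\<phi>, e). cd \<phi> e) ` A. V i \<longleftrightarrow> P i x" by blast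
    have "U \<phi> e \<longleftrightarrow> sat (S x) \<phi> (\<lambda>k. e k x)" if "(\<phi>, e) \<in> A" for \<phi> e
    proof -
      have "\<phi> \<in> ?Fm" using that A(1) by blast
      moreover have "V (cd \<phi> e) \<longleftrightarrow> P (cd \<phi> e) x" using x(3) that by fast
      ultimately show ?thesis by (simp add: U_def P_cd)
    qed
    then show ?thesis using x(1,2) by blast
  qed
  have pick: "\<exists>x\<in>?X. \<forall>(\<phi>, e)\<in>A. U \<phi> e \<longleftrightarrow> sat (S x) \<phi> (\<lambda>k. e k x)"
    if "A \<subseteq> {(\<phi>, e). \<phi> \<in> ?Fm \<and> range e \<subseteq> ?F}" "A \<prec> elts \<delta>" for A
    using pick'[OF that, of "{}"] \<delta>(2) by (auto simp: finite_lesspoll_infinite)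
  let ?N = "ultra_struct \<delta> L S U c"
  have N: "is_struct L ?N" by (rule is_struct_ultra[OF \<delta> S pick c])
  have "sat ?N \<phi> e" if \<phi>: "\<phi> \<in> T" and e: "range e \<subseteq> univ ?N" for \<phi> e
  proof -
    let ?e = "\<lambda>k. ultra_dec \<delta> L S c (e k)"
    have eU: "range e \<subseteq> ultra_univ \<delta> L S U c" using e univ_ultra_struct[OF \<delta> S pick c] by simp
    have eF: "range ?e \<subseteq> ?F" by (rule dec_range[OF \<delta> S pick c eU])
    \<comment> \<open>This x decides \<phi> correctly and contains its code, so \<open>S x\<close>
      is a model of \<phi>.\<close>
    have "\<exists>x\<in>?X. {g \<phi>} \<subseteq> elts x \<and> (\<forall>(\<phi>, e)\<in>{(\<phi>, ?e)}. U \<phi> e \<longleftrightarrow> sat (S x) \<phi> (\<lambda>k. e k x))"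
      using \<phi> TFm eF g(2) \<delta>(2) by (intro pick') (auto simp: finite_lesspoll_infinite)
    then obtain x where x: "x \<in> ?X" "g \<phi> \<in> elts x" "U \<phi> ?e \<longleftrightarrow> sat (S x) \<phi> (\<lambda>k. ?e k x)"
      by auto
    have "range (\<lambda>k. ?e k x) \<subseteq> univ (S x)"
    proof (rule image_subsetI)
      fix k show "?e k x \<in> univ (S x)"
        by (rule skolem_funs_univ[OF \<delta> S subsetD[OF eF rangeI] x(1)])
    qed
    moreover have "\<phi> \<in> Tx x" using x(2) \<phi> by (simp add: Tx_def)
    ultimately have "U \<phi> ?e" using x(3) S_sat[OF x(1)] by blast
    then show ?thesis using los[OF \<delta> S pick c _ eU] \<phi> TFm by blast
  qed
  then show "has_model L T" unfolding has_model_def using N by blast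
qed

section \<open>Applications of compactness\<close>

text \<open>A theory \<open>T'\<close> of fewer than \<kappa> axioms uses fewer than \<kappa> of the
  sentences \<open>\<sigma> \<gamma>\<close> beyond the common theory of all \<open>S x\<close>.
  Choosing one index for each of them gives an x in P_\<kappa>(lam), and \<open>S x\<close> is a
  model of \<open>T'\<close>.\<close>

lemma compact_models:
  assumes comp: "compact_Card \<delta> lam \<kappa>" and L: "rels L <+> funs L \<lesssim> elts lam"
    and S: "\<And>x. x \<in> elts (Pkl \<kappa> lam) \<Longrightarrow> is_struct L (S x)"
    and \<sigma>: "\<And>\<gamma>. \<gamma> \<in> elts lam \<Longrightarrow> \<sigma> \<gamma> \<in> sentences \<delta> L"
    and S_\<sigma>: "\<And>x \<gamma> e. x \<in> elts (Pkl \<kappa> lam) \<Longrightarrow> \<gamma> \<in> elts x \<Longrightarrow> sat (S x) (\<sigma> \<gamma>) e"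
  shows "\<exists>N. is_struct L N \<and>
    (\<forall>\<phi>\<in>sentences \<delta> L. (\<forall>x\<in>elts (Pkl \<kappa> lam). \<forall>e. range e \<subseteq> univ (S x) \<longrightarrow> sat (S x) \<phi> e)
      \<longrightarrow> (\<forall>e. range e \<subseteq> univ N \<longrightarrow> sat N \<phi> e)) \<and>
    (\<forall>\<gamma>\<in>elts lam. \<forall>e. range e \<subseteq> univ N \<longrightarrow> sat N (\<sigma> \<gamma>) e)"
proof -
  let ?X = "elts (Pkl \<kappa> lam)"
  define T0 where "T0 = {\<phi> \<in> sentences \<delta> L. \<forall>x\<in>?X. \<forall>e. range e \<subseteq> univ (S x) \<longrightarrow> sat (S x) \<phi> e}"
  define T where "T = T0 \<union> \<sigma> ` elts lam"
  have "has_model L T'" if T': "T' \<subseteq> T" "T' \<prec> elts \<kappa>" for T'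
  proof -
    have "\<forall>\<phi>\<in>T' - T0. \<exists>\<gamma>\<in>elts lam. \<phi> = \<sigma> \<gamma>" using T'(1) unfolding T_def by blast
    then obtain h where h: "\<forall>\<phi>\<in>T' - T0. h \<phi> \<in> elts lam \<and> \<phi> = \<sigma> (h \<phi>)" by metis
    define x where "x = vset (h ` (T' - T0))"
    have "h ` (T' - T0) \<subseteq> elts lam" using h by blast
    then have el: "elts x = h ` (T' - T0)"
      unfolding x_def by (intro elts_vset small_subset[OF _ small_elts])
    have "elts x \<lesssim> T' - T0" unfolding el by (rule image_lepoll)
    also have "T' - T0 \<lesssim> T'" by (rule subset_imp_lepoll) blast
    finally have "elts x \<prec> elts \<kappa>" using T'(2) by (rule lesspoll_trans1)
    then have x: "x \<in> ?X" using h el by (auto simp: elts_Pkl)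
    have "sat (S x) \<phi> e" if "\<phi> \<in> T'" "range e \<subseteq> univ (S x)" for \<phi> e
    proof (cases "\<phi> \<in> T0")
      case True then show ?thesis using x that by (simp add: T0_def)
    next
      case False
      then have "h \<phi> \<in> elts x" "\<phi> = \<sigma> (h \<phi>)" using that h el by auto
      then show ?thesis using S_\<sigma>[OF x] by metis
    qed
    then show ?thesis unfolding has_model_def using S[OF x] by blast
  qed
  moreover have "T \<subseteq> sentences \<delta> L" using \<sigma> by (auto simp: T_def T0_def)
  ultimately have "has_model L T" using comp L unfolding compact_Card_def by blast
  then obtain N where "is_struct L N" "\<And>\<phi> e. \<phi> \<in> T \<Longrightarrow> range e \<subseteq> univ N \<Longrightarrow> sat N \<phi> e"
    unfolding has_model_def by blast
  then show ?thesis by (intro exI[of _ N]) (auto simp: T_def T0_def)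
qed

text \<open>The logic has conjunctions of families indexed by ordinals; the binary one is indexed by
  the ordinal 2.\<close>

definition fm_and :: "'v::zfc fm \<Rightarrow> 'v fm \<Rightarrow> 'v fm" where
  "fm_and \<phi> \<psi> = Conj two (\<lambda>i\<in>elts two. if i = zero then \<phi> else \<psi>)"

lemma fm_and:
  assumes "Card \<delta>" "infinite (elts \<delta>)" "\<phi> \<in> formulas \<delta> L" "\<psi> \<in> formulas \<delta> L"
  shows "fm_and \<phi> \<psi> \<in> formulas \<delta> L"
  unfolding fm_and_def
proof (rule formulas.intros(4))
  show "two \<in> elts \<delta>"
    by (rule finite_Ord_mem[OF Ord_two _ Card_Ord[OF assms(1)] assms(2)]) (simp add: elts_two)
  show "finite (free_vars (Conj two (\<lambda>i\<in>elts two. if i = zero then \<phi> else \<psi>)))"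
    using finite_free_vars[OF assms(3)] finite_free_vars[OF assms(4)] by (auto simp: elts_two)
qed (use assms in auto)

lemma free_vars_and: "free_vars (fm_and \<phi> \<psi>) = free_vars \<phi> \<union> free_vars \<psi>"
  by (simp add: fm_and_def elts_two one_neq_zero)

lemma sat_and: "sat S (fm_and \<phi> \<psi>) e \<longleftrightarrow> sat S \<phi> e \<and> sat S \<psi> e"
  by (simp add: fm_and_def elts_two one_neq_zero)

lemma (in submodel_setting) omega_subset: "elts omega \<subseteq> elts \<delta>"
proof -
  have sub: "{n :: 'v. Ord n \<and> finite (elts n)} \<subseteq> elts \<delta>"
    using finite_Ord_mem[OF _ _ Card_Ord[OF Cards(1)] infinites(1)] by blast
  then show ?thesis unfolding omega_def elts_vset[OF small_subset[OF sub small_elts]] .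
qed

text \<open>The symbols are nullary relations, and the one-point structure \<open>S x\<close> is the
  principal truth valuation at x. The requirements on \<open>U\<close> other than fineness are
  instances of sentences true in every \<open>S x\<close>, and fineness is supplied by the axioms
  \<open>at (fin \<gamma>)\<close>.\<close>

lemma (in submodel_setting) compact_imp_ultrafilter:
  assumes "compact_Card \<delta> lam \<kappa>"
  shows "\<exists>U. complete_fine_ultrafilter \<delta> M \<kappa> lam U"
proof -
  let ?X = "Pkl \<kappa> lam"
  let ?E = "subsets_in M ?X"
  define L where "L = \<lparr>rels = ?E, funs = {} :: 'v set, rel_arity = \<lambda>_. 0, fun_arity = \<lambda>_. 0\<rparr>"
  define S where "S x = \<lparr>univ = {zero :: 'v}, rel_int = (\<lambda>Y _. x \<in> elts Y), fun_int = (\<lambda>_ _. zero)\<rparr>" for x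
  define fin where "fin \<gamma> = vset {x \<in> elts ?X. \<gamma> \<in> elts x}" for \<gamma>
  define at where "at Y = Rel Y []" for Y :: 'v
  have elts_fin: "elts (fin \<gamma>) = {x \<in> elts ?X. \<gamma> \<in> elts x}" for \<gamma>
    unfolding fin_def by (rule elts_vset[OF small_subset[OF _ small_elts[of ?X]]]) blast
  have fin_E: "fin \<gamma> \<in> ?E" if "\<gamma> \<in> elts lam" for \<gamma>
  proof -
    have "fin \<gamma> \<in> M"
    proof (rule separation_in_M[OF definable_mem[of "Suc (Suc 0)" 0] Pkl_M(1)])
      show "set [\<gamma>] \<subseteq> M" using that lam_sub by auto
      show "fin \<gamma> = vset {x \<in> elts ?X. mem (env ?X [x, ?X, \<gamma>] (Suc (Suc 0))) (env ?X [x, ?X, \<gamma>] 0)}"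
        unfolding env_Cons by (simp add: fin_def mem_def)
    qed
    then show ?thesis by (auto simp: subsets_in_def elts_fin)
  qed
  have elts_compl: "elts (vset (elts ?X - elts Y)) = elts ?X - elts Y" for Y
    by (rule elts_vset[OF small_subset[OF _ small_elts[of ?X]]]) blast
  have compl_E: "vset (elts ?X - elts Y) \<in> ?E" if "Y \<in> ?E" for Y
  proof -
    have "vset (elts ?X - elts Y) \<in> M"
    proof (rule separation_in_M[OF definable_not[OF definable_mem[of 0 "Suc (Suc 0)"]] Pkl_M(1)])
      show "set [Y] \<subseteq> M" using that by (auto simp: subsets_in_def)
      show "vset (elts ?X - elts Y) =
          vset {x \<in> elts ?X. \<not> mem (env ?X [x, ?X, Y] 0) (env ?X [x, ?X, Y] (Suc (Suc 0)))}"
        unfolding env_Cons by (intro arg_cong[of _ _ vset]) (auto simp: mem_def)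
    qed
    then show ?thesis by (auto simp: subsets_in_def elts_compl)
  qed
  have X_E: "?X \<in> ?E" using Pkl_M by (simp add: subsets_in_def)
  have "?E \<lesssim> elts lam"
    by (rule lepoll_trans2[OF subset_imp_lepoll M_size]) (auto simp: subsets_in_def)
  then have L: "rels L <+> funs L \<lesssim> elts lam"
    unfolding L_def by (intro Plus_lepoll_infinite infinites) auto
  have at: "at Y \<in> formulas \<delta> L" if "Y \<in> ?E" for Y
    unfolding at_def by (rule formulas.intros(2)) (use that in \<open>auto simp: L_def\<close>)
  have fv_at [simp]: "free_vars (at Y) = {}" for Y by (simp add: at_def)
  have S_at [simp]: "sat (S x) (at Y) e \<longleftrightarrow> x \<in> elts Y" for x Y e by (simp add: S_def at_def)
  have S: "is_struct L (S x)" for x by (simp add: is_struct_def S_def L_def)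
  have \<sigma>: "at (fin \<gamma>) \<in> sentences \<delta> L" if "\<gamma> \<in> elts lam" for \<gamma>
    using at[OF fin_E[OF that]] by (simp add: sentences_def)
  have S_\<sigma>: "sat (S x) (at (fin \<gamma>)) e" if "x \<in> elts ?X" "\<gamma> \<in> elts x" for x \<gamma> e
    using that by (simp add: elts_fin)
  have "\<exists>N. is_struct L N \<and>
      (\<forall>\<phi>\<in>sentences \<delta> L. (\<forall>x\<in>elts ?X. \<forall>e. range e \<subseteq> univ (S x) \<longrightarrow> sat (S x) \<phi> e)
        \<longrightarrow> (\<forall>e. range e \<subseteq> univ N \<longrightarrow> sat N \<phi> e)) \<and>
      (\<forall>\<gamma>\<in>elts lam. \<forall>e. range e \<subseteq> univ N \<longrightarrow> sat N (at (fin \<gamma>)) e)"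
    by (rule compact_models[OF assms L]; use S \<sigma> S_\<sigma> in blast)
  then obtain N where N: "is_struct L N"
    and all: "\<forall>\<phi>\<in>sentences \<delta> L. (\<forall>x\<in>elts ?X. \<forall>e. range e \<subseteq> univ (S x) \<longrightarrow> sat (S x) \<phi> e)
      \<longrightarrow> (\<forall>e. range e \<subseteq> univ N \<longrightarrow> sat N \<phi> e)"
    and \<sigma>_all: "\<forall>\<gamma>\<in>elts lam. \<forall>e. range e \<subseteq> univ N \<longrightarrow> sat N (at (fin \<gamma>)) e"
    by (elim exE conjE)
  have N_all: "sat N \<phi> e" if "\<phi> \<in> sentences \<delta> L"
    "\<And>x e. x \<in> elts ?X \<Longrightarrow> range e \<subseteq> univ (S x) \<Longrightarrow> sat (S x) \<phi> e" "range e \<subseteq> univ N" for \<phi> e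
    using all that by blast
  have N_fin: "sat N (at (fin \<gamma>)) e" if "\<gamma> \<in> elts lam" "range e \<subseteq> univ N" for \<gamma> e
    using \<sigma>_all that by blast
  obtain n where "n \<in> univ N" using N by (auto simp: is_struct_def)
  then have e: "range (\<lambda>_ :: nat. n) \<subseteq> univ N" by auto
  define U where "U = {Y \<in> ?E. sat N (at Y) (\<lambda>_. n)}"
  have true: "sat N \<phi> (\<lambda>_. n)" if "\<phi> \<in> formulas \<delta> L" "free_vars \<phi> = {}"
    "\<And>x e. x \<in> elts ?X \<Longrightarrow> sat (S x) \<phi> e" for \<phi>
    using that by (intro N_all e) (auto simp: sentences_def)
  note fml = fm_and[OF Cards(1) infinites(1)] formulas.intros(3) at compl_E X_E
  have XU: "?X \<in> U" using true[OF at[OF X_E]] X_E by (simp add: U_def)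
  have empty: "vset {} \<notin> U"
  proof
    assume "vset {} \<in> U"
    then have "vset {} \<in> ?E" "sat N (at (vset {})) (\<lambda>_. n)" by (auto simp: U_def)
    moreover have "sat N (Neg (at (vset {}))) (\<lambda>_. n)"
      using calculation(1) by (intro true fml) (simp_all add: elts_vset)
    ultimately show False by simp
  qed
  have up: "Y \<in> U" if "Y \<in> ?E" "Z \<in> U" "elts Z \<subseteq> elts Y" for Y Z
  proof -
    have "Z \<in> ?E" using that(2) by (simp add: U_def)
    then have "sat N (Neg (fm_and (at Z) (Neg (at Y)))) (\<lambda>_. n)"
      using that by (intro true fml) (auto simp: free_vars_and sat_and)
    then show ?thesis using that by (simp add: U_def sat_and)
  qed
  have inter: "(\<Inter>i\<in>elts \<mu>. elts (Y i)) \<noteq> {}" if \<mu>: "\<mu> \<in> elts \<delta>" and Y: "\<forall>i\<in>elts \<mu>. Y i \<in> U" for \<mu> Y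
  proof
    assume empty: "(\<Inter>i\<in>elts \<mu>. elts (Y i)) = {}"
    \<comment> \<open>The conjunction is formed outside of \<open>M\<close>, so sequences of members
      of \<open>U\<close> that do not belong to \<open>M\<close> are handled as well.\<close>
    let ?\<phi> = "Conj \<mu> (\<lambda>i\<in>elts \<mu>. at (Y i))"
    have "?\<phi> \<in> formulas \<delta> L"
      using \<mu> at Y by (intro formulas.intros(4)) (auto simp: U_def)
    then have "sat N (Neg ?\<phi>) (\<lambda>_. n)"
      using empty by (intro true fml) auto
    then show False using Y by (auto simp: U_def)
  qed
  have filter: "complete_filter \<delta>' ?X ?E U" if "elts \<delta>' \<subseteq> elts \<delta>" for \<delta>'
    unfolding complete_filter_def
  proof (intro conjI ballI allI impI)
    show "U \<subseteq> ?E" by (auto simp: U_def)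
    show "elts Y \<subseteq> elts ?X" if "Y \<in> ?E" for Y using that by (simp add: subsets_in_def)
    show "vset (elts ?X - elts Y) \<in> ?E" if "Y \<in> ?E" for Y by (rule compl_E[OF that])
    show "?X \<in> ?E" "?X \<in> U" "vset {} \<notin> U" by (fact X_E XU empty)+
    show "Y \<in> U" if "Y \<in> ?E" "elts Z \<subseteq> elts Y \<and> Z \<in> U" for Y Z using up that by blast
    show "(\<Inter>i\<in>elts \<mu>. elts (Y i)) \<noteq> {}" if "\<mu> \<in> elts \<delta>'" "\<forall>i\<in>elts \<mu>. Y i \<in> U" for \<mu> Y
      by (rule inter) (use that \<open>elts \<delta>' \<subseteq> elts \<delta>\<close> in auto)
  qed
  have "measures ?X ?E U"
    unfolding measures_def
  proof
    fix Y assume Y: "Y \<in> ?E"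
    have "sat N (Neg (fm_and (Neg (at Y)) (Neg (at (vset (elts ?X - elts Y)))))) (\<lambda>_. n)"
      using Y by (intro true fml) (auto simp: free_vars_and sat_and elts_compl)
    then show "Y \<in> U \<or> vset (elts ?X - elts Y) \<in> U"
      using Y compl_E[OF Y] by (auto simp: U_def sat_and)
  qed
  moreover have "fine M \<kappa> lam U"
    using N_fin[OF _ e] fin_E by (auto simp: fine_def U_def fin_def[symmetric])
  ultimately have "complete_fine_ultrafilter \<delta> M \<kappa> lam U"
    using filter omega_subset unfolding complete_fine_ultrafilter_def M_ultrafilter_def by blast
  then show ?thesis by blast
qed

section \<open>The downward Loewenheim-Skolem theorem\<close>

instance set_fm :: countable
  by countable_datatype

text \<open>Countably many Skolem operations, one for each formula and bound variable, are added to
  the elements of \<open>Z\<close>. Their hull passes the Tarski-Vaught test, because finitely many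
  values of an assignment determine the truth of a formula.\<close>

lemma lowenheim_skolem:
  fixes H :: "'v::zfc set"
  assumes C: "infinite C" and Z: "Z \<subseteq> H" "Z \<lesssim> C" and h: "h \<in> H"
  shows "\<exists>M. Z \<subseteq> M \<and> elementary_submodel M H \<and> M \<lesssim> C"
proof -
  define good where "good \<phi> n xs y \<longleftrightarrow> y \<in> H \<and> set_sat H mem \<phi> ((env h xs)(n := y))" for \<phi> n xs y
  define g where "g s xs = (case s of Inl a \<Rightarrow> a
    | Inr (\<phi>, n) \<Rightarrow> if \<exists>y. good \<phi> n xs y then SOME y. good \<phi> n xs y else h)"
    for s :: "'v + set_fm \<times> nat" and xs
  define M where "M = hull (Z <+> (UNIV :: (set_fm \<times> nat) set)) g"
  have "(UNIV :: (set_fm \<times> nat) set) \<lesssim> (UNIV :: nat set)"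
    unfolding lepoll_def by (rule exI[of _ to_nat]) auto
  then have "(UNIV :: (set_fm \<times> nat) set) \<lesssim> C"
    using C lepoll_trans by (auto simp: infinite_le_lepoll)
  then have MC: "M \<lesssim> C" unfolding M_def by (intro hull_lepoll Plus_lepoll_infinite C Z)
  have ZM: "Z \<subseteq> M"
  proof
    fix a assume "a \<in> Z"
    then have "g (Inl a) [] \<in> M" unfolding M_def by (intro hull.intros) auto
    then show "a \<in> M" by (simp add: g_def)
  qed
  have MH: "M \<subseteq> H"
  proof
    fix y assume "y \<in> M"
    then obtain s xs where s: "y = g s xs" "s \<in> Z <+> (UNIV :: (set_fm \<times> nat) set)"
      unfolding M_def by (cases rule: hull.cases) auto
    show "y \<in> H"
    proof (cases s)
      case (Inl a)
      then show ?thesis using s Z(1) by (auto simp: g_def)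
    next
      case (Inr p)
      obtain \<phi> n where p: "p = (\<phi>, n)" by (cases p)
      have "(SOME y. good \<phi> n xs y) \<in> H" if "\<exists>y. good \<phi> n xs y"
        using someI_ex[OF that] by (simp add: good_def)
      then show ?thesis using h by (simp add: s g_def Inr p)
    qed
  qed
  have "set_sat M mem \<phi> e \<longleftrightarrow> set_sat H mem \<phi> e" if "range e \<subseteq> M" for \<phi> e
    using that
  proof (induction \<phi> arbitrary: e)
    case (Set_Ex n \<phi>)
    have IH: "set_sat M mem \<phi> (e(n := x)) \<longleftrightarrow> set_sat H mem \<phi> (e(n := x))" if "x \<in> M" for x
      using Set_Ex.prems that by (intro Set_Ex.IH) auto
    have "\<exists>x\<in>M. set_sat H mem \<phi> (e(n := x))" if ex: "\<exists>x\<in>H. set_sat H mem \<phi> (e(n := x))"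
    proof -
      define xs where "xs = map e [0..<var_bound \<phi>]"
      have eq: "set_sat H mem \<phi> ((env h xs)(n := y)) \<longleftrightarrow> set_sat H mem \<phi> (e(n := y))" for y
        by (rule set_sat_cong) (auto simp: env_def xs_def)
      have "g (Inr (\<phi>, n)) xs \<in> M"
        unfolding M_def using Set_Ex.prems by (intro hull.intros) (auto simp: xs_def M_def)
      moreover have "good \<phi> n xs (g (Inr (\<phi>, n)) xs)"
      proof -
        have "\<exists>y. good \<phi> n xs y" using ex by (auto simp: good_def eq)
        then show ?thesis using someI_ex[of "good \<phi> n xs"] by (simp add: g_def)
      qed
      ultimately show ?thesis using eq by (auto simp: good_def)
    qed
    then show ?case using IH MH by auto
  qed simp_all
  then have "elementary_submodel M H"
    using MH unfolding elementary_submodel_def elementary_embedding_def by simp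
  then show ?thesis using ZM MC by blast
qed

text \<open>The symbol \<open>zero\<close> serves as the membership relation.\<close>

primrec fm_of :: "set_fm \<Rightarrow> (nat \<Rightarrow> 'v::zfc tm) \<Rightarrow> 'v fm" where
  "fm_of (Set_Mem m n) = (\<lambda>s. Rel zero [s m, s n])"
| "fm_of (Set_Eq m n) = (\<lambda>s. Eq (s m) (s n))"
| "fm_of (Set_Neg \<phi>) = (\<lambda>s. Neg (fm_of \<phi> s))"
| "fm_of (Set_And \<phi> \<psi>) = (\<lambda>s. fm_and (fm_of \<phi> s) (fm_of \<psi> s))"
| "fm_of (Set_Ex n \<phi>) = (\<lambda>s. Ex n (fm_of \<phi> (s(n := Var n))))"

lemma fm_of_formulas:
  assumes "Card \<delta>" "infinite (elts \<delta>)" "zero \<in> rels L" "rel_arity L zero = 2"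
    and "range s \<subseteq> lang_terms L"
  shows "fm_of \<phi> s \<in> formulas \<delta> L"
  using assms(5)
proof (induction \<phi> arbitrary: s)
  case (Set_Ex n \<phi>)
  have "range (s(n := Var n)) \<subseteq> lang_terms L"
    using Set_Ex.prems lang_terms.intros(1) by (auto simp: image_subset_iff)
  then show ?case using Set_Ex.IH by (auto intro: formulas.intros)
qed (use assms in \<open>auto intro!: formulas.intros fm_and simp: image_subset_iff\<close>)

lemma free_vars_fm_of: "free_vars (fm_of \<phi> s) \<subseteq> (\<Union>m. tm_vars (s m))"
proof (induction \<phi> arbitrary: s)
  case (Set_Ex n \<phi>)
  have "free_vars (fm_of \<phi> (s(n := Var n))) \<subseteq> (\<Union>m. tm_vars ((s(n := Var n)) m))" by (rule Set_Ex)
  also have "\<dots> \<subseteq> insert n (\<Union>m. tm_vars (s m))" by (auto split: if_splits)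
  finally show ?case by auto
qed (auto simp: free_vars_and)

text \<open>A quantifier could capture a variable that was substituted for a different one. Leaving
  a variable as it is or replacing it by a constant is harmless.\<close>

lemma sat_fm_of:
  assumes "\<And>m. s m = Var m \<or> (\<exists>c. s m = Fun c [])"
  shows "sat S (fm_of \<phi> s) e \<longleftrightarrow>
    set_sat (univ S) (\<lambda>a b. rel_int S zero [a, b]) \<phi> (\<lambda>m. tm_val S e (s m))"
  using assms
proof (induction \<phi> arbitrary: s e)
  case (Set_Ex n \<phi>)
  have "(\<lambda>m. tm_val S (e(n := x)) ((s(n := Var n)) m)) = (\<lambda>m. tm_val S e (s m))(n := x)" for x
  proof
    fix m
    show "tm_val S (e(n := x)) ((s(n := Var n)) m) = ((\<lambda>m. tm_val S e (s m))(n := x)) m"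
      using Set_Ex.prems[of m] by auto
  qed
  moreover have "sat S (fm_of \<phi> (s(n := Var n))) (e(n := x)) \<longleftrightarrow> set_sat (univ S)
      (\<lambda>a b. rel_int S zero [a, b]) \<phi> (\<lambda>m. tm_val S (e(n := x)) ((s(n := Var n)) m))" for x
    by (rule Set_Ex.IH) (use Set_Ex.prems in auto)
  ultimately show ?case by simp
qed (simp_all add: sat_and)

text \<open>Over one fixed structure, the new constant \<open>d\<close> is interpreted by each x in
  P_\<kappa>(lam). The common theory of these expansions contains the elementary diagram of
  \<open>M\<close>, the statement that \<open>d\<close> has size less than \<kappa>, and for every
  \<beta> < \<delta> an infinitary sentence listing the elements of \<beta>.\<close>

lemma (in submodel_setting) compact_imp_embedding:
  assumes comp: "compact_Card \<delta> lam \<kappa>"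
  shows "\<exists>j N R D. covering_embedding \<delta> M \<kappa> lam j N R D"
proof -
  let ?X = "Pkl \<kappa> lam" and ?W = "elts (weak_cpower lam \<kappa>)" and ?H = "Hset \<theta>"
  have lamW: "elts lam \<lesssim> ?W" by (rule lepoll_weak_cpower[OF Cards(2) infinites(2)])
  then have infW: "infinite ?W" using infinites(3) by (meson inj_on_finite lepoll_def)
  have "M \<union> elts ?X \<lesssim> ?W"
    using lepoll_trans1[OF M_size lamW] Pkl_lepoll[OF Cards(2) infinites(2) \<kappa>lam]
    by (intro Un_lepoll_infinite infW)
  moreover have "M \<union> elts ?X \<subseteq> ?H" using MH Hset_mem[OF Pkl_H] by blast
  \<comment> \<open>An x in P_\<kappa>(lam) need not belong to \<open>M\<close>. The common
    structure is therefore a larger elementary submodel of H(\<theta>), still small enough to be a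
    set.\<close>
  ultimately obtain M' where M': "M \<union> elts ?X \<subseteq> M'" "elementary_submodel M' ?H" "M' \<lesssim> ?W"
    using lowenheim_skolem[OF infW] MH[OF lam_M] by metis
  have sM': "small M'" by (rule small_lepoll[OF M'(3)])
  have emb': "elementary_embedding id M' mem ?H mem"
    using M'(2) by (simp add: elementary_submodel_def)
  \<comment> \<open>As the set of all elements of \<open>M'\<close>, the symbol \<open>d\<close> is
    not an element of \<open>M'\<close>, so it differs from all constants naming elements of
    \<open>M\<close>.\<close>
  define d where "d = vset M'"
  have dM: "d \<notin> M" using M'(1) mem_irrefl[of d] elts_vset[OF sM'] by (auto simp: d_def)
  define L where "L = \<lparr>rels = {zero :: 'v}, funs = insert d M, rel_arity = \<lambda>_. 2, fun_arity = \<lambda>_. 0\<rparr>"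
  define S where "S x = \<lparr>univ = M', rel_int = (\<lambda>_ vs. mem (vs ! 0) (vs ! 1)),
    fun_int = (\<lambda>c _. if c = d then x else c)\<rparr>" for x
  define cst :: "'v \<Rightarrow> 'v tm" where "cst c = Fun c []" for c
  have "{d} \<union> M \<lesssim> elts lam"
    using M_size infinites(3) by (intro Un_lepoll_infinite) (auto simp: finite_lepoll_infinite eqpoll_imp_lepoll)
  then have L: "rels L <+> funs L \<lesssim> elts lam"
    unfolding L_def using infinites(3) by (intro Plus_lepoll_infinite) (auto simp: finite_lepoll_infinite)
  have S: "is_struct L (S x)" if "x \<in> elts ?X" for x
    using M'(1) that sM' lam_M by (auto simp: is_struct_def S_def L_def)
  have cst: "cst c \<in> lang_terms L" if "c \<in> insert d M" for c
    unfolding cst_def by (rule lang_terms.intros) (use that in \<open>auto simp: L_def\<close>)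
  have tv_cst [simp]: "tm_vars (cst c) = {}" for c by (simp add: cst_def)
  have val_cst: "tm_val T e (cst c) = fun_int T c []" for T e c by (simp add: cst_def)
  have S_cst: "tm_val (S x) e (cst c) = (if c = d then x else c)" for x e c by (simp add: val_cst S_def)
  have zero_L: "zero \<in> rels L" "rel_arity L zero = 2" by (auto simp: L_def)
  define \<sigma> where "\<sigma> \<gamma> = Rel zero [cst \<gamma>, cst d]" for \<gamma>
  have \<sigma>: "\<sigma> \<gamma> \<in> sentences \<delta> L" if "\<gamma> \<in> elts lam" for \<gamma>
  proof -
    have "cst \<gamma> \<in> lang_terms L" "cst d \<in> lang_terms L" using that lam_sub cst by blast+
    then show ?thesis
      unfolding \<sigma>_def sentences_def by (auto intro!: formulas.intros simp: zero_L)
  qed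
  have S_\<sigma>: "sat (S x) (\<sigma> \<gamma>) e" if "x \<in> elts ?X" "\<gamma> \<in> elts x" for x \<gamma> e
  proof -
    have "\<gamma> \<in> M" using that lam_sub by (auto simp: elts_Pkl)
    then have "\<gamma> \<noteq> d" using dM by blast
    then show ?thesis using that by (simp add: \<sigma>_def S_cst) (simp add: S_def mem_def)
  qed
  have "\<exists>N. is_struct L N \<and>
      (\<forall>\<phi>\<in>sentences \<delta> L. (\<forall>x\<in>elts ?X. \<forall>e. range e \<subseteq> univ (S x) \<longrightarrow> sat (S x) \<phi> e)
        \<longrightarrow> (\<forall>e. range e \<subseteq> univ N \<longrightarrow> sat N \<phi> e)) \<and>
      (\<forall>\<gamma>\<in>elts lam. \<forall>e. range e \<subseteq> univ N \<longrightarrow> sat N (\<sigma> \<gamma>) e)"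
    by (rule compact_models[OF comp L]; use S \<sigma> S_\<sigma> in blast)
  then obtain N where N: "is_struct L N"
    and all: "\<forall>\<phi>\<in>sentences \<delta> L. (\<forall>x\<in>elts ?X. \<forall>e. range e \<subseteq> univ (S x) \<longrightarrow> sat (S x) \<phi> e)
      \<longrightarrow> (\<forall>e. range e \<subseteq> univ N \<longrightarrow> sat N \<phi> e)"
    and \<sigma>_all: "\<forall>\<gamma>\<in>elts lam. \<forall>e. range e \<subseteq> univ N \<longrightarrow> sat N (\<sigma> \<gamma>) e"
    by (elim exE conjE)
  have N_all: "sat N \<phi> e" if "\<phi> \<in> sentences \<delta> L"
    "\<And>x e. x \<in> elts ?X \<Longrightarrow> range e \<subseteq> univ (S x) \<Longrightarrow> sat (S x) \<phi> e" "range e \<subseteq> univ N" for \<phi> e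
    using all that by blast
  have N_\<sigma>: "sat N (\<sigma> \<gamma>) e" if "\<gamma> \<in> elts lam" "range e \<subseteq> univ N" for \<gamma> e
    using \<sigma>_all that by blast
  obtain n where "n \<in> univ N" using N by (auto simp: is_struct_def)
  then have n: "range (\<lambda>_ :: nat. n) \<subseteq> univ N" by auto
  define R where "R a b = rel_int N zero [a, b]" for a b
  define j where "j c = fun_int N c []" for c
  have jN: "j c \<in> univ N" if "c \<in> insert d M" for c
    using N that unfolding is_struct_def j_def L_def by auto
  have true: "sat N \<phi> (\<lambda>_. n)" if "\<phi> \<in> formulas \<delta> L" "free_vars \<phi> = {}"
    "\<And>x e. x \<in> elts ?X \<Longrightarrow> range e \<subseteq> M' \<Longrightarrow> sat (S x) \<phi> e" for \<phi>
    using that by (intro N_all n) (auto simp: sentences_def S_def)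
  have transfer: "set_sat (univ N) R \<phi> (\<lambda>m. j (e m))"
    if e: "range e \<subseteq> insert d M"
      and sat: "\<And>x. x \<in> elts ?X \<Longrightarrow> set_sat M' mem \<phi> (\<lambda>m. if e m = d then x else e m)" for \<phi> e
  proof -
    let ?\<phi> = "fm_of \<phi> (\<lambda>m. cst (e m))"
    have "sat N ?\<phi> (\<lambda>_. n)"
    proof (rule true)
      show "?\<phi> \<in> formulas \<delta> L"
        using e cst by (intro fm_of_formulas Cards infinites zero_L) auto
      show "free_vars ?\<phi> = {}" using free_vars_fm_of[of \<phi> "\<lambda>m. cst (e m)"] by auto
      fix x and e' :: "nat \<Rightarrow> 'v" assume x: "x \<in> elts ?X"
      have "sat (S x) ?\<phi> e' \<longleftrightarrow> set_sat M' mem \<phi> (\<lambda>m. if e m = d then x else e m)"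
        by (subst sat_fm_of) (simp_all add: cst_def, simp add: S_def)
      then show "sat (S x) ?\<phi> e'" using sat[OF x] by simp
    qed
    then show ?thesis
      by (subst (asm) sat_fm_of) (simp_all add: cst_def j_def[symmetric] R_def[symmetric])
  qed
  have elem: "elementary_embedding j M mem (univ N) R"
    unfolding elementary_embedding_def
  proof (intro conjI allI impI)
    show "j ` M \<subseteq> univ N" using jN by auto
    fix \<phi> and e :: "nat \<Rightarrow> 'v" assume e: "range e \<subseteq> M"
    have ed: "e m \<noteq> d" for m using e dM by auto
    have e': "range e \<subseteq> insert d M" "range e \<subseteq> M'" using e M'(1) by auto
    have eq: "set_sat M mem \<phi> e \<longleftrightarrow> set_sat M' mem \<phi> e" for \<phi>
      using emb_id emb' e e'(2) unfolding elementary_embedding_def by simp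
    have pos: "set_sat (univ N) R \<phi> (j \<circ> e)" if "set_sat M mem \<phi> e" for \<phi>
      using transfer[OF e'(1), of \<phi>] that by (simp add: eq ed o_def)
    show "set_sat M mem \<phi> e \<longleftrightarrow> set_sat (univ N) R \<phi> (j \<circ> e)"
      \<comment> \<open>Transfer is one-directional; applying it to the negated formula gives the
        converse.\<close>
      using pos[of \<phi>] pos[of "Set_Neg \<phi>"] by auto
  qed
  have cover: "R (j \<gamma>) (j d)" if "\<gamma> \<in> elts lam" for \<gamma>
    using N_\<sigma>[OF that n] by (simp add: \<sigma>_def val_cst R_def j_def)
  have card: "int_card_less (univ N) R (j d) (j \<kappa>)"
  proof -
    obtain \<phi> where \<phi>: "\<And>(A :: 'v set) R e. range e \<subseteq> A \<Longrightarrow> set_sat A R \<phi> e = int_card_less A R (e 0) (e (Suc 0))"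
      using definable_card_less[of 0 "Suc 0"] unfolding definable_def by blast
    let ?e = "\<lambda>m. if m = 0 then d else \<kappa>"
    have \<kappa>d: "\<kappa> \<noteq> d" using \<kappa>_M dM by blast
    have "set_sat (univ N) R \<phi> (\<lambda>m. j (?e m))"
    proof (rule transfer)
      fix x assume x: "x \<in> elts ?X"
      then have "int_card_less ?H mem x \<kappa>"
        using Hset_int_card_less[OF reg Hset_mem[OF Pkl_H x] Cards(2) MH[OF \<kappa>_M]] by (simp add: elts_Pkl)
      then have less: "int_card_less M' mem x \<kappa>"
        using elementary_embeddingD_list[OF emb' definable_card_less[of 0 "Suc 0"], of x "[\<kappa>]"] x M'(1) \<kappa>_M
        by auto
      have rng: "range (\<lambda>m. if ?e m = d then x else ?e m) \<subseteq> M'" using x \<kappa>_M M'(1) by auto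
      show "set_sat M' mem \<phi> (\<lambda>m. if ?e m = d then x else ?e m)"
        unfolding \<phi>[OF rng] using \<kappa>d less by simp
    qed (use \<kappa>_M in auto)
    moreover have rng: "range (\<lambda>m. j (?e m)) \<subseteq> univ N" using jN \<kappa>_M by auto
    ultimately show ?thesis using \<phi>[OF rng, of R] by simp
  qed
  have fixd: "\<exists>\<alpha>\<in>elts \<beta>. z = j \<alpha>" if \<beta>: "\<beta> \<in> elts \<delta>" and z: "z \<in> univ N" "R z (j \<beta>)" for \<beta> z
  proof -
    have \<beta>M: "elts \<beta> \<subseteq> M" "\<beta> \<in> M"
      using \<beta> Ord_subset[OF Card_Ord[OF Cards(1)] \<beta>] \<delta>\<kappa> \<kappa>lam lam_sub by blast+
    \<comment> \<open>Since \<beta> < \<delta>, the disjunction over the elements of \<beta> is a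
      formula of the logic. It forces every element of \<open>j \<beta>\<close> in N to be a value
      of \<open>j\<close>, which places the critical point at or above \<delta>.\<close>
    let ?\<psi> = "Disj \<beta> (\<lambda>\<alpha>\<in>elts \<beta>. Eq (Var 0) (cst \<alpha>))"
    let ?\<phi> = "Neg (Ex 0 (fm_and (Rel zero [Var 0, cst \<beta>]) (Neg ?\<psi>)))"
    have fv: "free_vars ?\<psi> \<subseteq> {0}" by auto
    have \<psi>: "?\<psi> \<in> formulas \<delta> L"
    proof (rule formulas.intros(5)[OF \<beta>])
      show "finite (free_vars ?\<psi>)" using fv finite_subset by blast
    qed (use \<beta>M cst in \<open>auto intro!: formulas.intros lang_terms.intros(1)\<close>)
    have "sat N ?\<phi> (\<lambda>_. n)"
    proof (rule true)
      show "?\<phi> \<in> formulas \<delta> L"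
        using \<psi> cst \<beta>M zero_L
        by (auto intro!: formulas.intros fm_and Cards infinites lang_terms.intros(1))
      show "free_vars ?\<phi> = {}" using fv by (auto simp: free_vars_and)
      fix x and e :: "nat \<Rightarrow> 'v"
      have "\<alpha> \<noteq> d" if "\<alpha> \<in> insert \<beta> (elts \<beta>)" for \<alpha> using that \<beta>M dM by blast
      then show "sat (S x) ?\<phi> e"
        by (auto simp: sat_and S_cst) (auto simp: S_def mem_def)
    qed
    then have "\<exists>\<alpha>\<in>elts \<beta>. z = tm_val N ((\<lambda>_. n)(0 := z)) (cst \<alpha>)"
      using z by (auto simp: sat_and R_def j_def val_cst)
    then show ?thesis by (simp add: val_cst j_def)
  qed
  have unmoved: "{z \<in> univ N. R z (j \<beta>)} = j ` (elts \<beta> \<inter> M)"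
    if "\<not> moved j M (univ N) R \<beta>" "Ord \<beta>" "\<beta> \<in> M" for \<beta>
  proof -
    have "j ` (elts \<beta> \<inter> M) \<subseteq> {z \<in> univ N. R z (j \<beta>)}"
      using elementary_embedding_rel[OF elem _ that(3)] elementary_embedding_in[OF elem]
      by (auto simp: mem_def)
    then show ?thesis using that unfolding moved_def by blast
  qed
  \<comment> \<open>If no ordinal were moved, the N-cardinality of \<open>j d\<close> would be
    \<open>j \<mu>\<close> for some \<mu> < \<kappa>, with exactly the images of the elements of
    \<mu> below it. The bijection in N would then inject \<open>lam\<close> into \<mu>.\<close>
  have "\<exists>\<gamma>. moved j M (univ N) R \<gamma>"
  proof (rule ccontr)
    assume "\<not> ?thesis"
    then have ext: "{z \<in> univ N. R z (j \<beta>)} = j ` (elts \<beta> \<inter> M)" if "Ord \<beta>" "\<beta> \<in> M" for \<beta>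
      using unmoved that by blast
    obtain m f where m: "m \<in> univ N" "R m (j \<kappa>)" "int_bij (univ N) R f (j d) m"
      using card unfolding int_card_less_def int_is_card_def int_eqpoll_def by blast
    obtain \<mu> where \<mu>: "\<mu> \<in> elts \<kappa>" "\<mu> \<in> M" "m = j \<mu>"
      using ext[OF Card_Ord[OF Cards(2)] \<kappa>_M] m by blast
    have "elts lam \<lesssim> j ` elts lam"
      using inj_on_subset[OF elementary_embedding_inj[OF elem] lam_sub]
      by (simp add: inj_on_image_eqpoll_self eqpoll_imp_lepoll eqpoll_sym)
    also have "j ` elts lam \<lesssim> {a \<in> univ N. R a (j d)}"
      using cover jN lam_sub by (intro subset_imp_lepoll) auto
    also have "\<dots> \<approx> {z \<in> univ N. R z m}" by (rule int_bij_iff[OF m(3)])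
    also have "{z \<in> univ N. R z m} = j ` (elts \<mu> \<inter> M)"
      unfolding \<mu>(3) by (rule ext[OF Ord_in_Ord[OF Card_Ord[OF Cards(2)] \<mu>(1)] \<mu>(2)])
    also have "j ` (elts \<mu> \<inter> M) \<lesssim> elts \<mu> \<inter> M" by (rule image_lepoll)
    also have "elts \<mu> \<inter> M \<lesssim> elts \<mu>" by (rule subset_imp_lepoll) blast
    finally have "elts lam \<lesssim> elts \<mu>" .
    moreover have "elts \<mu> \<prec> elts lam"
      by (rule lesspoll_trans2[OF Card_mem_lesspoll[OF Cards(2) \<mu>(1)] subset_imp_lepoll[OF \<kappa>lam]])
    ultimately show False using not_lepoll_iff_lesspoll by blast
  qed
  then obtain \<gamma>0 where "moved j M (univ N) R \<gamma>0" ..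
  then have "\<exists>\<gamma>. is_crit j M (univ N) R \<gamma>"
  proof (induction \<gamma>0 rule: eps_induct)
    case (1 \<gamma>)
    then show ?case unfolding is_crit_def by blast
  qed
  then obtain \<gamma> where \<gamma>: "is_crit j M (univ N) R \<gamma>" ..
  have "elts \<delta> \<subseteq> elts \<gamma>"
  proof (rule Ord_not_mem[OF Card_Ord[OF Cards(1)]])
    show "Ord \<gamma>" using \<gamma> by (simp add: is_crit_def moved_def)
    show "\<gamma> \<notin> elts \<delta>"
    proof
      assume "\<gamma> \<in> elts \<delta>"
      moreover have "elts \<gamma> \<subseteq> M"
        using Ord_subset[OF Card_Ord[OF Cards(1)] \<open>\<gamma> \<in> elts \<delta>\<close>] \<delta>\<kappa> \<kappa>lam lam_sub by blast
      ultimately have "{z \<in> univ N. R z (j \<gamma>)} \<subseteq> j ` (elts \<gamma> \<inter> M)"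
        using fixd by blast
      then show False using \<gamma> unfolding is_crit_def moved_def by blast
    qed
  qed
  then have "crit_ge j M (univ N) R \<delta>" unfolding crit_ge_def using \<gamma> by blast
  then have "covering_embedding \<delta> M \<kappa> lam j (univ N) R (j d)"
    unfolding covering_embedding_def using N elem cover card jN by (auto simp: is_struct_def)
  then show ?thesis by blast
qed

text \<open>Keeps the quantifier over M from being vacuous; otherwise a suitable \<theta> would give
  no information about \<kappa>.\<close>

lemma ex_good_submodel:
  assumes \<kappa>: "uncountable_Card \<kappa>" and lam: "uncountable_Card lam" and \<theta>: "regular_above \<kappa> lam \<theta>"
  shows "\<exists>M. good_submodel lam \<theta> M"
proof -
  have reg: "regular \<theta>" and W\<theta>: "weak_cpower lam \<kappa> \<in> elts \<theta>" using \<theta> by (auto simp: regular_above_def)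
  note Card = regular_Card[OF reg]
  have inf: "infinite (elts lam)" "infinite (elts \<kappa>)" and Cl: "Card lam" "Card \<kappa>"
    using lam \<kappa> by (auto simp: uncountable_Card_def countable_finite)
  have lt: "elts lam \<prec> elts \<theta>"
    by (rule lesspoll_trans1[OF lepoll_weak_cpower[OF Cl(2) inf(2)] Card_mem_lesspoll[OF Card W\<theta>]])
  have "lam \<in> elts \<theta>"
  proof (rule ccontr)
    assume "lam \<notin> elts \<theta>"
    then have "elts \<theta> \<lesssim> elts lam"
      by (rule subset_imp_lepoll[OF Ord_not_mem[OF Card_Ord[OF Card] Card_Ord[OF Cl(1)]]])
    then show False using lt not_lepoll_iff_lesspoll by blast
  qed
  then have lamH: "lam \<in> Hset \<theta>" by (rule Hset_Ord[OF Card])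
  have "{lam} \<union> elts lam \<lesssim> elts lam"
    using inf by (intro Un_lepoll_infinite) (auto simp: finite_lepoll_infinite)
  moreover have "{lam} \<union> elts lam \<subseteq> Hset \<theta>" using lamH Hset_mem[OF lamH] by blast
  ultimately obtain M where M: "{lam} \<union> elts lam \<subseteq> M" "elementary_submodel M (Hset \<theta>)" "M \<lesssim> elts lam"
    using lowenheim_skolem[OF inf(1) _ _ lamH] by metis
  moreover have "M \<approx> elts lam"
    by (rule lepoll_antisym[OF M(3) subset_imp_lepoll]) (use M(1) in blast)
  ultimately show ?thesis unfolding good_submodel_def by auto
qed

theorem corollary26:
  fixes \<delta> \<kappa> lam :: "'v::zfc"
  assumes "uncountable_Card \<delta>" and "uncountable_Card \<kappa>" and "uncountable_Card lam"
    and "elts \<delta> \<subseteq> elts \<kappa>" and "elts \<kappa> \<subseteq> elts lam"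
    and "regular \<delta>"
    and "weak_cpower lam \<delta> = lam"
  shows
    "(compact_Card \<delta> lam \<kappa> \<longleftrightarrow>
        (\<forall>\<theta>. regular_above \<kappa> lam \<theta> \<longrightarrow>
           (\<forall>M. good_submodel lam \<theta> M \<longrightarrow> (\<exists>U. complete_fine_ultrafilter \<delta> M \<kappa> lam U)))) \<and>
     (compact_Card \<delta> lam \<kappa> \<longleftrightarrow>
        (\<exists>\<theta>. regular_above \<kappa> lam \<theta> \<and>
           (\<forall>M. good_submodel lam \<theta> M \<longrightarrow> (\<exists>U. complete_fine_ultrafilter \<delta> M \<kappa> lam U)))) \<and>
     (\<forall>\<theta> M. regular_above \<kappa> lam \<theta> \<and> good_submodel lam \<theta> M \<longrightarrow>
        ((\<exists>U. complete_fine_ultrafilter \<delta> M \<kappa> lam U) \<longleftrightarrow>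
         (\<exists>j N R D. covering_embedding \<delta> M \<kappa> lam j N R D)))"
proof -
  have Cards: "Card \<delta>" "Card \<kappa>" "infinite (elts \<delta>)" "infinite (elts \<kappa>)"
    using assms(1,2) by (auto simp: uncountable_Card_def countable_finite)
  have family_measure: "family_measure \<delta> \<kappa> lam \<Longrightarrow> compact_Card \<delta> lam \<kappa>"
    using assms by (intro family_measure_imp_compact Cards) auto
  have equiv: "compact_Card \<delta> lam \<kappa> \<longleftrightarrow> (\<exists>U. complete_fine_ultrafilter \<delta> M \<kappa> lam U)"
    "compact_Card \<delta> lam \<kappa> \<longleftrightarrow> (\<exists>j N R D. covering_embedding \<delta> M \<kappa> lam j N R D)"
    if "regular_above \<kappa> lam \<theta>" "good_submodel lam \<theta> M" for \<theta> M
  proof -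
    interpret submodel_setting \<delta> \<kappa> lam \<theta> M by unfold_locales (use assms that in auto)
    show "compact_Card \<delta> lam \<kappa> \<longleftrightarrow> (\<exists>U. complete_fine_ultrafilter \<delta> M \<kappa> lam U)"
      using compact_imp_ultrafilter family_measure_if_ultrafilter family_measure by blast
    show "compact_Card \<delta> lam \<kappa> \<longleftrightarrow> (\<exists>j N R D. covering_embedding \<delta> M \<kappa> lam j N R D)"
      using compact_imp_embedding family_measure_if_embedding[OF assms(7)] family_measure by blast
  qed
  \<comment> \<open>Likewise, the version for all \<theta> yields compactness only through some
    actual \<theta>. The weak power is an ordinal because it is a union of cardinals, so a regular
    cardinal exists above it.\<close>
  have "\<exists>\<theta>. regular_above \<kappa> lam \<theta>"
  proof -
    have "elts \<kappa> \<lesssim> elts (weak_cpower lam \<kappa>)"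
      by (rule lepoll_trans[OF subset_imp_lepoll[OF assms(5)] lepoll_weak_cpower[OF Cards(2,4)]])
    then have "infinite (elts (weak_cpower lam \<kappa>))"
      using Cards(4) by (meson inj_on_finite lepoll_def)
    moreover have "Ord (weak_cpower lam \<kappa>)"
    proof -
      have "Ord (vset (elts (weak_cpower lam \<kappa>)))"
      proof (rule Ord_vset[OF small_elts])
        fix x assume "x \<in> elts (weak_cpower lam \<kappa>)"
        then obtain \<mu> where \<mu>: "\<mu> \<in> elts \<kappa>" "Card \<mu>" "x \<in> elts (cpower lam \<mu>)"
          by (auto simp: elts_weak_cpower)
        note Ord = Card_Ord[OF cpower_props(1)]
        show "Ord x" by (rule Ord_in_Ord[OF Ord \<mu>(3)])
        show "y \<in> elts (weak_cpower lam \<kappa>)" if "y \<in> elts x" for y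
          using \<mu> Ord_trans[OF Ord \<mu>(3) that] by (auto simp: elts_weak_cpower)
      qed
      then show ?thesis by simp
    qed
    ultimately show ?thesis using ex_regular_above unfolding regular_above_def by blast
  qed
  then obtain \<theta> where \<theta>: "regular_above \<kappa> lam \<theta>" ..
  have ex: "\<exists>M. good_submodel lam \<theta> M" if "regular_above \<kappa> lam \<theta>" for \<theta>
    by (rule ex_good_submodel[OF assms(2,3) that])
  show ?thesis
    using \<theta> ex equiv by (intro conjI allI iffI impI) meson+
qed

end
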